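(* Let $(\Omega,\Sigma,\mu)$ and $(\Delta,\Gamma,\nu)$ be $\sigma$-finite measure spaces, let $X_1(\mu),X_2(\mu)$ be saturated Banach function spaces over $\mu$ and $Y_1(\nu),Y_2(\nu)$ saturated Banach function spaces over $\nu$, and let $T\colon X_1(\mu)\to Y_1(\nu)$ and $S\colon X_2(\mu)\to Y_2(\nu)$ be nontrivial continuous linear operators. Assume that $Y_1(\nu)'$ has a Schauder basis $(\gamma_n)$ and $X_1(\mu)$ has a Schauder basis $(\beta_n)$. Assume that $Y_2^{Y_1''}$ is saturated and that $Y_2(\nu)$ or $Y_1(\nu)'$ is $\sigma$-order continuous. Given $h\in X_1^{X_2}$, the following are equivalent: (a) $T$ factors strongly through $S$ and $M_h$, i.e. there exists $g\in Y_2^{Y_1''}$ with $T(x)=g\,S(hx)$ for all $x\in X_1(\mu)$. (b) There exists $g\in Y_2^{Y_1''}$ such that $T(\beta_n)=g\,S(h\beta_n)$ for each $n\in\mathbb{N}$. (c) There exists $C>0$ such that $$\sum_{i=1}^n\sum_{j=1}^m r_{ij}\int T(\beta_j)\gamma_i\,d\nu\le C\Big\Vert\sum_{i=1}^n\sum_{j=1}^m r_{ij}S(h\beta_j)\gamma_i\Big\Vert_{Y_2\pi Y_1'}$$ for all $n,m\in\mathbb{N}$ and all real $(r_{ij})$ with $|r_{ij}|\le1$. Moreover, if $Y_2(\nu)\subset Y_1(\nu)''$ and the functions $(\gamma_n)$ have pairwise disjoint supports, then the condition (d) there exists $C>0$ such that $\sum_{j=1}^m r_j\int T(\beta_j)\gamma_n\,d\nu\le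 C\int\big|\sum_{j=1}^m r_jS(h\beta_j)\gamma_n\big|\,d\nu$ for all $n,m\in\mathbb{N}$ and all real $(r_j)$ with $|r_j|\le1$ implies (a)–(c). If, in addition to these, $Y_2^{Y_1''}=L^\infty(\nu)$, then (d) is equivalent to (a)–(c).
   Context: A Banach function space $X(\mu)$ is a Banach space $X(\mu)\subset L^0(\mu)$ (measurable functions mod a.e. equality) with norm such that $|f|\le|g|$ a.e., $g\in X(\mu)$ imply $f\in X(\mu)$ and $\Vert f\Vert_X\le\Vert g\Vert_X$; it is saturated if no set $A$ of positive measure satisfies $f\chi_A=0$ a.e. for all $f\in X(\mu)$; it is $\sigma$-order continuous if $f_n\downarrow 0$ a.e. with $f_n\in X(\mu)$ implies $\Vert f_n\Vert_X\downarrow0$. $X^Y=\{h: fh\in Y\ \forall f\in X\}$ with norm $\sup_{f\in B_X}\Vert hf\Vert_Y$; $X'=X^{L^1}$ (Köthe dual), $X''=(X')'$. The $\pi$-product $X\pi Y$ is the space of $h$ with $|h|\le\sum_n|f_ng_n|$ a.e. for some $f_n\in X$, $g_n\in Y$, $\sum_n\Vert f_n\Vert_X\Vert g_n\Vert_Y<\infty$, with norm the infimum of $\sum_n\Vert f_n\Vert_X\Vert g_n\Vert_Y$. *)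

theory Defs
  imports "HOL-Analysis.Analysis"
begin

text \<open>Elements of L^0(mu) are represented by Borel measurable real functions; all
  notions below respect equality almost everywhere.  A function space is given by a
  pair (X, nX) of a set of representatives and a norm.\<close>

definition bfs :: "'a measure \<Rightarrow> ('a \<Rightarrow> real) set \<Rightarrow> (('a \<Rightarrow> real) \<Rightarrow> real) \<Rightarrow> bool" where
  "bfs M X nX \<longleftrightarrow>
     X \<subseteq> borel_measurable M \<and>
     (\<lambda>_. 0) \<in> X \<and>
     (\<forall>f\<in>X. \<forall>g\<in>X. (\<lambda>x. f x + g x) \<in> X) \<and>
     (\<forall>f\<in>X. \<forall>c. (\<lambda>x. c * f x) \<in> X) \<and>
     (\<forall>f\<in>X. 0 \<le> nX f) \<and>
     (\<forall>f\<in>X. nX f = 0 \<longleftrightarrow> (AE x in M. f x = 0)) \<and>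
     (\<forall>f\<in>X. \<forall>c. nX (\<lambda>x. c * f x) = \<bar>c\<bar> * nX f) \<and>
     (\<forall>f\<in>X. \<forall>g\<in>X. nX (\<lambda>x. f x + g x) \<le> nX f + nX g) \<and>
     (\<forall>f g. f \<in> borel_measurable M \<longrightarrow> g \<in> X \<longrightarrow> (AE x in M. \<bar>f x\<bar> \<le> \<bar>g x\<bar>)
        \<longrightarrow> f \<in> X \<and> nX f \<le> nX g) \<and>
     (\<forall>u::nat \<Rightarrow> 'a \<Rightarrow> real. (\<forall>n. u n \<in> X) \<longrightarrow>
        (\<forall>e>0. \<exists>N. \<forall>m\<ge>N. \<forall>n\<ge>N. nX (\<lambda>x. u m x - u n x) < e) \<longrightarrow>
        (\<exists>v\<in>X. (\<lambda>n. nX (\<lambda>x. u n x - v x)) \<longlonglongrightarrow> 0))"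

definition saturated :: "'a measure \<Rightarrow> ('a \<Rightarrow> real) set \<Rightarrow> bool" where
  "saturated M X \<longleftrightarrow>
     \<not> (\<exists>A\<in>sets M. emeasure M A > 0 \<and> (\<forall>f\<in>X. AE x in M. x \<in> A \<longrightarrow> f x = 0))"

definition sigma_order_continuous ::
  "'a measure \<Rightarrow> ('a \<Rightarrow> real) set \<Rightarrow> (('a \<Rightarrow> real) \<Rightarrow> real) \<Rightarrow> bool" where
  "sigma_order_continuous M X nX \<longleftrightarrow>
     (\<forall>u::nat \<Rightarrow> 'a \<Rightarrow> real. (\<forall>n. u n \<in> X) \<longrightarrow>
        (AE x in M. decseq (\<lambda>n. u n x) \<and> (\<lambda>n. u n x) \<longlonglongrightarrow> 0) \<longrightarrow>
        (\<lambda>n. nX (u n)) \<longlonglongrightarrow> 0)"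

definition L1 :: "'a measure \<Rightarrow> ('a \<Rightarrow> real) set" where
  "L1 M = {f \<in> borel_measurable M. integrable M f}"

definition L1_norm :: "'a measure \<Rightarrow> ('a \<Rightarrow> real) \<Rightarrow> real" where
  "L1_norm M f = (\<integral>x. \<bar>f x\<bar> \<partial>M)"

definition Linf :: "'a measure \<Rightarrow> ('a \<Rightarrow> real) set" where
  "Linf M = {f \<in> borel_measurable M. \<exists>K. AE x in M. \<bar>f x\<bar> \<le> K}"

definition mult_space ::
  "'a measure \<Rightarrow> ('a \<Rightarrow> real) set \<Rightarrow> ('a \<Rightarrow> real) set \<Rightarrow> ('a \<Rightarrow> real) set" where
  "mult_space M X Y = {h \<in> borel_measurable M. \<forall>f\<in>X. (\<lambda>x. h x * f x) \<in> Y}"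

definition mult_norm ::
  "(('a \<Rightarrow> real) set) \<Rightarrow> (('a \<Rightarrow> real) \<Rightarrow> real) \<Rightarrow> (('a \<Rightarrow> real) \<Rightarrow> real) \<Rightarrow> ('a \<Rightarrow> real) \<Rightarrow> real" where
  "mult_norm X nX nY h = (SUP f\<in>{f\<in>X. nX f \<le> 1}. nY (\<lambda>x. h x * f x))"

definition kdual :: "'a measure \<Rightarrow> ('a \<Rightarrow> real) set \<Rightarrow> ('a \<Rightarrow> real) set" where
  "kdual M X = mult_space M X (L1 M)"

definition kdual_norm ::
  "'a measure \<Rightarrow> ('a \<Rightarrow> real) set \<Rightarrow> (('a \<Rightarrow> real) \<Rightarrow> real) \<Rightarrow> ('a \<Rightarrow> real) \<Rightarrow> real" where
  "kdual_norm M X nX = mult_norm X nX (L1_norm M)"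

definition pi_rep ::
  "'a measure \<Rightarrow> ('a \<Rightarrow> real) set \<Rightarrow> (('a \<Rightarrow> real) \<Rightarrow> real) \<Rightarrow>
   ('a \<Rightarrow> real) set \<Rightarrow> (('a \<Rightarrow> real) \<Rightarrow> real) \<Rightarrow>
   ('a \<Rightarrow> real) \<Rightarrow> (nat \<Rightarrow> 'a \<Rightarrow> real) \<Rightarrow> (nat \<Rightarrow> 'a \<Rightarrow> real) \<Rightarrow> bool" where
  "pi_rep M X nX Y nY h f g \<longleftrightarrow>
     (\<forall>n. f n \<in> X \<and> g n \<in> Y) \<and>
     summable (\<lambda>n. nX (f n) * nY (g n)) \<and>
     (AE x in M. ennreal \<bar>h x\<bar> \<le> (\<Sum>n. ennreal \<bar>f n x * g n x\<bar>))"

definition pi_space ::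
  "'a measure \<Rightarrow> ('a \<Rightarrow> real) set \<Rightarrow> (('a \<Rightarrow> real) \<Rightarrow> real) \<Rightarrow>
   ('a \<Rightarrow> real) set \<Rightarrow> (('a \<Rightarrow> real) \<Rightarrow> real) \<Rightarrow> ('a \<Rightarrow> real) set" where
  "pi_space M X nX Y nY = {h \<in> borel_measurable M. \<exists>f g. pi_rep M X nX Y nY h f g}"

definition pi_norm ::
  "'a measure \<Rightarrow> ('a \<Rightarrow> real) set \<Rightarrow> (('a \<Rightarrow> real) \<Rightarrow> real) \<Rightarrow>
   ('a \<Rightarrow> real) set \<Rightarrow> (('a \<Rightarrow> real) \<Rightarrow> real) \<Rightarrow> ('a \<Rightarrow> real) \<Rightarrow> real" where
  "pi_norm M X nX Y nY h =
     Inf {(\<Sum>n. nX (f n) * nY (g n)) | f g. pi_rep M X nX Y nY h f g}"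

definition schauder_basis ::
  "('a \<Rightarrow> real) set \<Rightarrow> (('a \<Rightarrow> real) \<Rightarrow> real) \<Rightarrow> (nat \<Rightarrow> 'a \<Rightarrow> real) \<Rightarrow> bool" where
  "schauder_basis X nX b \<longleftrightarrow>
     (\<forall>n. b n \<in> X) \<and>
     (\<forall>x\<in>X. \<exists>!a::nat \<Rightarrow> real.
        (\<lambda>n. nX (\<lambda>t. x t - (\<Sum>k<n. a k * b k t))) \<longlonglongrightarrow> 0)"

definition bounded_op ::
  "'a measure \<Rightarrow> 'b measure \<Rightarrow> ('a \<Rightarrow> real) set \<Rightarrow> (('a \<Rightarrow> real) \<Rightarrow> real) \<Rightarrow>
   ('b \<Rightarrow> real) set \<Rightarrow> (('b \<Rightarrow> real) \<Rightarrow> real) \<Rightarrow> (('a \<Rightarrow> real) \<Rightarrow> ('b \<Rightarrow> real)) \<Rightarrow> bool" where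
  "bounded_op M N X nX Y nY T \<longleftrightarrow>
     (\<forall>f\<in>X. T f \<in> Y) \<and>
     (\<forall>f\<in>X. \<forall>g\<in>X. (AE x in M. f x = g x) \<longrightarrow> (AE y in N. T f y = T g y)) \<and>
     (\<forall>f\<in>X. \<forall>g\<in>X. \<forall>a b. AE y in N. T (\<lambda>x. a * f x + b * g x) y = a * T f y + b * T g y) \<and>
     (\<exists>K. \<forall>f\<in>X. nY (T f) \<le> K * nX f)"

definition nontrivial_op ::
  "'b measure \<Rightarrow> ('a \<Rightarrow> real) set \<Rightarrow> (('a \<Rightarrow> real) \<Rightarrow> ('b \<Rightarrow> real)) \<Rightarrow> bool" where
  "nontrivial_op N X T \<longleftrightarrow> (\<exists>f\<in>X. \<not> (AE y in N. T f y = 0))"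

end

theory Submission
  imports Defs
begin

text \<open>For \<open>g\<close> in \<open>Y\<^sub>2\<^bsup>Y\<^sub>1''\<^esup>\<close> the form \<open>(f, k) \<mapsto> \<integral> g f k\<close> is bounded on
  \<open>Y\<^sub>2 \<times> Y\<^sub>1'\<close> by a gliding hump argument, so \<open>u \<mapsto> \<integral> g u\<close> is bounded for the \<open>\<pi>\<close>-norm and (b)
  gives (c). Conversely, (c) says that \<open>S(h\<beta>\<^sub>j)\<gamma>\<^sub>i \<mapsto> \<integral> T(\<beta>\<^sub>j)\<gamma>\<^sub>i\<close> is dominated by the \<open>\<pi>\<close>-norm.
  Hahn--Banach extends it to a difference of positive functionals, which are order continuous because
  one of the factors is, hence integration against some \<open>g\<close> by Radon--Nikodym; as the
  \<open>\<gamma>\<^sub>i\<close> span \<open>Y\<^sub>1'\<close> and \<open>Y\<^sub>1'\<close> is saturated, \<open>T(\<beta>\<^sub>j) = g S(h\<beta>\<^sub>j)\<close>. Step (b) to (a)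
  passes to almost everywhere convergent subsequences of basis expansions. If the \<open>\<gamma>\<^sub>i\<close> are disjoint,
  summing (d) gives (c) with the \<open>L\<^sup>1\<close> norm, which the \<open>\<pi>\<close>-norm dominates when the constant
  \<open>1\<close> is a multiplier.\<close>

section \<open>Hahn--Banach extension\<close>

text \<open>The equivalence of (b) and (c) rests on a duality: \<open>g\<close> maps Y2 into Y1''
  exactly when \<open>g * f * k\<close> is integrable for all \<open>f\<close> in Y2 and
  \<open>k\<close> in Y1', so multipliers are the functions that integrate against products.
  Condition (c) is thus a moment problem: numbers dominated by the pi-norm have to be the integrals
  of \<open>g\<close> against prescribed products. The obstacle is that a norm bounded functional
  need not be an integral. Everything therefore happens on \<open>product_ideal\<close>, the
  functions dominated by one single product \<open>f * k\<close>. It contains every combination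
  occurring in (c), and there the indicator of a shrinking set can be moved onto whichever factor
  has the order continuous norm. A second obstacle is the saturation of Y1', which has to be proved
  before Y1'' carries a usable norm, before Y1' has a weak unit, and before its basis can determine
  elements of Y1''; this costs a separate application of Hahn-Banach and of the integral
  representation. In passing from (b) to (a) the multiplier acts only pointwise, which is why
  convergence almost everywhere replaces norm convergence there.\<close>

definition fun_subspace :: "('c \<Rightarrow> real) set \<Rightarrow> bool" where
  "fun_subspace V \<longleftrightarrow> (\<lambda>_. 0) \<in> V \<and> (\<forall>u\<in>V. \<forall>v\<in>V. (\<lambda>x. u x + v x) \<in> V) \<and>
     (\<forall>u\<in>V. \<forall>c. (\<lambda>x. c * u x) \<in> V)"

definition sublinear_on :: "('c \<Rightarrow> real) set \<Rightarrow> (('c \<Rightarrow> real) \<Rightarrow> real) \<Rightarrow> bool" where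
  "sublinear_on V p \<longleftrightarrow> (\<forall>u\<in>V. \<forall>v\<in>V. p (\<lambda>x. u x + v x) \<le> p u + p v) \<and>
     (\<forall>u\<in>V. \<forall>c>0. p (\<lambda>x. c * u x) \<le> c * p u)"

lemma fun_subspace_zero: "fun_subspace V \<Longrightarrow> (\<lambda>_. 0) \<in> V"
  and fun_subspace_add: "fun_subspace V \<Longrightarrow> u \<in> V \<Longrightarrow> v \<in> V \<Longrightarrow> (\<lambda>x. u x + v x) \<in> V"
  and fun_subspace_scale: "fun_subspace V \<Longrightarrow> u \<in> V \<Longrightarrow> (\<lambda>x. c * u x) \<in> V"
  by (auto simp: fun_subspace_def)

lemma sublinear_on_add:
  "sublinear_on V p \<Longrightarrow> u \<in> V \<Longrightarrow> v \<in> V \<Longrightarrow> p (\<lambda>x. u x + v x) \<le> p u + p v"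
  by (auto simp: sublinear_on_def)

text \<open>Only one inequality is built into \<open>sublinear_on\<close>; using it with
  \<open>inverse c\<close> on \<open>c * u\<close> gives the other.\<close>

lemma sublinear_on_scale:
  assumes p: "sublinear_on V p" and V: "fun_subspace V" and u: "u \<in> V" and c: "0 < c"
  shows "p (\<lambda>x. c * u x) = c * p u"
proof (rule antisym)
  show "p (\<lambda>x. c * u x) \<le> c * p u"
    using assms by (auto simp: sublinear_on_def)
  have "p (\<lambda>x. inverse c * (c * u x)) \<le> inverse c * p (\<lambda>x. c * u x)"
    using p c fun_subspace_scale[OF V u, of c] by (auto simp: sublinear_on_def)
  moreover have "(\<lambda>x. inverse c * (c * u x)) = u"
    using c by (auto simp: field_simps)
  ultimately show "c * p u \<le> p (\<lambda>x. c * u x)"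
    using c by (simp add: field_simps)
qed

lemma sublinear_on_zero:
  assumes "sublinear_on V p" "fun_subspace V"
  shows "p (\<lambda>_. 0) = 0"
  using sublinear_on_scale[OF assms fun_subspace_zero[OF assms(2)], of 2] by simp

lemma sublinear_on_minus:
  assumes p: "sublinear_on V p" and V: "fun_subspace V" and u: "u \<in> V"
  shows "- p (\<lambda>x. - u x) \<le> p u"
  using sublinear_on_add[OF p u fun_subspace_scale[OF V u, of "- 1"]] sublinear_on_zero[OF p V]
  by simp

text \<open>Subadditivity for \<open>w = (u + w) - u\<close>. The lower bound does not involve
  \<open>w\<close>, so it keeps the infima below finite, both along a ray and over a linear
  relation.\<close>

lemma sublinear_on_shift_lower:
  assumes p: "sublinear_on V p" and V: "fun_subspace V" and u: "u \<in> V" and w: "w \<in> V"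
  shows "- p (\<lambda>x. - u x) \<le> p (\<lambda>x. u x + w x) - p w"
proof -
  have "p (\<lambda>x. (u x + w x) + - 1 * u x) \<le> p (\<lambda>x. u x + w x) + p (\<lambda>x. - 1 * u x)"
    by (intro sublinear_on_add[OF p] fun_subspace_add[OF V] fun_subspace_scale[OF V] u w)
  then show ?thesis by simp
qed

text \<open>Lowering a sublinear functional in the direction of a point leaves a minimal one
  unchanged, which forces additivity.\<close>

lemma minimal_sublinear_additive:
  assumes V: "fun_subspace V" and q: "sublinear_on V q"
    and minimal: "\<And>q'. sublinear_on V q' \<Longrightarrow> (\<And>u. u \<in> V \<Longrightarrow> q' u \<le> q u) \<Longrightarrow>
                    (\<And>u. u \<in> V \<Longrightarrow> q' u = q u)"
    and u: "u \<in> V" and y: "y \<in> V"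
  shows "q (\<lambda>x. u x + y x) = q u + q y"
proof (rule antisym)
  \<comment> \<open>\<open>r\<close> is \<open>q\<close> lowered along the ray through
    \<open>y\<close>. Minimality gives \<open>r u = q u\<close>, and the entry \<open>t = 1\<close>
    of the infimum then reads \<open>q u \<le> q (u + y) - q y\<close>, the missing
    inequality.\<close>
  define f where "f v t = q (\<lambda>x. v x + t * y x) - t * q y" for v and t :: real
  define r where "r v = (INF t\<in>{0..}. f v t)" for v
  have ty: "(\<lambda>x. t * y x) \<in> V" for t
    by (rule fun_subspace_scale[OF V y])
  have qty: "q (\<lambda>x. t * y x) = t * q y" if "t \<ge> 0" for t
    using that sublinear_on_scale[OF q V y, of t] sublinear_on_zero[OF q V]
    by (cases "t = 0") auto
  have bdd: "bdd_below (f v ` {0..})" if v: "v \<in> V" for v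
  proof (rule bdd_belowI2[where m = "- q (\<lambda>x. - v x)"])
    fix t :: real assume "t \<in> {0..}"
    then show "- q (\<lambda>x. - v x) \<le> f v t"
      using sublinear_on_shift_lower[OF q V v ty, of t] qty[of t] by (simp add: f_def)
  qed
  have r_le: "r v \<le> f v t" if "v \<in> V" "t \<ge> 0" for v t
    unfolding r_def by (rule cINF_lower[OF bdd]) (use that in auto)
  have r_greatest: "a \<le> r v" if "\<And>t. t \<ge> 0 \<Longrightarrow> a \<le> f v t" for a v
    unfolding r_def by (rule cINF_greatest) (use that in auto)
  have "sublinear_on V r"
    unfolding sublinear_on_def
  proof (intro conjI ballI allI impI)
    fix v w assume v: "v \<in> V" and w: "w \<in> V"
    have "r (\<lambda>x. v x + w x) \<le> f v s + f w t" if "s \<ge> 0" "t \<ge> 0" for s t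
    proof -
      have "q (\<lambda>x. (v x + s * y x) + (w x + t * y x)) \<le> q (\<lambda>x. v x + s * y x) + q (\<lambda>x. w x + t * y x)"
        by (intro sublinear_on_add[OF q] fun_subspace_add[OF V] ty v w)
      moreover have "(\<lambda>x. (v x + s * y x) + (w x + t * y x)) = (\<lambda>x. (v x + w x) + (s + t) * y x)"
        by (auto simp: algebra_simps)
      ultimately have "f (\<lambda>x. v x + w x) (s + t) \<le> f v s + f w t"
        by (simp add: f_def algebra_simps)
      with r_le[OF fun_subspace_add[OF V v w], of "s + t"] that show ?thesis by simp
    qed
    then have "r (\<lambda>x. v x + w x) - f w t \<le> r v" if "t \<ge> 0" for t
      using that by (intro r_greatest) (simp add: algebra_simps)
    then have "r (\<lambda>x. v x + w x) - r v \<le> r w"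
      by (intro r_greatest) (simp add: algebra_simps)
    then show "r (\<lambda>x. v x + w x) \<le> r v + r w" by simp
  next
    fix v and c :: real assume v: "v \<in> V" and c: "0 < c"
    have "r (\<lambda>x. c * v x) / c \<le> r v"
    proof (rule r_greatest)
      fix t :: real assume t: "t \<ge> 0"
      have "(\<lambda>x. c * (v x + t * y x)) = (\<lambda>x. c * v x + (c * t) * y x)"
        by (auto simp: algebra_simps)
      with sublinear_on_scale[OF q V fun_subspace_add[OF V v ty] c, of t]
      have "f (\<lambda>x. c * v x) (c * t) = c * f v t"
        by (simp add: f_def algebra_simps)
      with r_le[OF fun_subspace_scale[OF V v], of "c * t" c] t c
      show "r (\<lambda>x. c * v x) / c \<le> f v t" by (simp add: field_simps)
    qed
    with c show "r (\<lambda>x. c * v x) \<le> c * r v" by (simp add: field_simps)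
  qed
  moreover have "r v \<le> q v" if "v \<in> V" for v
    using r_le[OF that, of 0] by (simp add: f_def)
  ultimately have "r u = q u" using u by (rule minimal)
  with r_le[OF u, of 1] show "q u + q y \<le> q (\<lambda>x. u x + y x)"
    by (simp add: f_def)
qed (rule sublinear_on_add[OF q u y])

text \<open>Zorn's lemma yields a minimal sublinear functional below \<open>p\<close>. It is
  additive by the previous lemma, and additivity extends homogeneity from positive to negative
  scalars.\<close>

lemma exists_linear_below_sublinear:
  fixes p :: "('c \<Rightarrow> real) \<Rightarrow> real"
  assumes V: "fun_subspace V" and p: "sublinear_on V p"
  obtains F where "\<And>u v. u \<in> V \<Longrightarrow> v \<in> V \<Longrightarrow> F (\<lambda>x. u x + v x) = F u + F v"
    and "\<And>u c. u \<in> V \<Longrightarrow> F (\<lambda>x. c * u x) = c * F u"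
    and "\<And>u. u \<in> V \<Longrightarrow> F u \<le> p u"
proof -
  \<comment> \<open>The value 0 off \<open>V\<close> makes the pointwise order of total functions
    agree with the order on \<open>V\<close>, so that minimality in \<open>Q\<close> is minimality
    on \<open>V\<close>.\<close>
  define Q where "Q = {q. sublinear_on V q \<and> (\<forall>u\<in>V. q u \<le> p u) \<and> (\<forall>u. u \<notin> V \<longrightarrow> q u = 0)}"
  have "\<exists>q\<in>Q. \<forall>r\<in>Q. r \<le> q \<longrightarrow> r = q"
  \<comment> \<open>The order is reversed because Zorn's lemma delivers a maximal element and a
    minimal one is wanted.\<close>
  proof (rule predicate_Zorn)
    show "partial_order_on Q (relation_of (\<lambda>q r. r \<le> q) Q)"
      by (auto simp: partial_order_on_def preorder_on_def refl_on_def trans_def antisym_def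
          relation_of_def intro: order_trans)
  next
    fix C assume C: "C \<in> Chains (relation_of (\<lambda>q r. r \<le> q) Q)"
    show "\<exists>u\<in>Q. \<forall>q\<in>C. u \<le> q"
    proof (cases "C = {}")
      case True
      have "(\<lambda>u. if u \<in> V then p u else 0) \<in> Q"
        using V p by (auto simp: Q_def sublinear_on_def fun_subspace_def)
      with True show ?thesis by auto
    next
      case False
      have CQ: "q \<in> Q" if "q \<in> C" for q
        using C that by (auto simp: Chains_def relation_of_def)
      have sub: "sublinear_on V q" if "q \<in> C" for q
        using CQ[OF that] by (simp add: Q_def)
      have tot: "q \<le> r \<or> r \<le> q" if "q \<in> C" "r \<in> C" for q r
        using C that by (auto simp: Chains_def relation_of_def)
      define i where "i u = (if u \<in> V then INF q\<in>C. q u else 0)" for u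
      have bdd: "bdd_below ((\<lambda>q. q u) ` C)" if u: "u \<in> V" for u
      proof (rule bdd_belowI2[where m = "- p (\<lambda>x. - u x)"])
        fix q assume q: "q \<in> C"
        have "q (\<lambda>x. - u x) \<le> p (\<lambda>x. - u x)"
          using CQ[OF q] fun_subspace_scale[OF V u, of "- 1"] by (auto simp: Q_def)
        with sublinear_on_minus[OF sub[OF q] V u] show "- p (\<lambda>x. - u x) \<le> q u" by simp
      qed
      have i_le: "i u \<le> q u" if "u \<in> V" "q \<in> C" for u q
        using that by (auto simp: i_def intro!: cINF_lower bdd)
      have i_greatest: "a \<le> i u" if "u \<in> V" "\<And>q. q \<in> C \<Longrightarrow> a \<le> q u" for a u
        using that False by (auto simp: i_def intro!: cINF_greatest)
      have "sublinear_on V i"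
        unfolding sublinear_on_def
      proof (intro conjI ballI allI impI)
        fix u v assume u: "u \<in> V" and v: "v \<in> V"
        \<comment> \<open>The chain contains a member \<open>s\<close> below both \<open>q\<close>
          and \<open>r\<close>; its subadditivity bounds the infimum at the sum by values of two
          different members.\<close>
        have uv: "i (\<lambda>x. u x + v x) \<le> q u + r v" if qr: "q \<in> C" "r \<in> C" for q r
        proof -
          obtain s where s: "s \<in> C" "s \<le> q" "s \<le> r"
            using tot[OF qr] qr by auto
          have "i (\<lambda>x. u x + v x) \<le> s u + s v"
            using i_le[OF fun_subspace_add[OF V u v] s(1)] sublinear_on_add[OF sub[OF s(1)] u v]
            by simp
          also have "\<dots> \<le> q u + r v"
            using s(2,3) by (intro add_mono) (auto simp: le_fun_def)
          finally show ?thesis .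
        qed
        have "i (\<lambda>x. u x + v x) - r v \<le> i u" if "r \<in> C" for r
          using uv[OF _ that] by (intro i_greatest[OF u]) (simp add: algebra_simps)
        then have "i (\<lambda>x. u x + v x) - i u \<le> i v"
          by (intro i_greatest[OF v]) (simp add: algebra_simps)
        then show "i (\<lambda>x. u x + v x) \<le> i u + i v" by simp
      next
        fix u and c :: real assume u: "u \<in> V" and c: "0 < c"
        have "i (\<lambda>x. c * u x) / c \<le> i u"
        proof (rule i_greatest[OF u])
          fix q assume q: "q \<in> C"
          show "i (\<lambda>x. c * u x) / c \<le> q u"
            using i_le[OF fun_subspace_scale[OF V u] q, of c] sublinear_on_scale[OF sub[OF q] V u c] c
            by (simp add: field_simps)
        qed
        with c show "i (\<lambda>x. c * u x) \<le> c * i u" by (simp add: field_simps)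
      qed
      moreover have "i u \<le> p u" if u: "u \<in> V" for u
      proof -
        from False obtain q where q: "q \<in> C" by auto
        from i_le[OF u q] CQ[OF q] u show ?thesis by (auto simp: Q_def)
      qed
      ultimately have "i \<in> Q" by (auto simp: Q_def i_def)
      moreover have "i \<le> q" if "q \<in> C" for q
        using i_le[OF _ that] CQ[OF that] by (auto simp: le_fun_def Q_def i_def)
      ultimately show ?thesis by auto
    qed
  qed
  then obtain F where F: "F \<in> Q" and min: "\<And>r. r \<in> Q \<Longrightarrow> r \<le> F \<Longrightarrow> r = F" by blast
  have sF: "sublinear_on V F" using F by (simp add: Q_def)
  have minimal: "q' u = F u"
    if q': "sublinear_on V q'" "\<And>u. u \<in> V \<Longrightarrow> q' u \<le> F u" and u: "u \<in> V" for q' u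
  proof -
    define r where "r u = (if u \<in> V then q' u else 0)" for u
    have "sublinear_on V r"
      using q'(1) V by (auto simp: r_def sublinear_on_def fun_subspace_def)
    then have "r \<in> Q"
      using q'(2) F by (auto simp: Q_def r_def intro: order_trans)
    moreover have "r \<le> F"
      using q'(2) F by (auto simp: Q_def r_def le_fun_def)
    ultimately have "F u = r u" using min by blast
    with u show ?thesis by (simp add: r_def)
  qed
  have add: "F (\<lambda>x. u x + v x) = F u + F v" if "u \<in> V" "v \<in> V" for u v
    by (rule minimal_sublinear_additive[OF V sF _ that]) (rule minimal)
  have "F (\<lambda>x. c * u x) = c * F u" if u: "u \<in> V" for u c
  proof (cases c "0 :: real" rule: linorder_cases)
    case less
    have "F (\<lambda>x. c * u x + - c * u x) = F (\<lambda>x. c * u x) + F (\<lambda>x. - c * u x)"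
      by (intro add fun_subspace_scale[OF V u])
    moreover have "F (\<lambda>x. - c * u x) = - c * F u"
      using less by (intro sublinear_on_scale[OF sF V u]) simp
    ultimately show ?thesis using sublinear_on_zero[OF sF V] by simp
  next
    case equal
    then show ?thesis using sublinear_on_zero[OF sF V] by simp
  next
    case greater
    then show ?thesis by (rule sublinear_on_scale[OF sF V u])
  qed
  with add F show ?thesis by (intro that[of F]) (auto simp: Q_def)
qed

text \<open>The prescribed values are given by a linear relation \<open>L\<close> rather than a functional, so that
  no well-definedness has to be checked beforehand.\<close>

theorem hahn_banach_relation:
  fixes p :: "('c \<Rightarrow> real) \<Rightarrow> real" and L :: "(('c \<Rightarrow> real) \<times> real) set"
  assumes V: "fun_subspace V" and p: "sublinear_on V p"
    and L_V: "\<And>w a. (w, a) \<in> L \<Longrightarrow> w \<in> V"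
    and L_ne: "L \<noteq> {}"
    and L_add: "\<And>w a w' a'. (w, a) \<in> L \<Longrightarrow> (w', a') \<in> L \<Longrightarrow> ((\<lambda>x. w x + w' x), a + a') \<in> L"
    and L_scale: "\<And>w a c. (w, a) \<in> L \<Longrightarrow> ((\<lambda>x. c * w x), c * a) \<in> L"
    and L_le: "\<And>w a. (w, a) \<in> L \<Longrightarrow> a \<le> p w"
  obtains F where "\<And>u v. u \<in> V \<Longrightarrow> v \<in> V \<Longrightarrow> F (\<lambda>x. u x + v x) = F u + F v"
    and "\<And>u c. u \<in> V \<Longrightarrow> F (\<lambda>x. c * u x) = c * F u"
    and "\<And>u. u \<in> V \<Longrightarrow> F u \<le> p u"
    and "\<And>w a. (w, a) \<in> L \<Longrightarrow> F w = a"
proof -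
  \<comment> \<open>Every linear functional below \<open>q\<close> takes the prescribed values:
    shifting \<open>w\<close> by the pair for \<open>- w\<close> gives \<open>q w \<le> a\<close>,
    and the same for \<open>- w\<close> gives the reverse inequality. The domination
    \<open>a \<le> p w\<close> is what makes the infimum finite.\<close>
  define f where "f u = (\<lambda>(w, a). p (\<lambda>x. u x + w x) - a)" for u :: "'c \<Rightarrow> real"
  define q where "q u = (INF l\<in>L. f u l)" for u
  have bdd: "bdd_below (f u ` L)" if u: "u \<in> V" for u
  proof (rule bdd_belowI2[where m = "- p (\<lambda>x. - u x)"])
    fix l assume "l \<in> L"
    then show "- p (\<lambda>x. - u x) \<le> f u l"
      using sublinear_on_shift_lower[OF p V u L_V, of "fst l" "snd l"] L_le[of "fst l" "snd l"]
      by (auto simp: f_def split: prod.splits)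
  qed
  have q_le: "q u \<le> p (\<lambda>x. u x + w x) - a" if "u \<in> V" "(w, a) \<in> L" for u w a
    using cINF_lower[OF bdd[OF that(1)] that(2)] by (simp add: q_def f_def)
  have q_greatest: "b \<le> q u" if "\<And>w a. (w, a) \<in> L \<Longrightarrow> b \<le> p (\<lambda>x. u x + w x) - a" for b u
    unfolding q_def by (rule cINF_greatest[OF L_ne]) (use that in \<open>auto simp: f_def\<close>)
  have L0: "((\<lambda>_. 0), 0) \<in> L"
    using L_ne L_scale[of _ _ 0] by auto
  have "sublinear_on V q"
    unfolding sublinear_on_def
  proof (intro conjI ballI allI impI)
    fix u v assume u: "u \<in> V" and v: "v \<in> V"
    have uv: "q (\<lambda>x. u x + v x) \<le> (p (\<lambda>x. u x + w x) - a) + (p (\<lambda>x. v x + w' x) - a')"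
      if l: "(w, a) \<in> L" "(w', a') \<in> L" for w a w' a'
    proof -
      have "p (\<lambda>x. (u x + w x) + (v x + w' x)) \<le> p (\<lambda>x. u x + w x) + p (\<lambda>x. v x + w' x)"
        by (intro sublinear_on_add[OF p] fun_subspace_add[OF V] u v L_V[OF l(1)] L_V[OF l(2)])
      moreover have "(\<lambda>x. (u x + w x) + (v x + w' x)) = (\<lambda>x. (u x + v x) + (w x + w' x))"
        by (auto simp: algebra_simps)
      ultimately show ?thesis
        using q_le[OF fun_subspace_add[OF V u v] L_add[OF l]] by simp
    qed
    have "q (\<lambda>x. u x + v x) - (p (\<lambda>x. v x + w' x) - a') \<le> q u" if "(w', a') \<in> L" for w' a'
      by (rule q_greatest) (use uv[OF _ that] in \<open>simp add: algebra_simps\<close>)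
    then have "q (\<lambda>x. u x + v x) - q u \<le> q v"
      by (intro q_greatest) (simp add: algebra_simps)
    then show "q (\<lambda>x. u x + v x) \<le> q u + q v" by simp
  next
    fix u and c :: real assume u: "u \<in> V" and c: "0 < c"
    have "q (\<lambda>x. c * u x) / c \<le> q u"
    proof (rule q_greatest)
      fix w a assume l: "(w, a) \<in> L"
      have "(\<lambda>x. c * (u x + w x)) = (\<lambda>x. c * u x + c * w x)"
        by (auto simp: algebra_simps)
      with sublinear_on_scale[OF p V fun_subspace_add[OF V u L_V[OF l]] c]
        q_le[OF fun_subspace_scale[OF V u] L_scale[OF l], of c c]
      have "q (\<lambda>x. c * u x) \<le> c * (p (\<lambda>x. u x + w x) - a)"
        by (simp add: algebra_simps)
      with c show "q (\<lambda>x. c * u x) / c \<le> p (\<lambda>x. u x + w x) - a"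
        by (simp add: field_simps)
    qed
    with c show "q (\<lambda>x. c * u x) \<le> c * q u" by (simp add: field_simps)
  qed
  then obtain F where F: "\<And>u v. u \<in> V \<Longrightarrow> v \<in> V \<Longrightarrow> F (\<lambda>x. u x + v x) = F u + F v"
      "\<And>u c. u \<in> V \<Longrightarrow> F (\<lambda>x. c * u x) = c * F u" "\<And>u. u \<in> V \<Longrightarrow> F u \<le> q u"
    using exists_linear_below_sublinear[OF V] by blast
  have le: "F w \<le> a" if l: "(w, a) \<in> L" for w a
    using F(3)[OF L_V[OF l]] q_le[OF L_V[OF l] L_scale[OF l, of "- 1"]] sublinear_on_zero[OF p V]
    by simp
  show ?thesis
  proof (rule that[OF F(1,2)])
    show "F u \<le> p u" if "u \<in> V" for u
      using F(3)[OF that] q_le[OF that L0] by simp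
    show "F w = a" if l: "(w, a) \<in> L" for w a
      using le[OF l] le[OF L_scale[OF l, of "- 1"]] F(2)[OF L_V[OF l], of "- 1"] by simp
  qed
qed

section \<open>Riesz--Fischer function spaces\<close>

lemma summable_if_le_half_powers:
  fixes a :: "nat \<Rightarrow> real"
  assumes "\<And>n. 0 \<le> a n" "\<And>n. a n \<le> (1/2) ^ n"
  shows "summable a"
proof (rule summable_comparison_test'[where N = 0])
  show "summable (\<lambda>n. (1/2::real) ^ n)" by (rule summable_geometric) simp
qed (use assms in simp)

text \<open>The Riesz--Fischer property replaces norm completeness: it is all that the proofs need, and it
  passes directly to Koethe duals.\<close>

locale riesz_fischer_space =
  fixes M :: "'a measure" and X :: "('a \<Rightarrow> real) set" and nX :: "('a \<Rightarrow> real) \<Rightarrow> real"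
  assumes measurable: "f \<in> X \<Longrightarrow> f \<in> borel_measurable M"
    and zero: "(\<lambda>_. 0) \<in> X"
    and add: "f \<in> X \<Longrightarrow> g \<in> X \<Longrightarrow> (\<lambda>x. f x + g x) \<in> X"
    and scale: "f \<in> X \<Longrightarrow> (\<lambda>x. c * f x) \<in> X"
    and norm_nonneg: "f \<in> X \<Longrightarrow> 0 \<le> nX f"
    and norm_scale: "f \<in> X \<Longrightarrow> nX (\<lambda>x. c * f x) = \<bar>c\<bar> * nX f"
    and norm_add: "f \<in> X \<Longrightarrow> g \<in> X \<Longrightarrow> nX (\<lambda>x. f x + g x) \<le> nX f + nX g"
    and solid: "f \<in> borel_measurable M \<Longrightarrow> g \<in> X \<Longrightarrow> (AE x in M. \<bar>f x\<bar> \<le> \<bar>g x\<bar>) \<Longrightarrow> f \<in> X"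
    and norm_mono: "f \<in> borel_measurable M \<Longrightarrow> g \<in> X \<Longrightarrow> (AE x in M. \<bar>f x\<bar> \<le> \<bar>g x\<bar>) \<Longrightarrow> nX f \<le> nX g"
    and riesz_fischer: "(\<And>k::nat. u k \<in> X) \<Longrightarrow> summable (\<lambda>k. nX (u k)) \<Longrightarrow>
       \<exists>v\<in>X. AE x in M. \<forall>n. (\<Sum>k<n. \<bar>u k x\<bar>) \<le> v x"
begin

lemma norm_zero: "nX (\<lambda>_. 0) = 0"
  using norm_scale[OF zero, of 0] by simp

lemma diff: "f \<in> X \<Longrightarrow> g \<in> X \<Longrightarrow> (\<lambda>x. f x - g x) \<in> X"
  using add[OF _ scale[of g "- 1"], of f] by simp

lemma abs:
  assumes f: "f \<in> X"
  shows "(\<lambda>x. \<bar>f x\<bar>) \<in> X"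
  by (rule solid[OF _ f]) (use measurable[OF f] in auto)

lemma sum: "(\<And>i. i \<in> I \<Longrightarrow> f i \<in> X) \<Longrightarrow> (\<lambda>x. \<Sum>i\<in>I. c i * f i x) \<in> X"
proof (induction I rule: infinite_finite_induct)
  case (insert i I)
  then have "(\<lambda>x. c i * f i x + (\<Sum>i\<in>I. c i * f i x)) \<in> X"
    by (intro add scale) auto
  with insert show ?case by simp
qed (auto intro: zero)

lemma dominated_sequence:
  assumes u: "\<And>k::nat. u k \<in> X" and s: "summable (\<lambda>k. nX (u k))"
  obtains v where "v \<in> X" "AE x in M. \<forall>k. \<bar>u k x\<bar> \<le> v x"
proof -
  obtain v where v: "v \<in> X" "AE x in M. \<forall>n. (\<Sum>k<n. \<bar>u k x\<bar>) \<le> v x"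
    using riesz_fischer[OF u s] by auto
  from v(2) have "AE x in M. \<forall>k. \<bar>u k x\<bar> \<le> v x"
  proof eventually_elim
    case (elim x)
    show ?case
    proof
      fix k
      have "\<bar>u k x\<bar> \<le> (\<Sum>k<Suc k. \<bar>u k x\<bar>)" by (simp add: sum_nonneg)
      with elim show "\<bar>u k x\<bar> \<le> v x" by (blast intro: order_trans)
    qed
  qed
  with v(1) that show ?thesis by blast
qed

text \<open>Partial sums bounded at a point force the series to converge there, hence its terms to
  vanish in the limit.\<close>

lemma AE_tendsto_zero:
  assumes u: "\<And>k::nat. u k \<in> X" and s: "summable (\<lambda>k. nX (u k))"
  shows "AE x in M. (\<lambda>k. u k x) \<longlonglongrightarrow> 0"
proof -
  obtain v where "v \<in> X" "AE x in M. \<forall>n. (\<Sum>k<n. \<bar>u k x\<bar>) \<le> v x"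
    using riesz_fischer[OF u s] by auto
  from this(2) show ?thesis
  proof eventually_elim
    case (elim x)
    have "summable (\<lambda>k. \<bar>u k x\<bar>)"
      by (rule summableI_nonneg_bounded) (use elim in auto)
    then show ?case
      using summable_LIMSEQ_zero tendsto_rabs_zero_iff by blast
  qed
qed

lemma subsequence_AE:
  assumes u: "\<And>k::nat. u k \<in> X" and lim: "(\<lambda>k. nX (u k)) \<longlonglongrightarrow> 0"
  obtains r :: "nat \<Rightarrow> nat" where "strict_mono r" "AE x in M. (\<lambda>k. u (r k) x) \<longlonglongrightarrow> 0"
proof -
  have "\<exists>r::nat\<Rightarrow>nat. strict_mono r \<and> (\<forall>n. nX (u (r n)) < (1/2) ^ n)"
  proof -
    have ev: "\<forall>n. \<exists>N. \<forall>k\<ge>N. nX (u k) < (1/2) ^ n"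
    proof
      fix n :: nat
      show "\<exists>N. \<forall>k\<ge>N. nX (u k) < (1/2) ^ n"
        using order_tendstoD(2)[OF lim, of "(1/2) ^ n"] by (simp add: eventually_sequentially)
    qed
    then obtain K where K: "\<And>n k. k \<ge> K n \<Longrightarrow> nX (u k) < (1/2) ^ n" by metis
    \<comment> \<open>\<open>Suc m\<close> forces strict growth, \<open>K (Suc n)\<close> pushes the
      norm below \<open>(1/2) ^ Suc n\<close>.\<close>
    define r where "r = rec_nat (K 0) (\<lambda>n m. max (Suc m) (K (Suc n)))"
    have "strict_mono r" by (rule strict_mono_Suc_iff[THEN iffD2]) (auto simp: r_def less_max_iff_disj)
    moreover have "r n \<ge> K n" for n by (cases n) (auto simp: r_def)
    ultimately show ?thesis using K by blast
  qed
  then obtain r :: "nat \<Rightarrow> nat" where r: "strict_mono r" "\<And>n. nX (u (r n)) < (1/2) ^ n" by blast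
  have "summable (\<lambda>n. nX (u (r n)))"
    by (intro summable_if_le_half_powers norm_nonneg u less_imp_le[OF r(2)])
  from that[OF r(1) AE_tendsto_zero[OF u this]] show ?thesis .
qed

text \<open>Gliding hump: if no \<open>K\<close> works, there are \<open>f n\<close> with
  \<open>\<Psi> (f n) > 4 ^ n * nX (f n)\<close>. Scaled to \<open>\<Psi> = 2 ^ n\<close> they have
  norms at most \<open>(1/2) ^ n\<close>, so one \<open>v\<close> in \<open>X\<close> dominates them
  all and \<open>\<Psi> v\<close> is at least every \<open>2 ^ n\<close>. As \<open>\<Psi>\<close>
  is merely monotone and homogeneous, it may be an integral of an absolute value or the norm of a
  product.\<close>

lemma positive_functional_bounded:
  assumes \<Psi>_nonneg: "\<And>f. f \<in> X \<Longrightarrow> 0 \<le> \<Psi> f"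
    and \<Psi>_scale: "\<And>f c. f \<in> X \<Longrightarrow> \<Psi> (\<lambda>x. c * f x) = \<bar>c\<bar> * \<Psi> f"
    and \<Psi>_mono: "\<And>f g. f \<in> X \<Longrightarrow> g \<in> X \<Longrightarrow> (AE x in M. \<bar>f x\<bar> \<le> \<bar>g x\<bar>) \<Longrightarrow> \<Psi> f \<le> (\<Psi> g :: real)"
  obtains K where "0 < K" "\<And>f. f \<in> X \<Longrightarrow> \<Psi> f \<le> K * nX f"
proof -
  have "\<exists>K>0. \<forall>f\<in>X. \<Psi> f \<le> K * nX f"
  proof (rule ccontr)
    assume "\<not> ?thesis"
    then have "\<forall>n. \<exists>f\<in>X. 4 ^ n * nX f < \<Psi> f"
      by (metis not_le zero_less_numeral zero_less_power)
    then obtain f where f: "\<And>n. f n \<in> X" "\<And>n. 4 ^ n * nX (f n) < \<Psi> (f n)" by metis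
    have pos: "0 < \<Psi> (f n)" for n
      using f(2)[of n] norm_nonneg[OF f(1), of n] by (meson le_less_trans mult_nonneg_nonneg zero_le_numeral zero_le_power)
    define u where "u n x = (2 ^ n / \<Psi> (f n)) * f n x" for n x
    have u: "u n \<in> X" for n unfolding u_def[abs_def] by (rule scale[OF f(1)])
    have \<Psi>u: "\<Psi> (u n) = 2 ^ n" for n
      using \<Psi>_scale[OF f(1), of "2 ^ n / \<Psi> (f n)" n] pos[of n] by (simp add: u_def[abs_def])
    have "nX (u n) \<le> (1/2) ^ n" for n
    proof -
      have "nX (u n) = 2 ^ n * nX (f n) / \<Psi> (f n)"
        using norm_scale[OF f(1), of "2 ^ n / \<Psi> (f n)" n] pos[of n] by (simp add: u_def[abs_def])
      moreover have "2 ^ n * (2 ^ n * nX (f n)) \<le> \<Psi> (f n)"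
        using f(2)[of n] by (simp add: power_mult_distrib[symmetric] mult.assoc[symmetric])
      ultimately have "2 ^ n * nX (u n) \<le> 1"
        using pos[of n] by (simp add: divide_le_eq)
      then show ?thesis by (simp add: power_one_over field_simps)
    qed
    then have "summable (\<lambda>n. nX (u n))"
      by (intro summable_if_le_half_powers norm_nonneg u)
    then obtain v where v: "v \<in> X" "AE x in M. \<forall>k. \<bar>u k x\<bar> \<le> v x"
      by (rule dominated_sequence[OF u])
    have "2 ^ n \<le> \<Psi> v" for n
    proof -
      have "\<Psi> (u n) \<le> \<Psi> v"
        by (rule \<Psi>_mono[OF u v(1)]) (use v(2) in \<open>auto elim!: eventually_mono intro: order_trans\<close>)
      with \<Psi>u show ?thesis by simp
    qed
    then show False
      using real_arch_pow[of 2 "\<Psi> v"] by (auto simp: not_le[symmetric])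
  qed
  with that show ?thesis by blast
qed

text \<open>Exhaustion: an element dominating a sequence of functions with almost maximal support
  has maximal support itself. All of \<open>X\<close> then vanishes where it vanishes, and
  saturation makes that set null.\<close>

lemma weak_unit:
  assumes sf: "sigma_finite_measure M" and sat: "saturated M X"
  obtains e where "e \<in> X" "AE x in M. 0 < e x"
proof -
  interpret sigma_finite_measure M by fact
  obtain \<theta> :: "'a \<Rightarrow> real" where \<theta>[measurable]: "\<theta> \<in> borel_measurable M" "\<And>x. \<theta> x > 0" "integrable M \<theta>"
    using obtain_positive_integrable_function by metis
  \<comment> \<open>\<open>m f\<close> is the mass of the support of \<open>f\<close> under the
    finite measure with density \<open>\<theta>\<close>, which has the same null sets as
    \<open>M\<close>.\<close>
  define m where "m f = (\<integral>x. \<theta> x * indicator {x. f x \<noteq> 0} x \<partial>M)" for f :: "'a \<Rightarrow> real"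
  have int: "integrable M (\<lambda>x. \<theta> x * indicator {x. f x \<noteq> 0} x)"
    if "f \<in> X" for f
    using measurable[OF that] \<theta>(2)
    by (intro Bochner_Integration.integrable_bound[OF \<theta>(3)])
      (auto simp: indicator_def less_imp_le intro!: borel_measurable_times)
  have m_mono: "m f \<le> m g" if "f \<in> X" "g \<in> X" "AE x in M. f x \<noteq> 0 \<longrightarrow> g x \<noteq> 0" for f g
    unfolding m_def using that(3) \<theta>(2)
    by (intro integral_mono_AE int that) (auto elim!: eventually_mono simp: indicator_def less_imp_le)
  have bdd: "bdd_above (m ` X)"
  proof (rule bdd_aboveI2)
    fix f assume f: "f \<in> X"
    show "m f \<le> (\<integral>x. \<theta> x \<partial>M)"
      unfolding m_def using \<theta>(2)
      by (intro integral_mono int f \<theta>(3)) (auto simp: indicator_def less_imp_le)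
  qed
  define s where "s = (SUP f\<in>X. m f)"
  have "\<exists>f\<in>X. s - 1 / Suc n < m f" for n
  proof -
    have "s - 1 / Suc n < (SUP f\<in>X. m f)" by (simp add: s_def)
    then show ?thesis
      using less_cSUP_iff[OF _ bdd] zero by blast
  qed
  then obtain f where f: "\<And>n. f n \<in> X" "\<And>n. s - 1 / Suc n < m (f n)" by metis
  \<comment> \<open>The factor changes no support and brings the norm below
    \<open>(1/2) ^ n\<close>; the summand 1 avoids division by zero.\<close>
  define u where "u n x = ((1/2) ^ n / (1 + nX (f n))) * f n x" for n x
  have pos: "0 < 1 + nX (f n)" for n using norm_nonneg[OF f(1), of n] by simp
  have u: "u n \<in> X" for n unfolding u_def[abs_def] by (rule scale[OF f(1)])
  have "nX (u n) \<le> (1/2) ^ n" for n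
  proof -
    have "nX (u n) = \<bar>(1/2) ^ n / (1 + nX (f n))\<bar> * nX (f n)"
      unfolding u_def[abs_def] by (rule norm_scale[OF f(1)])
    also have "\<dots> = (1/2) ^ n * (nX (f n) / (1 + nX (f n)))"
      using pos[of n] by simp
    also have "\<dots> \<le> (1/2) ^ n * 1"
      using pos[of n] by (intro mult_left_mono) auto
    finally show ?thesis by simp
  qed
  then have "summable (\<lambda>n. nX (u n))"
    by (intro summable_if_le_half_powers norm_nonneg u)
  then obtain e where e: "e \<in> X" "AE x in M. \<forall>k. \<bar>u k x\<bar> \<le> e x"
    by (rule dominated_sequence[OF u])
  have nz: "AE x in M. f n x \<noteq> 0 \<longrightarrow> e x \<noteq> 0" for n
    using e(2)
  proof eventually_elim
    case (elim x)
    have "f n x \<noteq> 0 \<Longrightarrow> \<bar>u n x\<bar> > 0" using pos[of n] by (simp add: u_def)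
    with elim show ?case by (metis abs_le_zero_iff not_less)
  qed
  have me: "s \<le> m e"
  proof (rule field_le_epsilon)
    fix \<epsilon> :: real assume "\<epsilon> > 0"
    then obtain n where n: "1 / Suc n < \<epsilon>" using nat_approx_posE by blast
    have "s - 1 / Suc n < m e"
      using f(2)[of n] m_mono[OF f(1) e(1) nz, of n] by simp
    with n show "s \<le> m e + \<epsilon>" by simp
  qed
  note [measurable] = measurable[OF e(1)]
  define A where "A = {x\<in>space M. e x = 0}"
  have A: "A \<in> sets M" unfolding A_def by measurable
  have "AE x in M. x \<in> A \<longrightarrow> g x = 0" if g: "g \<in> X" for g
  proof -
    note [measurable] = measurable[OF g]
    \<comment> \<open>The support of \<open>k\<close> is the union of those of \<open>e\<close> and
      \<open>g\<close>. Since \<open>m k \<le> s \<le> m e\<close>, it exceeds the support of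
      \<open>e\<close> by a null set only.\<close>
    define k where "k x = \<bar>e x\<bar> + \<bar>g x\<bar>" for x
    have k: "k \<in> X" using add[OF abs[OF e(1)] abs[OF g]] by (simp add: k_def[abs_def])
    have "m k \<le> s" unfolding s_def by (rule cSUP_upper[OF k bdd])
    with me have "(\<integral>x. \<theta> x * indicator {x. k x \<noteq> 0} x - \<theta> x * indicator {x. e x \<noteq> 0} x \<partial>M) \<le> 0"
      by (simp add: Bochner_Integration.integral_diff[OF int[OF k] int[OF e(1)]] m_def)
    moreover have ge: "0 \<le> \<theta> x * indicator {x. k x \<noteq> 0} x - \<theta> x * indicator {x. e x \<noteq> 0} x" for x
      using \<theta>(2)[of x] by (auto simp: indicator_def k_def)
    ultimately have "(\<integral>x. \<theta> x * indicator {x. k x \<noteq> 0} x - \<theta> x * indicator {x. e x \<noteq> 0} x \<partial>M) = 0"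
      by (intro antisym Bochner_Integration.integral_nonneg)
    then have "AE x in M. \<theta> x * indicator {x. k x \<noteq> 0} x - \<theta> x * indicator {x. e x \<noteq> 0} x = 0"
      using ge int[OF k] int[OF e(1)]
      by (subst (asm) integral_nonneg_eq_0_iff_AE) auto
    then show ?thesis
    proof eventually_elim
      case (elim x)
      then show ?case using \<theta>(2)[of x] by (auto simp: indicator_def k_def A_def split: if_splits)
    qed
  qed
  with sat A have "emeasure M A = 0"
    unfolding saturated_def by (metis not_gr_zero)
  with A have "AE x in M. x \<notin> A" by (intro AE_not_in) (auto simp: null_sets_def)
  then have "AE x in M. 0 < \<bar>e x\<bar>"
    by (rule AE_mp) (auto simp: A_def)
  with that[OF abs[OF e(1)]] show ?thesis by blast
qed

end

text \<open>The partial sums \<open>s n\<close> of the absolute values form a Cauchy sequence; let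
  \<open>v\<close> be a norm limit. For all \<open>m \<ge> n\<close> the positive part of
  \<open>s n - v\<close> is at most the modulus of \<open>s m - v\<close>, so its norm is 0 and
  \<open>s n \<le> v\<close> almost everywhere.\<close>

lemma bfs_riesz_fischer_space:
  assumes b: "bfs M X nX"
  shows "riesz_fischer_space M X nX"
proof
  have solid: "f \<in> X \<and> nX f \<le> nX g"
    if "f \<in> borel_measurable M" "g \<in> X" "AE x in M. \<bar>f x\<bar> \<le> \<bar>g x\<bar>" for f g
    using b that unfolding bfs_def by blast
  show zero: "(\<lambda>_. 0) \<in> X" and meas: "\<And>f. f \<in> X \<Longrightarrow> f \<in> borel_measurable M"
    and add: "\<And>f g. f \<in> X \<Longrightarrow> g \<in> X \<Longrightarrow> (\<lambda>x. f x + g x) \<in> X"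
    and tri: "\<And>f g. f \<in> X \<Longrightarrow> g \<in> X \<Longrightarrow> nX (\<lambda>x. f x + g x) \<le> nX f + nX g"
    and scale: "\<And>f c. f \<in> X \<Longrightarrow> (\<lambda>x. c * f x) \<in> X"
    and nscale: "\<And>f c. f \<in> X \<Longrightarrow> nX (\<lambda>x. c * f x) = \<bar>c\<bar> * nX f"
    and nonneg: "\<And>f. f \<in> X \<Longrightarrow> 0 \<le> nX f"
    using b unfolding bfs_def by blast+
  have definite: "\<And>f. f \<in> X \<Longrightarrow> nX f = 0 \<Longrightarrow> AE x in M. f x = 0"
    using b unfolding bfs_def by blast
  show "f \<in> X" "nX f \<le> nX g"
    if "f \<in> borel_measurable M" "g \<in> X" "AE x in M. \<bar>f x\<bar> \<le> \<bar>g x\<bar>" for f g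
    using solid[OF that] by blast+
  show "\<exists>v\<in>X. AE x in M. \<forall>n. (\<Sum>k<n. \<bar>u k x\<bar>) \<le> v x"
    if u: "\<And>k::nat. u k \<in> X" and s: "summable (\<lambda>k. nX (u k))" for u
  proof -
    have um[measurable]: "u k \<in> borel_measurable M" for k by (rule meas[OF u])
    have au: "(\<lambda>x. \<bar>u k x\<bar>) \<in> X" "nX (\<lambda>x. \<bar>u k x\<bar>) \<le> nX (u k)" for k
      using solid[of "\<lambda>x. \<bar>u k x\<bar>" "u k"] u by auto
    have tail: "(\<lambda>x. \<Sum>k\<in>I. \<bar>u k x\<bar>) \<in> X \<and> nX (\<lambda>x. \<Sum>k\<in>I. \<bar>u k x\<bar>) \<le> (\<Sum>k\<in>I. nX (u k))"
      if "finite I" for I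
      using that
    proof induction
      case empty
      then show ?case using zero nscale[of "\<lambda>_. 0" 0] by simp
    next
      case (insert i I)
      then show ?case using add[OF au(1)] tri[OF au(1), of "\<lambda>x. \<Sum>k\<in>I. \<bar>u k x\<bar>" i] au(2)[of i] by simp
    qed
    define s where "s n x = (\<Sum>k<n. \<bar>u k x\<bar>)" for n x
    have sX: "s n \<in> X" for n using tail[of "{..<n}"] by (simp add: s_def[abs_def])
    have sm[measurable]: "s n \<in> borel_measurable M" for n unfolding s_def[abs_def] by measurable
    have diff: "nX (\<lambda>x. s m x - s n x) \<le> (\<Sum>k\<in>{n..<m}. nX (u k))" if "n \<le> m" for m n
    proof -
      have "s m x - s n x = (\<Sum>k\<in>{n..<m}. \<bar>u k x\<bar>)" for x
        using that by (simp add: s_def sum_diff_nat_ivl[of 0 n m, symmetric] lessThan_atLeast0)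
      then show ?thesis using tail[of "{n..<m}"] by simp
    qed
    have comm: "nX (\<lambda>x. s m x - s n x) = nX (\<lambda>x. s n x - s m x)" for m n
      using nscale[OF add[OF sX scale[OF sX, of "-1"]], of "-1" m n] by (simp add: algebra_simps)
    have "\<exists>v\<in>X. (\<lambda>n. nX (\<lambda>x. s n x - v x)) \<longlonglongrightarrow> 0"
    proof -
      have "\<exists>N. \<forall>m\<ge>N. \<forall>n\<ge>N. nX (\<lambda>x. s m x - s n x) < e" if e: "e > 0" for e
      proof -
        obtain N where N: "\<And>m n. m \<ge> N \<Longrightarrow> norm (\<Sum>k\<in>{m..<n}. nX (u k)) < e"
          using s e unfolding summable_Cauchy by blast
        have *: "nX (\<lambda>x. s m x - s n x) < e" if "n \<ge> N" "n \<le> m" for m n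
          using diff[OF that(2)] N[OF that(1), of m] by simp
        have "nX (\<lambda>x. s m x - s n x) < e" if "n \<ge> N" "m \<ge> N" for m n
          using *[of n m] *[of m n] comm[of m n] that by (cases "n \<le> m") auto
        then show ?thesis by blast
      qed
      with sX b show ?thesis unfolding bfs_def by blast
    qed
    then obtain v where v: "v \<in> X" and lim: "(\<lambda>n. nX (\<lambda>x. s n x - v x)) \<longlonglongrightarrow> 0" by blast
    have [measurable]: "v \<in> borel_measurable M" by (rule meas[OF v])
    have "AE x in M. s n x \<le> v x" for n
    proof -
      have le: "nX (\<lambda>x. max 0 (s n x - v x)) \<le> nX (\<lambda>x. s m x - v x) \<and> (\<lambda>x. max 0 (s n x - v x)) \<in> X" if "m \<ge> n" for m
      proof -
        have "s n x \<le> s m x" for x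
          unfolding s_def using that by (intro sum_mono2) auto
        then have "\<bar>max 0 (s n x - v x)\<bar> \<le> \<bar>s m x - v x\<bar>" for x
          by (smt (verit))
        moreover have "(\<lambda>x. s m x - v x) \<in> X" using add[OF sX scale[OF v, of "-1"]] by simp
        ultimately show ?thesis
          using solid[of "\<lambda>x. max 0 (s n x - v x)" "\<lambda>x. s m x - v x"] by auto
      qed
      have "nX (\<lambda>x. max 0 (s n x - v x)) \<le> 0"
        by (rule LIMSEQ_le_const[OF lim]) (use le in blast)
      with le[of n] nonneg have "nX (\<lambda>x. max 0 (s n x - v x)) = 0" by (simp add: antisym)
      with le[of n] definite have "AE x in M. max 0 (s n x - v x) = 0" by blast
      then show ?thesis by eventually_elim (simp add: max_def split: if_splits)
    qed
    then have "AE x in M. \<forall>n. s n x \<le> v x" by (simp add: AE_all_countable)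
    with v show ?thesis unfolding s_def by blast
  qed
qed

section \<open>Integral representation of order continuous functionals\<close>

text \<open>Rational \<open>c\<close> close to \<open>r\<close> on either side squeeze
  \<open>E\<close>; as \<open>D\<close> may have any sign, closeness of \<open>c * D\<close> to
  \<open>r * D\<close> is measured in absolute value. Only rational \<open>c\<close> occur so that
  countably many almost everywhere statements can feed the lemma.\<close>

lemma real_eq_if_rational_bounds:
  fixes r D E :: real
  assumes le: "\<And>c. c \<in> \<rat> \<Longrightarrow> r \<le> c \<Longrightarrow> E \<le> c * D" and ge: "\<And>c. c \<in> \<rat> \<Longrightarrow> c \<le> r \<Longrightarrow> c * D \<le> E"
  shows "E = r * D"
proof -
  have close: "\<exists>c\<in>\<rat>. r \<le> c \<and> c \<le> r + e" "\<exists>c\<in>\<rat>. c \<le> r \<and> r \<le> c + e" if e: "e > 0" for e :: real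
    using Rats_dense_in_real[of r "r + e"] Rats_dense_in_real[of "r - e" r] e
    by (metis less_add_same_cancel1 less_imp_le, metis diff_less_eq less_add_same_cancel1 less_imp_le)
  have D: "\<bar>c * D - r * D\<bar> \<le> e * (1 + \<bar>D\<bar>)" if "\<bar>c - r\<bar> \<le> e" for c e
  proof -
    have "\<bar>c * D - r * D\<bar> = \<bar>c - r\<bar> * \<bar>D\<bar>" by (simp add: left_diff_distrib[symmetric] abs_mult)
    also have "\<dots> \<le> e * (1 + \<bar>D\<bar>)" using that by (intro mult_mono) auto
    finally show ?thesis .
  qed
  have "E \<le> r * D + \<epsilon> \<and> r * D \<le> E + \<epsilon>" if \<epsilon>: "\<epsilon> > 0" for \<epsilon>
  proof -
    define e where "e = \<epsilon> / (1 + \<bar>D\<bar>)"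
    have e: "e > 0" "e * (1 + \<bar>D\<bar>) = \<epsilon>" using \<epsilon> by (auto simp: e_def add_pos_nonneg)
    obtain c c' where c: "c \<in> \<rat>" "r \<le> c" "c \<le> r + e" and c': "c' \<in> \<rat>" "c' \<le> r" "r \<le> c' + e"
      using close[OF e(1)] by blast
    show ?thesis
      using le[OF c(1,2)] ge[OF c'(1,2)] D[of c e] D[of c' e] c c' e(2) by auto
  qed
  then have "E \<le> r * D" "r * D \<le> E" by (blast intro: field_le_epsilon)+
  then show ?thesis by (rule antisym)
qed

definition solid_subspace :: "'b measure \<Rightarrow> ('b \<Rightarrow> real) set \<Rightarrow> bool" where
  "solid_subspace N V \<longleftrightarrow> fun_subspace V \<and> V \<subseteq> borel_measurable N \<and>
     (\<forall>u v. u \<in> borel_measurable N \<longrightarrow> v \<in> V \<longrightarrow> (AE x in N. \<bar>u x\<bar> \<le> \<bar>v x\<bar>) \<longrightarrow> u \<in> V)"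

text \<open>Continuity is asked for along decreasing sets with empty intersection, which is the form
  in which additivity of \<open>A \<mapsto> \<Phi> (indicator A * u)\<close> upgrades to countable
  additivity.\<close>

locale order_continuous_functional = sigma_finite_measure N for N :: "'b measure" +
  fixes V :: "('b \<Rightarrow> real) set" and \<Phi> :: "('b \<Rightarrow> real) \<Rightarrow> real"
  assumes V: "solid_subspace N V"
    and \<Phi>_add: "\<And>u v. u \<in> V \<Longrightarrow> v \<in> V \<Longrightarrow> \<Phi> (\<lambda>x. u x + v x) = \<Phi> u + \<Phi> v"
    and \<Phi>_scale: "\<And>u c. u \<in> V \<Longrightarrow> \<Phi> (\<lambda>x. c * u x) = c * \<Phi> u"
    and \<Phi>_pos: "\<And>u. u \<in> V \<Longrightarrow> (AE x in N. 0 \<le> u x) \<Longrightarrow> 0 \<le> \<Phi> u"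
    and \<Phi>_cont: "\<And>u A. u \<in> V \<Longrightarrow> range A \<subseteq> sets N \<Longrightarrow> decseq A \<Longrightarrow> (\<Inter>i. A i) = {} \<Longrightarrow>
       (\<lambda>i. \<Phi> (\<lambda>x. indicator (A i) x * u x)) \<longlonglongrightarrow> 0"
begin

lemma V_measurable: "u \<in> V \<Longrightarrow> u \<in> borel_measurable N"
  and V_solid: "u \<in> borel_measurable N \<Longrightarrow> v \<in> V \<Longrightarrow> AE x in N. \<bar>u x\<bar> \<le> \<bar>v x\<bar> \<Longrightarrow> u \<in> V"
  and V_subspace: "fun_subspace V"
  using V unfolding solid_subspace_def by blast+

lemma V_indicator:
  assumes "u \<in> V" "A \<in> sets N"
  shows "(\<lambda>x. indicator A x * u x) \<in> V"
proof (rule V_solid[OF _ assms(1)])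
  show "(\<lambda>x. indicator A x * u x) \<in> borel_measurable N"
    by (intro borel_measurable_times borel_measurable_indicator assms(2) V_measurable[OF assms(1)])
qed (simp add: indicator_def)

text \<open>For nonnegative \<open>u\<close> the map
  \<open>A \<mapsto> \<Phi> (indicator A * u)\<close> is a finite measure that is absolutely
  continuous, and \<open>d\<close> is its Radon-Nikodym derivative.\<close>

lemma density_exists:
  assumes u: "u \<in> V" and nn: "AE x in N. 0 \<le> u x"
  obtains d where "integrable N d" "\<And>A. A \<in> sets N \<Longrightarrow> (\<integral>x. indicator A x * d x \<partial>N) = \<Phi> (\<lambda>x. indicator A x * u x)"
proof -
  define \<nu> where "\<nu> A = ennreal (\<Phi> (\<lambda>x. indicator A x * u x))" for A
  have pos: "0 \<le> \<Phi> (\<lambda>x. indicator A x * u x)" if "A \<in> sets N" for A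
    using nn by (intro \<Phi>_pos V_indicator u that) (auto elim!: eventually_mono simp: indicator_def)
  have empty: "\<Phi> (\<lambda>x. indicator {} x * u x) = 0"
    using \<Phi>_scale[OF u, of 0] by simp
  have add: "\<Phi> (\<lambda>x. indicator (A \<union> B) x * u x) = \<Phi> (\<lambda>x. indicator A x * u x) + \<Phi> (\<lambda>x. indicator B x * u x)"
    if "A \<in> sets N" "B \<in> sets N" "A \<inter> B = {}" for A B
  proof -
    have "(\<lambda>x. indicator (A \<union> B) x * u x) = (\<lambda>x. indicator A x * u x + indicator B x * u x)"
      using that by (auto simp: indicator_def fun_eq_iff)
    with \<Phi>_add[OF V_indicator[OF u] V_indicator[OF u]] that show ?thesis by simp
  qed
  have p: "positive (sets N) \<nu>"
    using empty by (simp add: positive_def \<nu>_def)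
  have a: "additive (sets N) \<nu>"
    by (auto simp: additive_def \<nu>_def add ennreal_plus pos)
  have ca: "countably_additive (sets N) \<nu>"
  proof (rule sets.empty_continuous_imp_countably_additive[OF p a])
    show "\<forall>A\<in>sets N. \<nu> A \<noteq> \<infinity>" by (simp add: \<nu>_def)
    show "(\<lambda>i. \<nu> (A i)) \<longlonglongrightarrow> 0" if "range A \<subseteq> sets N" "decseq A" "(\<Inter>i. A i) = {}" for A
      using tendsto_ennrealI[OF \<Phi>_cont[OF u that]] by (simp add: \<nu>_def)
  qed
  define \<rho> where "\<rho> = measure_of (space N) (sets N) \<nu>"
  have sets_\<rho>[simp]: "sets \<rho> = sets N" by (simp add: \<rho>_def)
  have em: "emeasure \<rho> A = \<nu> A" if "A \<in> sets N" for A
    unfolding \<rho>_def by (rule emeasure_measure_of_sigma[OF sets.sigma_algebra_axioms p ca that])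
  have "absolutely_continuous N \<rho>"
    unfolding absolutely_continuous_def
  proof
    fix A assume A: "A \<in> null_sets N"
    then have A': "A \<in> sets N" by auto
    \<comment> \<open>Both the restricted function and its negative are nonnegative almost
      everywhere, so positivity alone forces the value 0.\<close>
    have "AE x in N. indicator A x * u x = 0"
      using AE_not_in[OF A] by eventually_elim simp
    then have "0 \<le> \<Phi> (\<lambda>x. - 1 * (indicator A x * u x))"
      using V_subspace V_indicator[OF u A'] by (intro \<Phi>_pos fun_subspace_scale) auto
    then have "\<Phi> (\<lambda>x. indicator A x * u x) = 0"
      using \<Phi>_scale[OF V_indicator[OF u A'], of "- 1"] pos[OF A'] by simp
    then show "A \<in> null_sets \<rho>" using A' by (auto simp: null_sets_def em \<nu>_def)
  qed
  then obtain e where e[measurable]: "e \<in> borel_measurable N" and dens: "density N e = \<rho>"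
    using Radon_Nikodym[OF _ sets_\<rho>] by blast
  have nn_e: "(\<integral>\<^sup>+x. e x * indicator A x \<partial>N) = \<nu> A" if "A \<in> sets N" for A
    using em[OF that] emeasure_density[OF e that] by (simp add: dens)
  have "(\<integral>\<^sup>+x. e x \<partial>N) = (\<integral>\<^sup>+x. e x * indicator (space N) x \<partial>N)"
    by (intro nn_integral_cong) auto
  also have "\<dots> = \<nu> (space N)" by (rule nn_e) simp
  also have "\<dots> < \<infinity>" by (simp add: \<nu>_def)
  finally have "(\<integral>\<^sup>+x. e x \<partial>N) < \<infinity>" .
  then have fin: "AE x in N. e x \<noteq> \<infinity>"
    by (intro nn_integral_PInf_AE) auto
  have nn_d: "(\<integral>\<^sup>+x. ennreal (indicator A x * enn2real (e x)) \<partial>N) = \<nu> A" if "A \<in> sets N" for A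
    unfolding nn_e[OF that, symmetric]
    using fin by (intro nn_integral_cong_AE) (auto elim!: eventually_mono simp: indicator_def ennreal_enn2real_if)
  show ?thesis
  proof (rule that)
    have "(\<integral>\<^sup>+x. ennreal (norm (enn2real (e x))) \<partial>N) = (\<integral>\<^sup>+x. e x \<partial>N)"
      using fin by (intro nn_integral_cong_AE) (auto elim!: eventually_mono simp: ennreal_enn2real_if)
    then show "integrable N (\<lambda>x. enn2real (e x))"
      using \<open>(\<integral>\<^sup>+x. e x \<partial>N) < \<infinity>\<close> by (simp add: integrable_iff_bounded)
    show "(\<integral>x. indicator A x * enn2real (e x) \<partial>N) = \<Phi> (\<lambda>x. indicator A x * u x)" if A: "A \<in> sets N" for A
      using A by (subst integral_eq_nn_integral) (auto simp: nn_d \<nu>_def pos)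
  qed
qed

text \<open>Positivity of \<open>\<Phi>\<close> on
  \<open>indicator (A \<inter> B) * (v - u)\<close>, where \<open>B\<close> is the set on which
  \<open>u \<le> v\<close>, makes the integral of \<open>b - a\<close> over every
  \<open>A \<inter> B\<close> nonnegative. The functions carry no sign, because \<open>c * e\<close>
  enters below with \<open>c\<close> of either sign.\<close>

lemma density_le:
  assumes u: "u \<in> V" and v: "v \<in> V" and a: "integrable N a" and b: "integrable N b"
    and ua: "\<And>A. A \<in> sets N \<Longrightarrow> (\<integral>x. indicator A x * a x \<partial>N) = \<Phi> (\<lambda>x. indicator A x * u x)"
    and vb: "\<And>A. A \<in> sets N \<Longrightarrow> (\<integral>x. indicator A x * b x \<partial>N) = \<Phi> (\<lambda>x. indicator A x * v x)"
  shows "AE x in N. u x \<le> v x \<longrightarrow> a x \<le> b x"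
proof -
  note [measurable] = V_measurable[OF u] V_measurable[OF v]
  define B where "B = {x\<in>space N. u x \<le> v x}"
  have B[measurable]: "B \<in> sets N" unfolding B_def by measurable
  have ind: "integrable N (\<lambda>x. indicator A x * f x)" if "integrable N f" "A \<in> sets N" for A and f :: "'b \<Rightarrow> real"
    using integrable_mult_indicator[OF that(2,1)] by simp
  have "AE x in N. 0 \<le> indicator B x * (b x - a x)"
  proof (rule density_nonneg)
    show "integrable N (\<lambda>x. indicator B x * (b x - a x))"
      by (intro ind B Bochner_Integration.integrable_diff a b)
    fix A assume A: "A \<in> sets N"
    then have AB: "A \<inter> B \<in> sets N" by auto
    have "(\<integral>x\<in>A. indicator B x * (b x - a x) \<partial>N) = (\<integral>x. indicator (A \<inter> B) x * b x - indicator (A \<inter> B) x * a x \<partial>N)"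
      unfolding set_lebesgue_integral_def
      by (intro Bochner_Integration.integral_cong) (auto simp: indicator_def)
    also have "\<dots> = \<Phi> (\<lambda>x. indicator (A \<inter> B) x * v x) - \<Phi> (\<lambda>x. indicator (A \<inter> B) x * u x)"
      using Bochner_Integration.integral_diff[OF ind[OF b AB] ind[OF a AB]] ua[OF AB] vb[OF AB] by simp
    also have "\<dots> = \<Phi> (\<lambda>x. indicator (A \<inter> B) x * v x + - 1 * (indicator (A \<inter> B) x * u x))"
      using \<Phi>_add[OF V_indicator[OF v AB] fun_subspace_scale[OF V_subspace V_indicator[OF u AB]], of "- 1"]
        \<Phi>_scale[OF V_indicator[OF u AB], of "- 1"] by simp
    also have "0 \<le> \<dots>"
      by (intro \<Phi>_pos fun_subspace_add[OF V_subspace] fun_subspace_scale[OF V_subspace] V_indicator u v AB)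
        (auto simp: indicator_def B_def)
    finally show "0 \<le> (\<integral>x\<in>A. indicator B x * (b x - a x) \<partial>N)" .
  qed
  with AE_space show ?thesis by eventually_elim (auto simp: B_def indicator_def)
qed

text \<open>Comparing the densities of \<open>u\<close> and \<open>c e\<close> on the sets where \<open>u \<le> c e\<close> or \<open>u \<ge> c e\<close>, for
  rational \<open>c\<close>, shows that the density of \<open>u\<close> is proportional to \<open>u\<close>.\<close>

theorem integral_representation:
  assumes e: "e \<in> V" and epos: "AE x in N. 0 < e x"
  obtains g where "g \<in> borel_measurable N"
    and "\<And>u. u \<in> V \<Longrightarrow> integrable N (\<lambda>x. g x * u x)"
    and "\<And>u. u \<in> V \<Longrightarrow> (\<integral>x. g x * u x \<partial>N) = \<Phi> u"
proof -
  note [measurable] = V_measurable[OF e]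
  have "AE x in N. 0 \<le> e x" using epos by eventually_elim simp
  then obtain d where d: "integrable N d"
    and d_eq: "\<And>A. A \<in> sets N \<Longrightarrow> (\<integral>x. indicator A x * d x \<partial>N) = \<Phi> (\<lambda>x. indicator A x * e x)"
    by (rule density_exists[OF e]) blast
  \<comment> \<open>The density belonging to \<open>e\<close> has to be \<open>g * e\<close>, so
    \<open>g\<close> can only be this quotient.\<close>
  define g where "g x = d x / e x" for x
  have gm: "g \<in> borel_measurable N" using d unfolding g_def by measurable
  have pos: "integrable N (\<lambda>x. g x * u x) \<and> (\<integral>x. g x * u x \<partial>N) = \<Phi> u"
    if u: "u \<in> V" and nn: "AE x in N. 0 \<le> u x" for u
  proof -
    note [measurable] = V_measurable[OF u]
    obtain b where b: "integrable N b"
      and b_eq: "\<And>A. A \<in> sets N \<Longrightarrow> (\<integral>x. indicator A x * b x \<partial>N) = \<Phi> (\<lambda>x. indicator A x * u x)"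
      by (rule density_exists[OF u nn]) blast
    have ce: "(\<lambda>x. c * e x) \<in> V" and cd: "integrable N (\<lambda>x. c * d x)"
      and cd_eq: "A \<in> sets N \<Longrightarrow> (\<integral>x. indicator A x * (c * d x) \<partial>N) = \<Phi> (\<lambda>x. indicator A x * (c * e x))" for c A
    proof -
      show "(\<lambda>x. c * e x) \<in> V" by (rule fun_subspace_scale[OF V_subspace e])
      show "integrable N (\<lambda>x. c * d x)" using d by simp
      show "(\<integral>x. indicator A x * (c * d x) \<partial>N) = \<Phi> (\<lambda>x. indicator A x * (c * e x))" if A: "A \<in> sets N"
        using \<Phi>_scale[OF V_indicator[OF e A], of c] d_eq[OF A] by (simp add: mult.left_commute)
    qed
    have "AE x in N. u x \<le> c * e x \<longrightarrow> b x \<le> c * d x" for c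
      by (rule density_le[OF u ce b cd]) (fact b_eq, fact cd_eq)
    moreover have "AE x in N. c * e x \<le> u x \<longrightarrow> c * d x \<le> b x" for c
      by (rule density_le[OF ce u cd b]) (fact cd_eq, fact b_eq)
    ultimately have "AE x in N. (u x \<le> c * e x \<longrightarrow> b x \<le> c * d x) \<and> (c * e x \<le> u x \<longrightarrow> c * d x \<le> b x)" for c
      by (intro AE_conjI)
    then have "AE x in N. \<forall>c\<in>\<rat>. (u x \<le> c * e x \<longrightarrow> b x \<le> c * d x) \<and> (c * e x \<le> u x \<longrightarrow> c * d x \<le> b x)"
      by (intro AE_ball_countable[OF countable_rat, THEN iffD2] ballI)
    with epos have AE: "AE x in N. g x * u x = b x"
    proof eventually_elim
      case (elim x)
      have "b x = (u x / e x) * d x"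
      proof (rule real_eq_if_rational_bounds)
        fix c :: real assume c: "c \<in> \<rat>"
        show "b x \<le> c * d x" if "u x / e x \<le> c"
          using elim c that by (auto simp: divide_le_eq)
        show "c * d x \<le> b x" if "c \<le> u x / e x"
          using elim c that by (auto simp: le_divide_eq)
      qed
      then show ?case by (simp add: g_def)
    qed
    have "integrable N (\<lambda>x. g x * u x)"
      by (rule integrable_cong_AE_imp[OF b]) (use gm AE in auto)
    moreover have "(\<integral>x. g x * u x \<partial>N) = (\<integral>x. b x \<partial>N)"
      using b gm AE by (intro integral_cong_AE) auto
    moreover have "(\<integral>x. b x \<partial>N) = (\<integral>x. indicator (space N) x * b x \<partial>N)"
      by (intro Bochner_Integration.integral_cong) auto
    \<comment> \<open>Members of \<open>V\<close> are functions on the whole type and may be nonzero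
      outside \<open>space N\<close>. The difference vanishes on \<open>space N\<close>, and
      positivity applied to it and its negative gives it the value 0.\<close>
    moreover have "\<Phi> (\<lambda>x. indicator (space N) x * u x) = \<Phi> u"
    proof -
      have 1: "(\<lambda>x. indicator (space N) x * u x - u x) \<in> V"
        by (rule V_solid[OF _ u]) (auto simp: indicator_def)
      have 2: "(\<lambda>x. - 1 * (indicator (space N) x * u x - u x)) \<in> V"
        by (rule fun_subspace_scale[OF V_subspace 1])
      have "0 \<le> \<Phi> (\<lambda>x. indicator (space N) x * u x - u x)" "0 \<le> \<Phi> (\<lambda>x. - 1 * (indicator (space N) x * u x - u x))"
        by (rule \<Phi>_pos[OF 1], use AE_space in \<open>eventually_elim\<close>, simp)
           (rule \<Phi>_pos[OF 2], use AE_space in \<open>eventually_elim\<close>, simp)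
      then have "\<Phi> (\<lambda>x. indicator (space N) x * u x - u x) = 0"
        using \<Phi>_scale[OF 1, of "- 1"] by simp
      with \<Phi>_add[OF 1 u] show ?thesis by simp
    qed
    ultimately show ?thesis using b_eq[of "space N"] by simp
  qed
  have "integrable N (\<lambda>x. g x * u x) \<and> (\<integral>x. g x * u x \<partial>N) = \<Phi> u" if u: "u \<in> V" for u
  proof -
    note [measurable] = V_measurable[OF u]
    have p: "(\<lambda>x. max 0 (u x)) \<in> V" and m: "(\<lambda>x. max 0 (- u x)) \<in> V"
      by (rule V_solid[OF _ u]; auto)+
    note P = pos[OF p] and Q = pos[OF m]
    have eq: "u = (\<lambda>x. max 0 (u x) + - 1 * max 0 (- u x))" by (auto simp: max_def)
    have "\<Phi> (\<lambda>x. max 0 (u x) + - 1 * max 0 (- u x)) = \<Phi> (\<lambda>x. max 0 (u x)) - \<Phi> (\<lambda>x. max 0 (- u x))"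
      using \<Phi>_add[OF p fun_subspace_scale[OF V_subspace m], of "- 1"] \<Phi>_scale[OF m, of "- 1"] by simp
    then have \<Phi>u: "\<Phi> u = \<Phi> (\<lambda>x. max 0 (u x)) - \<Phi> (\<lambda>x. max 0 (- u x))"
      by (simp only: eq[symmetric])
    have gu: "g x * u x = g x * max 0 (u x) - g x * max 0 (- u x)" for x
      by (auto simp: max_def)
    from P Q have P': "integrable N (\<lambda>x. g x * max 0 (u x))" "(\<integral>x. g x * max 0 (u x) \<partial>N) = \<Phi> (\<lambda>x. max 0 (u x))"
      and Q': "integrable N (\<lambda>x. g x * max 0 (- u x))" "(\<integral>x. g x * max 0 (- u x) \<partial>N) = \<Phi> (\<lambda>x. max 0 (- u x))"
      by auto
    show ?thesis
      unfolding gu \<Phi>u using Bochner_Integration.integral_diff[OF P'(1) Q'(1)] P' Q' by auto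
  qed
  with gm that show ?thesis by blast
qed

end

section \<open>Koethe duals\<close>

context riesz_fischer_space
begin

abbreviation dual_norm :: "('a \<Rightarrow> real) \<Rightarrow> real" where
  "dual_norm \<equiv> kdual_norm M X nX"

lemma kdual_measurable: "h \<in> kdual M X \<Longrightarrow> h \<in> borel_measurable M"
  by (simp add: kdual_def mult_space_def)

lemma kdual_integrable: "h \<in> kdual M X \<Longrightarrow> f \<in> X \<Longrightarrow> integrable M (\<lambda>x. h x * f x)"
  by (simp add: kdual_def mult_space_def L1_def)

lemma kdualI:
  "h \<in> borel_measurable M \<Longrightarrow> (\<And>f. f \<in> X \<Longrightarrow> integrable M (\<lambda>x. h x * f x)) \<Longrightarrow> h \<in> kdual M X"
  using measurable by (auto simp: kdual_def mult_space_def L1_def)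

text \<open>The gliding hump for \<open>f \<mapsto> \<integral>\<bar>h * f\<bar>\<close>. Without
  this bound the supremum in \<open>kdual_norm\<close> could range over an unbounded set of reals
  and would carry no information.\<close>

lemma kdual_bounded:
  assumes h: "h \<in> kdual M X"
  obtains K where "0 < K" "\<And>f. f \<in> X \<Longrightarrow> (\<integral>x. \<bar>h x * f x\<bar> \<partial>M) \<le> K * nX f"
proof (rule positive_functional_bounded[where \<Psi> = "\<lambda>f. \<integral>x. \<bar>h x * f x\<bar> \<partial>M"])
  show "(\<integral>x. \<bar>h x * (c * f x)\<bar> \<partial>M) = \<bar>c\<bar> * (\<integral>x. \<bar>h x * f x\<bar> \<partial>M)" for f c
    by (simp add: abs_mult mult.left_commute)
  show "(\<integral>x. \<bar>h x * f x\<bar> \<partial>M) \<le> (\<integral>x. \<bar>h x * g x\<bar> \<partial>M)"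
    if "f \<in> X" "g \<in> X" "AE x in M. \<bar>f x\<bar> \<le> \<bar>g x\<bar>" for f g
    using that(3)
    by (intro integral_mono_AE integrable_abs kdual_integrable[OF h] that(1,2))
      (auto elim!: eventually_mono simp: abs_mult mult_left_mono)
qed (use that in auto)

lemma kdual_norm_upper:
  assumes h: "h \<in> kdual M X" and f: "f \<in> X" "nX f \<le> 1"
  shows "(\<integral>x. \<bar>h x * f x\<bar> \<partial>M) \<le> dual_norm h"
  unfolding kdual_norm_def mult_norm_def L1_norm_def
proof (rule cSUP_upper)
  obtain K where K: "0 < K" "\<And>f. f \<in> X \<Longrightarrow> (\<integral>x. \<bar>h x * f x\<bar> \<partial>M) \<le> K * nX f"
    by (rule kdual_bounded[OF h]) blast
  show "bdd_above ((\<lambda>f. \<integral>x. \<bar>h x * f x\<bar> \<partial>M) ` {f \<in> X. nX f \<le> 1})"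
  proof (rule bdd_aboveI2)
    fix f assume "f \<in> {f \<in> X. nX f \<le> 1}"
    then have "f \<in> X" "K * nX f \<le> K * 1" using K(1) by auto
    with K(2)[of f] show "(\<integral>x. \<bar>h x * f x\<bar> \<partial>M) \<le> K" by simp
  qed
qed (use f in auto)

lemma kdual_norm_least:
  assumes "\<And>f. f \<in> X \<Longrightarrow> nX f \<le> 1 \<Longrightarrow> (\<integral>x. \<bar>h x * f x\<bar> \<partial>M) \<le> K"
  shows "dual_norm h \<le> K"
  unfolding kdual_norm_def mult_norm_def L1_norm_def
  by (rule cSUP_least) (use assms zero norm_zero in auto)

lemma kdual_norm_nonneg: "h \<in> kdual M X \<Longrightarrow> 0 \<le> dual_norm h"
  using kdual_norm_upper[OF _ zero] norm_zero by simp

text \<open>Elements of norm 0 cannot be normalized; for them the cruder bound with \<open>K\<close>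
  already gives integral 0.\<close>

lemma kdual_hoelder:
  assumes h: "h \<in> kdual M X" and f: "f \<in> X"
  shows "(\<integral>x. \<bar>h x * f x\<bar> \<partial>M) \<le> dual_norm h * nX f"
proof (cases "nX f = 0")
  case True
  obtain K where K: "0 < K" "\<And>f. f \<in> X \<Longrightarrow> (\<integral>x. \<bar>h x * f x\<bar> \<partial>M) \<le> K * nX f"
    by (rule kdual_bounded[OF h]) blast
  with True f show ?thesis using K(2)[OF f] by simp
next
  case False
  with norm_nonneg[OF f] have pos: "0 < nX f" by simp
  have "(\<integral>x. \<bar>h x * (inverse (nX f) * f x)\<bar> \<partial>M) \<le> dual_norm h"
    by (rule kdual_norm_upper[OF h scale[OF f]]) (use norm_scale[OF f] pos in simp)
  moreover have "(\<integral>x. \<bar>h x * (inverse (nX f) * f x)\<bar> \<partial>M) = inverse (nX f) * (\<integral>x. \<bar>h x * f x\<bar> \<partial>M)"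
    using pos by (simp add: abs_mult mult.left_commute)
  ultimately show ?thesis using pos by (simp add: field_simps)
qed

text \<open>For the Riesz-Fischer property let \<open>t\<close> be the pointwise sum of the moduli,
  possibly infinite. Termwise integration and Hoelder make \<open>t * \<bar>f\<bar>\<close>
  integrable for each \<open>f\<close> in \<open>X\<close>, so every \<open>f\<close> vanishes where
  \<open>t\<close> is infinite; saturation makes that set null, and the finite version of
  \<open>t\<close> is the required bound.\<close>

lemma kdual_riesz_fischer_space:
  assumes sat: "saturated M X"
  shows "riesz_fischer_space M (kdual M X) dual_norm"
proof
  show "(\<lambda>_. 0) \<in> kdual M X" by (rule kdualI) auto
  show "h \<in> borel_measurable M" if "h \<in> kdual M X" for h by (rule kdual_measurable[OF that])
  show "0 \<le> dual_norm h" if "h \<in> kdual M X" for h by (rule kdual_norm_nonneg[OF that])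
  show "(\<lambda>x. h x + k x) \<in> kdual M X" if "h \<in> kdual M X" "k \<in> kdual M X" for h k
    using kdual_measurable[OF that(1)] kdual_measurable[OF that(2)]
      kdual_integrable[OF that(1)] kdual_integrable[OF that(2)]
    by (intro kdualI) (auto simp: distrib_right)
  show scale': "(\<lambda>x. c * h x) \<in> kdual M X" if "h \<in> kdual M X" for h c
    using kdual_measurable[OF that] kdual_integrable[OF that]
    by (intro kdualI) (auto simp: mult.assoc)
  show "dual_norm (\<lambda>x. h x + k x) \<le> dual_norm h + dual_norm k"
    if h: "h \<in> kdual M X" and k: "k \<in> kdual M X" for h k
  proof (rule kdual_norm_least)
    fix f assume f: "f \<in> X" "nX f \<le> 1"
    note i = kdual_integrable[OF h f(1)] kdual_integrable[OF k f(1)]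
    have "(\<integral>x. \<bar>(h x + k x) * f x\<bar> \<partial>M) \<le> (\<integral>x. \<bar>h x * f x\<bar> + \<bar>k x * f x\<bar> \<partial>M)"
      unfolding distrib_right using i
      by (intro integral_mono integrable_abs Bochner_Integration.integrable_add) auto
    also have "\<dots> \<le> dual_norm h + dual_norm k"
      using i kdual_norm_upper[OF h f] kdual_norm_upper[OF k f] by simp
    finally show "(\<integral>x. \<bar>(h x + k x) * f x\<bar> \<partial>M) \<le> dual_norm h + dual_norm k" .
  qed
  have scale_le: "dual_norm (\<lambda>x. c * h x) \<le> \<bar>c\<bar> * dual_norm h" if h: "h \<in> kdual M X" for h c
  proof (rule kdual_norm_least)
    fix f assume f: "f \<in> X" "nX f \<le> 1"
    show "(\<integral>x. \<bar>c * h x * f x\<bar> \<partial>M) \<le> \<bar>c\<bar> * dual_norm h"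
      using mult_left_mono[OF kdual_norm_upper[OF h f], of "\<bar>c\<bar>"] by (simp add: abs_mult mult.assoc)
  qed
  show "dual_norm (\<lambda>x. c * h x) = \<bar>c\<bar> * dual_norm h" if h: "h \<in> kdual M X" for h c
  proof (cases "c = 0")
    case True
    then show ?thesis using scale_le[OF h, of 0] kdual_norm_nonneg[OF scale'[OF h], of 0] by simp
  next
    case False
    have "(\<lambda>x. inverse c * (c * h x)) = h" using False by (simp add: mult.assoc[symmetric])
    then have "dual_norm h \<le> \<bar>inverse c\<bar> * dual_norm (\<lambda>x. c * h x)"
      using scale_le[OF scale'[OF h], of "inverse c" c] by simp
    then have "\<bar>c\<bar> * dual_norm h \<le> dual_norm (\<lambda>x. c * h x)"
      using False by (simp add: field_simps abs_inverse)
    with scale_le[OF h] show ?thesis by (intro antisym)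
  qed
  have solid': "integrable M (\<lambda>x. h x * f x) \<and> (\<integral>x. \<bar>h x * f x\<bar> \<partial>M) \<le> (\<integral>x. \<bar>k x * f x\<bar> \<partial>M)"
    if h: "h \<in> borel_measurable M" and k: "k \<in> kdual M X" and le: "AE x in M. \<bar>h x\<bar> \<le> \<bar>k x\<bar>" and f: "f \<in> X"
    for h k f
  proof -
    have le': "AE x in M. \<bar>h x * f x\<bar> \<le> \<bar>k x * f x\<bar>"
      using le by eventually_elim (simp add: abs_mult mult_right_mono)
    then have i: "integrable M (\<lambda>x. h x * f x)"
      using h measurable[OF f]
      by (intro Bochner_Integration.integrable_bound[OF kdual_integrable[OF k f]]) auto
    with le' kdual_integrable[OF k f] show ?thesis
      by (intro conjI integral_mono_AE integrable_abs)
  qed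
  show "h \<in> kdual M X"
    if "h \<in> borel_measurable M" "k \<in> kdual M X" "AE x in M. \<bar>h x\<bar> \<le> \<bar>k x\<bar>" for h k
    using solid'[OF that] that(1) by (intro kdualI) auto
  show "dual_norm h \<le> dual_norm k"
    if "h \<in> borel_measurable M" "k \<in> kdual M X" "AE x in M. \<bar>h x\<bar> \<le> \<bar>k x\<bar>" for h k
    using solid'[OF that] kdual_norm_upper[OF that(2)] by (intro kdual_norm_least) (blast intro: order_trans)
  show "\<exists>v\<in>kdual M X. AE x in M. \<forall>n. (\<Sum>k<n. \<bar>u k x\<bar>) \<le> v x"
    if u: "\<And>k::nat. u k \<in> kdual M X" and s: "summable (\<lambda>k. dual_norm (u k))" for u
  proof -
    have [measurable]: "u k \<in> borel_measurable M" for k by (rule kdual_measurable[OF u])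
    define t where "t x = (\<Sum>k. ennreal \<bar>u k x\<bar>)" for x
    have tm[measurable]: "t \<in> borel_measurable M" unfolding t_def by measurable
    have fin: "(\<integral>\<^sup>+x. t x * ennreal \<bar>f x\<bar> \<partial>M) < \<infinity>" if f: "f \<in> X" for f
    proof -
      note [measurable] = measurable[OF f]
      have "(\<integral>\<^sup>+x. t x * ennreal \<bar>f x\<bar> \<partial>M) = (\<integral>\<^sup>+x. (\<Sum>k. ennreal \<bar>u k x * f x\<bar>) \<partial>M)"
        by (intro nn_integral_cong) (simp add: t_def abs_mult ennreal_mult')
      also have "\<dots> = (\<Sum>k. \<integral>\<^sup>+x. ennreal \<bar>u k x * f x\<bar> \<partial>M)"
        by (rule nn_integral_suminf) measurable
      also have "\<dots> \<le> (\<Sum>k. ennreal (dual_norm (u k) * nX f))"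
      proof (intro suminf_le summableI)
        fix k
        have "(\<integral>\<^sup>+x. ennreal \<bar>u k x * f x\<bar> \<partial>M) = ennreal (\<integral>x. \<bar>u k x * f x\<bar> \<partial>M)"
          using kdual_integrable[OF u f] by (intro nn_integral_eq_integral) auto
        also have "\<dots> \<le> ennreal (dual_norm (u k) * nX f)"
          by (intro ennreal_leI kdual_hoelder u f)
        finally show "(\<integral>\<^sup>+x. ennreal \<bar>u k x * f x\<bar> \<partial>M) \<le> ennreal (dual_norm (u k) * nX f)" .
      qed
      also have "\<dots> = ennreal (\<Sum>k. dual_norm (u k) * nX f)"
        by (intro suminf_ennreal2 summable_mult2[OF s] mult_nonneg_nonneg kdual_norm_nonneg u norm_nonneg f)
      finally show ?thesis by (simp add: le_less_trans)
    qed
    define A where "A = {x\<in>space M. t x = \<infinity>}"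
    have A: "A \<in> sets M" unfolding A_def by measurable
    have "AE x in M. x \<in> A \<longrightarrow> f x = 0" if f: "f \<in> X" for f
    proof -
      note [measurable] = measurable[OF f]
      have "AE x in M. t x * ennreal \<bar>f x\<bar> \<noteq> \<infinity>"
        using fin[OF f] by (intro nn_integral_PInf_AE) auto
      then show ?thesis
        by eventually_elim (auto simp: A_def ennreal_top_mult split: if_splits)
    qed
    with sat A have "emeasure M A = 0" unfolding saturated_def by (metis not_gr_zero)
    with A have "AE x in M. x \<notin> A" by (intro AE_not_in) (auto simp: null_sets_def)
    with AE_space have t_fin: "AE x in M. t x \<noteq> \<infinity>" by eventually_elim (simp add: A_def)
    define v where "v x = enn2real (t x)" for x
    have vm[measurable]: "v \<in> borel_measurable M" unfolding v_def by measurable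
    have "v \<in> kdual M X"
    proof (rule kdualI[OF vm])
      fix f assume f: "f \<in> X"
      note [measurable] = measurable[OF f]
      have "(\<integral>\<^sup>+x. ennreal (norm (v x * f x)) \<partial>M) = (\<integral>\<^sup>+x. t x * ennreal \<bar>f x\<bar> \<partial>M)"
        using t_fin
        by (intro nn_integral_cong_AE)
          (auto elim!: eventually_mono simp: v_def abs_mult ennreal_mult' ennreal_enn2real_if)
      with fin[OF f] show "integrable M (\<lambda>x. v x * f x)"
        by (simp add: integrable_iff_bounded)
    qed
    moreover from t_fin have "AE x in M. \<forall>n. (\<Sum>k<n. \<bar>u k x\<bar>) \<le> v x"
    proof eventually_elim
      case (elim x)
      show ?case
      proof
        fix n
        have "(\<Sum>k<n. ennreal \<bar>u k x\<bar>) \<le> t x"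
          unfolding t_def by (intro sum_le_suminf summableI) auto
        also have "t x = ennreal (v x)" using elim by (simp add: v_def ennreal_enn2real_if)
        finally show "(\<Sum>k<n. \<bar>u k x\<bar>) \<le> v x"
          by (simp add: v_def)
      qed
    qed
    ultimately show ?thesis by blast
  qed
qed

text \<open>Hahn--Banach for the inf-convolution of the norm with a weighted one-sided \<open>L\<^sup>1\<close> norm:
  domination by the former puts the functional into the Koethe dual, domination by the latter
  makes it order continuous.\<close>

lemma kdual_saturated:
  assumes sf: "sigma_finite_measure M"
  shows "saturated M (kdual M X)"
  unfolding saturated_def
proof (intro notI, elim bexE conjE)
  fix A assume A[measurable]: "A \<in> sets M" and Apos: "0 < emeasure M A"
    and vanish: "\<forall>w\<in>kdual M X. AE x in M. x \<in> A \<longrightarrow> w x = 0"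
  interpret sigma_finite_measure M by (rule sf)
  obtain \<theta> :: "'a \<Rightarrow> real" where \<theta>m[measurable]: "\<theta> \<in> borel_measurable M" and \<theta>: "\<And>x. \<theta> x > 0"
    and \<theta>i: "integrable M \<theta>"
    using obtain_positive_integrable_function by metis
  have \<theta>0: "0 \<le> \<theta> x" for x using \<theta>[of x] by simp
  \<comment> \<open>The L1 space with weight \<open>\<theta>\<close>. Since \<open>\<theta>\<close>
    is integrable, it contains the bounded measurable functions, in particular
    \<open>indicator A\<close>.\<close>
  define V where "V = {v \<in> borel_measurable M. integrable M (\<lambda>x. \<theta> x * v x)}"
  have Vm: "v \<in> borel_measurable M" and Vi: "integrable M (\<lambda>x. \<theta> x * v x)" if "v \<in> V" for v
    using that by (auto simp: V_def)
  have V_sub: "fun_subspace V"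
    by (auto simp: fun_subspace_def V_def distrib_left mult.left_commute[of "\<theta> _"])
  have V_bound: "v \<in> V" if v: "v \<in> borel_measurable M" and w: "w \<in> V" and le: "AE x in M. \<bar>v x\<bar> \<le> \<bar>w x\<bar>" for v w
  proof -
    have "integrable M (\<lambda>x. \<theta> x * v x)"
    proof (rule Bochner_Integration.integrable_bound[OF Vi[OF w]])
      show "AE x in M. norm (\<theta> x * v x) \<le> norm (\<theta> x * w x)"
        using le by eventually_elim (use \<theta>0 in \<open>simp add: abs_mult mult_left_mono\<close>)
    qed (use v in measurable)
    with v show ?thesis by (simp add: V_def)
  qed
  have V_solid: "solid_subspace M V"
    using V_sub V_bound Vm unfolding solid_subspace_def by blast
  have one: "(\<lambda>_. 1) \<in> V" using \<theta>i by (simp add: V_def)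
  have ind: "indicator A \<in> V"
    by (rule V_bound[OF _ one]) (auto simp: indicator_def)
  \<comment> \<open>The cost of covering \<open>v\<close> by \<open>f\<close>: the norm of
    \<open>f\<close> plus the weighted mass of \<open>v\<close> left uncovered. Covering by 0 gives
    the weighted integral of the positive part of \<open>v\<close>; covering a nonnegative
    \<open>v\<close> in \<open>X\<close> by itself gives \<open>nX v\<close>.\<close>
  define c where "c v f = nX f + (\<integral>x. \<theta> x * max 0 (v x - f x) \<partial>M)" for v f
  define P where "P = {f\<in>X. \<forall>x. 0 \<le> f x}"
  define p where "p v = (INF f\<in>P. c v f)" for v
  have P0: "(\<lambda>_. 0) \<in> P" using zero by (simp add: P_def)
  have ci: "integrable M (\<lambda>x. \<theta> x * max 0 (v x - f x))" if v: "v \<in> V" and f: "f \<in> P" for v f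
  proof (rule Vi, rule V_bound[OF _ v])
    show "(\<lambda>x. max 0 (v x - f x)) \<in> borel_measurable M"
      using Vm[OF v] measurable[of f] f by (auto simp: P_def)
    have "0 \<le> f x" for x using f by (simp add: P_def)
    then have "\<bar>max 0 (v x - f x)\<bar> \<le> \<bar>v x\<bar>" for x
      by (smt (verit, best))
    then show "AE x in M. \<bar>max 0 (v x - f x)\<bar> \<le> \<bar>v x\<bar>" by simp
  qed
  have int0: "0 \<le> (\<integral>x. \<theta> x * max 0 (v x - f x) \<partial>M)" for v f
    using \<theta>0 by (intro Bochner_Integration.integral_nonneg) auto
  have c0: "0 \<le> c v f" if "f \<in> P" for v f
    using that norm_nonneg[of f] int0[of v f] by (auto simp: c_def P_def)
  have p_le: "p v \<le> c v f" if "f \<in> P" for v f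
    unfolding p_def by (rule cINF_lower[OF bdd_belowI2[of _ 0] that]) (rule c0)
  have p_greatest: "a \<le> p v" if "\<And>f. f \<in> P \<Longrightarrow> a \<le> c v f" for a v
    unfolding p_def by (rule cINF_greatest) (use P0 that in auto)
  have p0: "0 \<le> p v" for v by (rule p_greatest[OF c0])
  have p_sub: "sublinear_on V p"
    unfolding sublinear_on_def
  proof (intro conjI ballI allI impI)
    fix v w assume v: "v \<in> V" and w: "w \<in> V"
    have le: "p (\<lambda>x. v x + w x) \<le> c v f + c w g" if f: "f \<in> P" and g: "g \<in> P" for f g
    proof -
      have fg: "(\<lambda>x. f x + g x) \<in> P" using f g by (auto simp: P_def intro: add)
      have "(\<integral>x. \<theta> x * max 0 (v x + w x - (f x + g x)) \<partial>M)
        \<le> (\<integral>x. \<theta> x * max 0 (v x - f x) + \<theta> x * max 0 (w x - g x) \<partial>M)"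
      proof (rule integral_mono)
        show "integrable M (\<lambda>x. \<theta> x * max 0 (v x - f x) + \<theta> x * max 0 (w x - g x))"
          by (intro Bochner_Integration.integrable_add ci f g v w)
        show "integrable M (\<lambda>x. \<theta> x * max 0 (v x + w x - (f x + g x)))"
          by (rule ci[OF fun_subspace_add[OF V_sub v w] fg])
        show "\<theta> x * max 0 (v x + w x - (f x + g x)) \<le> \<theta> x * max 0 (v x - f x) + \<theta> x * max 0 (w x - g x)" for x
          unfolding distrib_left[symmetric] using \<theta>0 by (intro mult_left_mono) auto
      qed
      also have "\<dots> = (\<integral>x. \<theta> x * max 0 (v x - f x) \<partial>M) + (\<integral>x. \<theta> x * max 0 (w x - g x) \<partial>M)"
        by (intro Bochner_Integration.integral_add ci f g v w)
      finally have "c (\<lambda>x. v x + w x) (\<lambda>x. f x + g x) \<le> c v f + c w g"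
        using norm_add[of f g] f g by (simp add: c_def P_def)
      with p_le[OF fg] show ?thesis by (rule order_trans)
    qed
    have "p (\<lambda>x. v x + w x) - c w g \<le> p v" if "g \<in> P" for g
      using le[OF _ that] by (intro p_greatest) (simp add: algebra_simps)
    then have "p (\<lambda>x. v x + w x) - p v \<le> p w"
      by (intro p_greatest) (simp add: algebra_simps)
    then show "p (\<lambda>x. v x + w x) \<le> p v + p w" by simp
  next
    fix v and a :: real assume v: "v \<in> V" and a: "0 < a"
    have "p (\<lambda>x. a * v x) / a \<le> p v"
    proof (rule p_greatest)
      fix f assume f: "f \<in> P"
      then have af: "(\<lambda>x. a * f x) \<in> P" using a by (auto simp: P_def intro: scale)
      have "\<theta> x * max 0 (a * v x - a * f x) = a * (\<theta> x * max 0 (v x - f x))" for x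
        using a by (auto simp: max_def algebra_simps mult_less_cancel_left)
      then have "(\<integral>x. \<theta> x * max 0 (a * v x - a * f x) \<partial>M) = a * (\<integral>x. \<theta> x * max 0 (v x - f x) \<partial>M)"
        by (simp only: Bochner_Integration.integral_mult_right_zero)
      then have "c (\<lambda>x. a * v x) (\<lambda>x. a * f x) = a * c v f"
        using a f norm_scale[of f a] by (simp add: c_def P_def distrib_left)
      with p_le[OF af, of "\<lambda>x. a * v x"] a show "p (\<lambda>x. a * v x) / a \<le> c v f"
        by (simp add: field_simps)
    qed
    with a show "p (\<lambda>x. a * v x) \<le> a * p v" by (simp add: field_simps)
  qed
  \<comment> \<open>If \<open>indicator A\<close> could be covered at arbitrarily small cost, covers
    with summable norms would tend to 0 almost everywhere. By dominated convergence the uncovered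
    mass would then tend to the full weighted mass of \<open>A\<close>, which is positive, although
    it is at most the cost.\<close>
  have p_pos: "0 < p (indicator A)"
  proof (rule ccontr)
    assume "\<not> 0 < p (indicator A)"
    with p0 have p_eq: "p (indicator A) = 0" by (simp add: antisym not_less)
    have "\<exists>f\<in>P. c (indicator A) f < (1/2) ^ n" for n :: nat
    proof (rule ccontr)
      assume "\<not> ?thesis"
      then have "(1/2) ^ n \<le> p (indicator A)" by (intro p_greatest) (auto simp: not_less)
      moreover have "(0::real) < (1/2) ^ n" by simp
      ultimately show False using p_eq by linarith
    qed
    then obtain f where f: "\<And>n. f n \<in> P" and fc: "\<And>n. c (indicator A) (f n) < (1/2) ^ n" by metis
    have fX: "f n \<in> X" and f0: "0 \<le> f n x" for n x using f[of n] by (auto simp: P_def)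
    note [measurable] = measurable[OF fX]
    have "nX (f n) \<le> (1/2) ^ n" for n
      using fc[of n] int0[of "indicator A" "f n"] by (simp add: c_def)
    then have "summable (\<lambda>n. nX (f n))"
      by (intro summable_if_le_half_powers norm_nonneg fX)
    then have "AE x in M. (\<lambda>n. f n x) \<longlonglongrightarrow> 0" by (rule AE_tendsto_zero[OF fX])
    then have lim: "AE x in M. (\<lambda>n. \<theta> x * max 0 (indicator A x - f n x)) \<longlonglongrightarrow> \<theta> x * indicator A x"
    proof eventually_elim
      case (elim x)
      have "(\<lambda>n. \<theta> x * max 0 (indicator A x - f n x)) \<longlonglongrightarrow> \<theta> x * max 0 (indicator A x - 0)"
        by (intro tendsto_intros elim)
      then show ?case by simp
    qed
    have "(\<lambda>n. \<integral>x. \<theta> x * max 0 (indicator A x - f n x) \<partial>M) \<longlonglongrightarrow> (\<integral>x. \<theta> x * indicator A x \<partial>M)"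
    proof (rule integral_dominated_convergence[OF _ _ \<theta>i lim])
      show "AE x in M. norm (\<theta> x * max 0 (indicator A x - f n x)) \<le> \<theta> x" for n
      proof (rule AE_I2)
        fix x
        have "max 0 (indicator A x - f n x) \<le> 1" using f0[of n x] by (auto simp: indicator_def)
        then show "norm (\<theta> x * max 0 (indicator A x - f n x)) \<le> \<theta> x"
          using mult_left_mono[of "max 0 (indicator A x - f n x)" 1 "\<theta> x"] \<theta>0[of x] by (simp add: abs_mult)
      qed
    qed measurable
    moreover have "(\<lambda>n. \<integral>x. \<theta> x * max 0 (indicator A x - f n x) \<partial>M) \<longlonglongrightarrow> 0"
    proof (rule tendsto_sandwich[OF always_eventually always_eventually tendsto_const])
      show "\<forall>n. 0 \<le> (\<integral>x. \<theta> x * max 0 (indicator A x - f n x) \<partial>M)" by (simp add: int0)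
      show "\<forall>n. (\<integral>x. \<theta> x * max 0 (indicator A x - f n x) \<partial>M) \<le> (1/2) ^ n"
      proof
        fix n show "(\<integral>x. \<theta> x * max 0 (indicator A x - f n x) \<partial>M) \<le> (1/2) ^ n"
          using fc[of n] norm_nonneg[OF fX, of n] by (simp add: c_def)
      qed
      show "(\<lambda>n. (1/2::real) ^ n) \<longlonglongrightarrow> 0" by (rule LIMSEQ_power_zero) simp
    qed
    ultimately have "(\<integral>x. \<theta> x * indicator A x \<partial>M) = 0" by (rule LIMSEQ_unique)
    then have "AE x in M. \<theta> x * indicator A x = 0"
      using \<theta>0 Vi[OF ind] by (subst (asm) integral_nonneg_eq_0_iff_AE) auto
    then have "AE x in M. x \<notin> A"
    proof eventually_elim
      case (elim x) then show ?case using \<theta>[of x] by (auto simp: indicator_def)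
    qed
    then have "emeasure M A = 0"
      using A by (simp add: AE_iff_measurable[OF A, of "\<lambda>x. x \<notin> A"] sets.sets_into_space Collect_conj_eq Int_absorb1 subset_eq)
    with Apos show False by simp
  qed
  define L where "L = {((\<lambda>x. a * indicator A x), a * p (indicator A)) | a. True}"
  obtain F where F_add: "\<And>u v. u \<in> V \<Longrightarrow> v \<in> V \<Longrightarrow> F (\<lambda>x. u x + v x) = F u + F v"
    and F_scale: "\<And>u c. u \<in> V \<Longrightarrow> F (\<lambda>x. c * u x) = c * F u"
    and F_le: "\<And>u. u \<in> V \<Longrightarrow> F u \<le> p u"
    and F_L: "\<And>w a. (w, a) \<in> L \<Longrightarrow> F w = a"
  proof (rule hahn_banach_relation[OF V_sub p_sub, of L])
    show "w \<in> V" if "(w, a) \<in> L" for w a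
      using that fun_subspace_scale[OF V_sub ind] by (auto simp: L_def)
    show "L \<noteq> {}" by (auto simp: L_def)
    show "((\<lambda>x. w x + w' x), a + a') \<in> L" if l: "(w, a) \<in> L" "(w', a') \<in> L" for w a w' a'
    proof -
      obtain b b' where "w = (\<lambda>x. b * indicator A x)" "a = b * p (indicator A)"
        "w' = (\<lambda>x. b' * indicator A x)" "a' = b' * p (indicator A)"
        using l by (auto simp: L_def)
      then show ?thesis
        unfolding L_def by (intro CollectI exI[of _ "b + b'"]) (auto simp: distrib_right)
    qed
    show "((\<lambda>x. k * w x), k * a) \<in> L" if l: "(w, a) \<in> L" for w a k
    proof -
      obtain b where "w = (\<lambda>x. b * indicator A x)" "a = b * p (indicator A)"
        using l by (auto simp: L_def)
      then show ?thesis
        unfolding L_def by (intro CollectI exI[of _ "k * b"]) (auto simp: mult.assoc)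
    qed
    show "a \<le> p w" if l: "(w, a) \<in> L" for w a
    proof -
      obtain b where b: "w = (\<lambda>x. b * indicator A x)" "a = b * p (indicator A)"
        using l by (auto simp: L_def)
      show ?thesis
      proof (cases "0 < b")
        case True
        then show ?thesis using sublinear_on_scale[OF p_sub V_sub ind, of b] b by simp
      next
        case False
        then have "a \<le> 0" using b p_pos by (simp add: mult_nonpos_nonneg)
        with p0 show ?thesis by (blast intro: order_trans)
      qed
    qed
  qed (rule that, assumption+)
  \<comment> \<open>The cover \<open>f = 0\<close>. Applied to \<open>- u\<close> this gives
    positivity of \<open>F\<close>, and applied to both signs of \<open>indicator (B i) * u\<close>
    it gives order continuity.\<close>
  have F_int: "F v \<le> (\<integral>x. \<theta> x * max 0 (v x) \<partial>M)" if "v \<in> V" for v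
    using order_trans[OF F_le[OF that] p_le[OF P0]] by (simp add: c_def norm_zero)
  have F_minus: "F (\<lambda>x. - v x) = - F v" if "v \<in> V" for v
    using F_scale[OF that, of "- 1"] by simp
  have minus: "(\<lambda>x. - v x) \<in> V" if "v \<in> V" for v
    using fun_subspace_scale[OF V_sub that, of "- 1"] by simp
  interpret F: order_continuous_functional M V F
  proof
    show "solid_subspace M V" by (rule V_solid)
    show "0 \<le> F u" if u: "u \<in> V" and nn: "AE x in M. 0 \<le> u x" for u
    proof -
      have "(\<integral>x. \<theta> x * max 0 (- u x) \<partial>M) = 0"
        using nn by (intro integral_eq_zero_AE) (auto elim!: eventually_mono simp: max_def)
      with F_int[OF minus[OF u]] F_minus[OF u] show ?thesis by simp
    qed
    show "(\<lambda>i. F (\<lambda>x. indicator (B i) x * u x)) \<longlonglongrightarrow> 0"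
      if u: "u \<in> V" and B: "range B \<subseteq> sets M" "decseq B" "(\<Inter>i. B i) = {}" for u and B :: "nat \<Rightarrow> 'a set"
    proof (rule Lim_null_comparison[OF always_eventually])
      note [measurable] = Vm[OF u]
      have [measurable]: "B i \<in> sets M" for i using B by auto
      have Bu: "(\<lambda>x. indicator (B i) x * u x) \<in> V" for i
        by (rule V_bound[OF _ u]) (auto simp: indicator_def)
      have Bi: "integrable M (\<lambda>x. \<theta> x * (indicator (B i) x * \<bar>u x\<bar>))" for i
        by (rule Vi, rule V_bound[OF _ u]) (auto simp: indicator_def)
      have le: "F v \<le> (\<integral>x. \<theta> x * (indicator (B i) x * \<bar>u x\<bar>) \<partial>M)"
        if v: "v \<in> V" and vl: "\<And>x. v x \<le> indicator (B i) x * \<bar>u x\<bar>" for v i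
      proof -
        have "(\<integral>x. \<theta> x * max 0 (v x) \<partial>M) \<le> (\<integral>x. \<theta> x * (indicator (B i) x * \<bar>u x\<bar>) \<partial>M)"
        proof (rule integral_mono[OF _ Bi])
          show "integrable M (\<lambda>x. \<theta> x * max 0 (v x))" using ci[OF v P0] by simp
          show "\<theta> x * max 0 (v x) \<le> \<theta> x * (indicator (B i) x * \<bar>u x\<bar>)" for x
            using vl[of x] \<theta>0 by (intro mult_left_mono) (auto simp: indicator_def)
        qed
        with F_int[OF v] show ?thesis by (rule order_trans)
      qed
      show "\<forall>i. norm (F (\<lambda>x. indicator (B i) x * u x)) \<le> (\<integral>x. \<theta> x * (indicator (B i) x * \<bar>u x\<bar>) \<partial>M)"
      proof
        fix i
        show "norm (F (\<lambda>x. indicator (B i) x * u x)) \<le> (\<integral>x. \<theta> x * (indicator (B i) x * \<bar>u x\<bar>) \<partial>M)"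
        proof -
          have "F (\<lambda>x. indicator (B i) x * u x) \<le> (\<integral>x. \<theta> x * (indicator (B i) x * \<bar>u x\<bar>) \<partial>M)"
            by (rule le[OF Bu]) (auto simp: indicator_def)
          moreover have "F (\<lambda>x. - (indicator (B i) x * u x)) \<le> (\<integral>x. \<theta> x * (indicator (B i) x * \<bar>u x\<bar>) \<partial>M)"
            by (rule le[OF minus[OF Bu]]) (auto simp: indicator_def)
          ultimately show ?thesis using F_minus[OF Bu, of i] by (simp add: abs_le_iff)
        qed
      qed
      have "(\<lambda>i. \<integral>x. \<theta> x * (indicator (B i) x * \<bar>u x\<bar>) \<partial>M) \<longlonglongrightarrow> (\<integral>x. 0 \<partial>M)"
      proof (rule integral_dominated_convergence)
        show "integrable M (\<lambda>x. \<theta> x * \<bar>u x\<bar>)"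
          by (rule Vi, rule V_bound[OF _ u]) auto
        show "AE x in M. norm (\<theta> x * (indicator (B i) x * \<bar>u x\<bar>)) \<le> \<theta> x * \<bar>u x\<bar>" for i
          using \<theta>0 by (auto simp: indicator_def abs_mult)
        show "AE x in M. (\<lambda>i. \<theta> x * (indicator (B i) x * \<bar>u x\<bar>)) \<longlonglongrightarrow> 0"
        proof (rule AE_I2)
          fix x
          have "(\<lambda>i. indicator (B i) x :: real) \<longlonglongrightarrow> indicator (\<Inter>i. B i) x"
            by (rule LIMSEQ_indicator_decseq[OF B(2)])
          then have "(\<lambda>i. \<theta> x * (indicator (B i) x * \<bar>u x\<bar>)) \<longlonglongrightarrow> \<theta> x * (indicator (\<Inter>i. B i) x * \<bar>u x\<bar>)"
            by (intro tendsto_intros)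
          then show "(\<lambda>i. \<theta> x * (indicator (B i) x * \<bar>u x\<bar>)) \<longlonglongrightarrow> 0" using B(3) by simp
        qed
      qed measurable
      then show "(\<lambda>i. \<integral>x. \<theta> x * (indicator (B i) x * \<bar>u x\<bar>) \<partial>M) \<longlonglongrightarrow> 0" by simp
    qed
  qed (fact F_add, fact F_scale)
  obtain w where wm[measurable]: "w \<in> borel_measurable M"
    and wi: "\<And>u. u \<in> V \<Longrightarrow> integrable M (\<lambda>x. w x * u x)"
    and w_eq: "\<And>u. u \<in> V \<Longrightarrow> (\<integral>x. w x * u x \<partial>M) = F u"
    by (rule F.integral_representation[OF one]) auto
  have w_nn: "AE x in M. 0 \<le> w x"
  proof (rule density_nonneg)
    show "integrable M w" using wi[OF one] by simp
    fix B assume B: "B \<in> sets M"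
    have "(\<integral>x\<in>B. w x \<partial>M) = (\<integral>x. w x * (indicator B x * 1) \<partial>M)"
      by (simp add: set_lebesgue_integral_def mult.commute)
    also have "\<dots> = F (\<lambda>x. indicator B x * 1)" by (rule w_eq[OF F.V_indicator[OF one B]])
    also have "0 \<le> \<dots>" by (rule F.\<Phi>_pos[OF F.V_indicator[OF one B]]) (auto simp: indicator_def)
    finally show "0 \<le> (\<integral>x\<in>B. w x \<partial>M)" .
  qed
  have "w \<in> kdual M X"
  proof (rule kdualI[OF wm])
    fix f assume f: "f \<in> X"
    note [measurable] = measurable[OF f]
    \<comment> \<open>Truncations lie in \<open>X\<close> by solidity and in \<open>V\<close> by
      boundedness, so each can be covered by itself and \<open>F (t n) \<le> nX (t n)\<close>.
      Fatou's lemma carries the bound over to \<open>\<bar>f\<bar>\<close>.\<close>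
    define t where "t n x = min \<bar>f x\<bar> (real n)" for n x
    have tm[measurable]: "t n \<in> borel_measurable M" for n unfolding t_def[abs_def] by measurable
    have tX: "t n \<in> X" for n by (rule solid[OF tm f]) (auto simp: t_def)
    have tV: "t n \<in> V" for n
      by (rule V_bound[OF tm fun_subspace_scale[OF V_sub one, of "real n"]]) (auto simp: t_def)
    have tP: "t n \<in> P" for n using tX by (auto simp: P_def t_def)
    have int_t: "(\<integral>x. w x * t n x \<partial>M) \<le> nX f" for n
    proof -
      have "(\<integral>x. w x * t n x \<partial>M) \<le> c (t n) (t n)"
        using order_trans[OF F_le[OF tV] p_le[OF tP]] w_eq[OF tV] by simp
      also have "\<dots> = nX (t n)" by (simp add: c_def)
      also have "\<dots> \<le> nX f" by (rule norm_mono[OF tm f]) (auto simp: t_def)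
      finally show ?thesis .
    qed
    have nn_t: "(\<integral>\<^sup>+x. ennreal (w x * t n x) \<partial>M) \<le> ennreal (nX f)" for n
    proof -
      have "AE x in M. 0 \<le> w x * t n x"
        using w_nn by eventually_elim (simp add: t_def)
      with int_t show ?thesis
        by (subst nn_integral_eq_integral[OF wi[OF tV]]) (auto intro: ennreal_leI)
    qed
    have "(\<integral>\<^sup>+x. ennreal (norm (w x * f x)) \<partial>M) \<le> (\<integral>\<^sup>+x. liminf (\<lambda>n. ennreal (w x * t n x)) \<partial>M)"
    proof (rule nn_integral_mono_AE, use w_nn in eventually_elim)
      fix x assume w: "0 \<le> w x"
      have "eventually (\<lambda>n. t n x = \<bar>f x\<bar>) sequentially"
        using filterlim_real_sequentially[unfolded filterlim_at_top, rule_format, of "\<bar>f x\<bar>"]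
        by eventually_elim (simp add: t_def)
      then have "(\<lambda>n. ennreal (w x * t n x)) \<longlonglongrightarrow> ennreal (w x * \<bar>f x\<bar>)"
        by (intro tendsto_eventually) (auto elim: eventually_mono)
      then have "liminf (\<lambda>n. ennreal (w x * t n x)) = ennreal (w x * \<bar>f x\<bar>)"
        by (intro lim_imp_Liminf) auto
      with w show "ennreal (norm (w x * f x)) \<le> liminf (\<lambda>n. ennreal (w x * t n x))"
        by (simp add: abs_mult)
    qed
    also have "\<dots> \<le> liminf (\<lambda>n. \<integral>\<^sup>+x. ennreal (w x * t n x) \<partial>M)"
      by (rule nn_integral_liminf) measurable
    also have "\<dots> \<le> ennreal (nX f)"
      by (rule Liminf_le) (auto intro!: always_eventually nn_t)
    finally show "integrable M (\<lambda>x. w x * f x)"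
      by (simp add: integrable_iff_bounded le_less_trans)
  qed
  \<comment> \<open>By assumption \<open>w\<close> vanishes almost everywhere on \<open>A\<close>,
    while its integral over \<open>A\<close> is \<open>F (indicator A) = p (indicator A)\<close>,
    which is positive.\<close>
  with vanish have "AE x in M. w x * indicator A x = 0"
    by (auto elim!: eventually_mono simp: indicator_def)
  then have "(\<integral>x. w x * indicator A x \<partial>M) = 0" by (rule integral_eq_zero_AE)
  moreover have "(\<integral>x. w x * indicator A x \<partial>M) = p (indicator A)"
    using w_eq[OF ind] F_L[of "indicator A" "p (indicator A)"] by (force simp: L_def)
  ultimately show False using p_pos by simp
qed

end

text \<open>By Hoelder the functional \<open>k \<mapsto> \<integral>d * k\<close> is continuous, so
  it vanishes on all of \<open>X\<close> once it vanishes on the basis. Testing it on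
  \<open>sgn d * e\<close> with a weak unit \<open>e\<close> gives
  \<open>\<integral>\<bar>d\<bar> * e = 0\<close>.\<close>

lemma (in riesz_fischer_space) kdual_annihilator_basis:
  assumes sf: "sigma_finite_measure M" and sat: "saturated M X"
    and basis: "schauder_basis X nX b" and d: "d \<in> kdual M X"
    and ann: "\<And>i. (\<integral>x. d x * b i x \<partial>M) = 0"
  shows "AE x in M. d x = 0"
proof -
  note [measurable] = kdual_measurable[OF d]
  have b: "b i \<in> X" for i using basis by (simp add: schauder_basis_def)
  have zero': "(\<integral>x. d x * k x \<partial>M) = 0" if k: "k \<in> X" for k
  proof -
    obtain a where a: "(\<lambda>n. nX (\<lambda>x. k x - (\<Sum>i<n. a i * b i x))) \<longlonglongrightarrow> 0"
      using basis k unfolding schauder_basis_def by blast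
    have "\<bar>\<integral>x. d x * k x \<partial>M\<bar> \<le> kdual_norm M X nX d * nX (\<lambda>x. k x - (\<Sum>i<n. a i * b i x))" for n
    proof -
      define s where "s x = (\<Sum>i<n. a i * b i x)" for x
      have s: "s \<in> X" unfolding s_def by (rule sum) (rule b)
      have "(\<integral>x. d x * s x \<partial>M) = (\<integral>x. (\<Sum>i<n. a i * (d x * b i x)) \<partial>M)"
        by (simp add: s_def sum_distrib_left mult.left_commute)
      also have "\<dots> = (\<Sum>i<n. a i * (\<integral>x. d x * b i x \<partial>M))"
        using kdual_integrable[OF d b] by (subst Bochner_Integration.integral_sum) auto
      finally have "(\<integral>x. d x * s x \<partial>M) = 0" by (simp add: ann)
      then have "(\<integral>x. d x * k x \<partial>M) = (\<integral>x. d x * (k x - s x) \<partial>M)"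
        using kdual_integrable[OF d k] kdual_integrable[OF d s] by (simp add: right_diff_distrib)
      also have "\<bar>\<dots>\<bar> \<le> (\<integral>x. \<bar>d x * (k x - s x)\<bar> \<partial>M)" by (rule integral_abs_bound)
      also have "\<dots> \<le> kdual_norm M X nX d * nX (\<lambda>x. k x - s x)"
        by (rule kdual_hoelder[OF d diff[OF k s]])
      finally show ?thesis by (simp add: s_def)
    qed
    moreover have "(\<lambda>n. kdual_norm M X nX d * nX (\<lambda>x. k x - (\<Sum>i<n. a i * b i x))) \<longlonglongrightarrow> 0"
      using tendsto_mult_left[OF a] by simp
    ultimately have "\<bar>\<integral>x. d x * k x \<partial>M\<bar> \<le> 0" by (intro LIMSEQ_le_const) auto
    then show ?thesis by simp
  qed
  obtain e where e: "e \<in> X" "AE x in M. 0 < e x" by (rule weak_unit[OF sf sat])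
  note [measurable] = measurable[OF e(1)]
  have se: "(\<lambda>x. sgn (d x) * e x) \<in> X"
    by (rule solid[OF _ e(1)]) (auto simp: abs_mult sgn_if)
  have "AE x in M. d x * (sgn (d x) * e x) = 0"
  proof (subst integral_nonneg_eq_0_iff_AE[symmetric])
    show "integrable M (\<lambda>x. d x * (sgn (d x) * e x))" by (rule kdual_integrable[OF d se])
    show "AE x in M. 0 \<le> d x * (sgn (d x) * e x)"
      using e(2) by eventually_elim (auto simp: sgn_if mult_nonpos_nonneg)
    show "(\<integral>x. d x * (sgn (d x) * e x) \<partial>M) = 0" by (rule zero'[OF se])
  qed
  with e(2) show ?thesis by eventually_elim (auto simp: sgn_if split: if_splits)
qed

section \<open>The \<open>\<pi>\<close>-product\<close>

text \<open>Partial sums of even length split into the two series. The inequality suffices, since a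
  representation only has to dominate.\<close>

lemma suminf_interleave_ge:
  fixes a b :: "nat \<Rightarrow> ennreal"
  shows "suminf a + suminf b \<le> (\<Sum>n. if even n then a (n div 2) else b (n div 2))"
proof -
  let ?c = "\<lambda>n. if even n then a (n div 2) else b (n div 2)"
  have eq: "(\<Sum>n<2 * m. ?c n) = (\<Sum>n<m. a n) + (\<Sum>n<m. b n)" for m
    by (induction m) (auto simp: algebra_simps)
  have "(\<lambda>m. (\<Sum>n<m. a n) + (\<Sum>n<m. b n)) \<longlonglongrightarrow> suminf a + suminf b"
    by (intro tendsto_add summable_LIMSEQ summableI)
  moreover have "(\<Sum>n<m. a n) + (\<Sum>n<m. b n) \<le> suminf ?c" for m
    unfolding eq[symmetric] by (intro sum_le_suminf summableI) auto
  ultimately show ?thesis by (intro LIMSEQ_le_const2) auto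
qed

locale product_pair =
  Y: riesz_fischer_space N Y nY + Z: riesz_fischer_space N Z nZ
  for N :: "'b measure" and Y nY Z nZ
begin

abbreviation "rep \<equiv> pi_rep N Y nY Z nZ"
abbreviation "pn \<equiv> pi_norm N Y nY Z nZ"

text \<open>One product per function, instead of the series allowed in \<open>pi_space\<close>: this
  keeps finite sums inside, because two products can be merged into one, and lets order continuity
  of a single factor act.\<close>

definition product_ideal :: "('b \<Rightarrow> real) set" where
  "product_ideal = {u \<in> borel_measurable N. \<exists>f\<in>Y. \<exists>k\<in>Z. AE y in N. \<bar>u y\<bar> \<le> \<bar>f y * k y\<bar>}"

lemma rep_sum_nonneg: "rep u f g \<Longrightarrow> 0 \<le> (\<Sum>n. nY (f n) * nZ (g n))"
  by (intro suminf_nonneg) (auto simp: pi_rep_def Y.norm_nonneg Z.norm_nonneg)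

lemma pi_norm_lower: "rep u f g \<Longrightarrow> pn u \<le> (\<Sum>n. nY (f n) * nZ (g n))"
  unfolding pi_norm_def
proof (rule cInf_lower)
  show "bdd_below {\<Sum>n. nY (f n) * nZ (g n) |f g. rep u f g}"
    by (rule bdd_belowI[of _ 0]) (use rep_sum_nonneg in blast)
qed blast

lemma pi_norm_greatest:
  assumes "rep u f g" "\<And>f g. rep u f g \<Longrightarrow> a \<le> (\<Sum>n. nY (f n) * nZ (g n))"
  shows "a \<le> pn u"
  unfolding pi_norm_def by (rule cInf_greatest) (use assms in auto)

lemma pi_norm_nonneg: "rep u f g \<Longrightarrow> 0 \<le> pn u"
  by (rule pi_norm_greatest) (auto intro: rep_sum_nonneg)

text \<open>A single product, padded by zeros to an infinite representation.\<close>

lemma product_rep: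
  assumes f: "f \<in> Y" and k: "k \<in> Z" and le: "AE y in N. \<bar>u y\<bar> \<le> \<bar>f y * k y\<bar>"
  obtains F G where "rep u F G" "(\<Sum>n. nY (F n) * nZ (G n)) = nY f * nZ k"
proof -
  define F where "F n = (if n = 0 then f else (\<lambda>_. 0))" for n :: nat
  define G where "G n = (if n = 0 then k else (\<lambda>_. 0))" for n :: nat
  have F0: "F 0 = f" "G 0 = k" by (auto simp: F_def G_def)
  have nz: "nY (F n) * nZ (G n) = 0" if "n \<notin> {0}" for n
    using that by (simp add: F_def G_def Y.norm_zero)
  have s: "(\<lambda>n. nY (F n) * nZ (G n)) sums (\<Sum>n\<in>{0}. nY (F n) * nZ (G n))"
    by (rule sums_finite[OF _ nz]) auto
  have e: "(\<Sum>n. ennreal \<bar>F n y * G n y\<bar>) = ennreal \<bar>f y * k y\<bar>" for y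
    by (subst suminf_finite[of "{0}"]) (auto simp: F_def G_def)
  have "rep u F G"
    unfolding pi_rep_def e
    using f k Y.zero Z.zero sums_summable[OF s] le
    by (auto simp: F_def G_def elim!: eventually_mono intro!: ennreal_leI)
  moreover have "(\<Sum>n. nY (F n) * nZ (G n)) = nY f * nZ k"
    using sums_unique[OF s] by (simp add: F0)
  ultimately show ?thesis by (rule that)
qed

lemma pi_norm_product_le:
  assumes "f \<in> Y" "k \<in> Z" "AE y in N. \<bar>u y\<bar> \<le> \<bar>f y * k y\<bar>"
  shows "pn u \<le> nY f * nZ k"
  using product_rep[OF assms] pi_norm_lower by metis

lemma product_ideal_rep: "u \<in> product_ideal \<Longrightarrow> \<exists>f g. rep u f g"
  unfolding product_ideal_def by (blast elim: product_rep)

text \<open>Every representation of \<open>v\<close> also represents \<open>u\<close>. That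
  \<open>v\<close> has one is required because \<open>pi_norm\<close> is a real infimum, which is
  meaningless over the empty set.\<close>

lemma pi_norm_mono:
  assumes v: "\<exists>f g. rep v f g" and le: "AE y in N. \<bar>u y\<bar> \<le> \<bar>v y\<bar>"
  shows "pn u \<le> pn v"
proof -
  have "rep u f g" if "rep v f g" for f g
  proof -
    have "AE y in N. ennreal \<bar>v y\<bar> \<le> (\<Sum>n. ennreal \<bar>f n y * g n y\<bar>)"
      using that by (simp add: pi_rep_def)
    with le have "AE y in N. ennreal \<bar>u y\<bar> \<le> (\<Sum>n. ennreal \<bar>f n y * g n y\<bar>)"
      by eventually_elim (blast intro: order_trans ennreal_leI)
    with that show ?thesis by (simp add: pi_rep_def)
  qed
  with v show ?thesis by (blast intro: pi_norm_greatest pi_norm_lower)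
qed

lemma pi_norm_scale_le:
  assumes v: "\<exists>f g. rep u f g"
  shows "pn (\<lambda>y. c * u y) \<le> \<bar>c\<bar> * pn u"
proof (cases "c = 0")
  case True
  have "pn (\<lambda>y. 0) \<le> nY (\<lambda>_. 0) * nZ (\<lambda>_. 0)"
    by (rule pi_norm_product_le[OF Y.zero Z.zero]) simp
  with True show ?thesis by (simp add: Y.norm_zero)
next
  case False
  have *: "pn (\<lambda>y. c * u y) / \<bar>c\<bar> \<le> (\<Sum>n. nY (f n) * nZ (g n))" if r: "rep u f g" for f g
  proof -
    have fY: "\<And>n. f n \<in> Y" and s: "summable (\<lambda>n. nY (f n) * nZ (g n))"
      using r unfolding pi_rep_def by blast+
    have eq: "nY (\<lambda>y. c * f n y) * nZ (g n) = \<bar>c\<bar> * (nY (f n) * nZ (g n))" for n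
      by (simp add: Y.norm_scale[OF fY])
    have "AE y in N. ennreal \<bar>u y\<bar> \<le> (\<Sum>n. ennreal \<bar>f n y * g n y\<bar>)"
      using r by (simp add: pi_rep_def)
    then have "AE y in N. ennreal \<bar>c * u y\<bar> \<le> (\<Sum>n. ennreal \<bar>c * f n y * g n y\<bar>)"
    proof eventually_elim
      case (elim y)
      have "(\<Sum>n. ennreal \<bar>c * f n y * g n y\<bar>) = (\<Sum>n. ennreal \<bar>c\<bar> * ennreal \<bar>f n y * g n y\<bar>)"
        by (simp add: abs_mult ennreal_mult' mult.assoc)
      also have "\<dots> = ennreal \<bar>c\<bar> * (\<Sum>n. ennreal \<bar>f n y * g n y\<bar>)" by (rule ennreal_suminf_cmult)
      finally show ?case using elim by (simp add: abs_mult ennreal_mult' mult_left_mono)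
    qed
    then have "rep (\<lambda>y. c * u y) (\<lambda>n y. c * f n y) g"
      using r Y.scale unfolding pi_rep_def eq by (auto intro: summable_mult)
    from pi_norm_lower[OF this] have "pn (\<lambda>y. c * u y) \<le> \<bar>c\<bar> * (\<Sum>n. nY (f n) * nZ (g n))"
      unfolding eq suminf_mult[OF s] .
    with False show ?thesis by (simp add: field_simps)
  qed
  from v obtain f g where "rep u f g" by blast
  then have "pn (\<lambda>y. c * u y) / \<bar>c\<bar> \<le> pn u" using * by (rule pi_norm_greatest)
  with False show ?thesis by (simp add: field_simps)
qed

text \<open>Two representations are interleaved at even and odd positions; both infima are then
  taken one after the other.\<close>

lemma pi_norm_add_le:
  assumes u: "\<exists>f g. rep u f g" and v: "\<exists>f g. rep v f g"
  shows "pn (\<lambda>y. u y + v y) \<le> pn u + pn v"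
proof -
  have *: "pn (\<lambda>y. u y + v y) \<le> (\<Sum>n. nY (f n) * nZ (g n)) + (\<Sum>n. nY (f' n) * nZ (g' n))"
    if r: "rep u f g" "rep v f' g'" for f g f' g'
  proof -
    define F where "F n = (if even n then f (n div 2) else f' (n div 2))" for n :: nat
    define G where "G n = (if even n then g (n div 2) else g' (n div 2))" for n :: nat
    have "(\<lambda>n. nY (f n) * nZ (g n)) sums (\<Sum>n. nY (f n) * nZ (g n))"
      "(\<lambda>n. nY (f' n) * nZ (g' n)) sums (\<Sum>n. nY (f' n) * nZ (g' n))"
      using r unfolding pi_rep_def by (blast intro: summable_sums)+
    from sums_if[OF this(2,1)]
    have "(\<lambda>n. if even n then nY (f (n div 2)) * nZ (g (n div 2)) else nY (f' ((n - 1) div 2)) * nZ (g' ((n - 1) div 2)))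
       sums ((\<Sum>n. nY (f' n) * nZ (g' n)) + (\<Sum>n. nY (f n) * nZ (g n)))" .
    \<comment> \<open>For odd \<open>n\<close> the index \<open>(n - 1) div 2\<close> supplied by
      \<open>sums_if\<close> equals the \<open>n div 2\<close> used in \<open>F\<close> and
      \<open>G\<close>.\<close>
    moreover have "(\<lambda>n. if even n then nY (f (n div 2)) * nZ (g (n div 2)) else nY (f' ((n - 1) div 2)) * nZ (g' ((n - 1) div 2)))
      = (\<lambda>n. nY (F n) * nZ (G n))"
      by (rule ext) (auto simp: F_def G_def elim!: oddE)
    ultimately have s: "(\<lambda>n. nY (F n) * nZ (G n)) sums ((\<Sum>n. nY (f' n) * nZ (g' n)) + (\<Sum>n. nY (f n) * nZ (g n)))"
      by simp
    have "AE y in N. ennreal \<bar>u y\<bar> \<le> (\<Sum>n. ennreal \<bar>f n y * g n y\<bar>)"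
      "AE y in N. ennreal \<bar>v y\<bar> \<le> (\<Sum>n. ennreal \<bar>f' n y * g' n y\<bar>)"
      using r unfolding pi_rep_def by blast+
    then have "AE y in N. ennreal \<bar>u y + v y\<bar> \<le> (\<Sum>n. ennreal \<bar>F n y * G n y\<bar>)"
    proof eventually_elim
      case (elim y)
      have "ennreal \<bar>u y + v y\<bar> \<le> ennreal (\<bar>u y\<bar> + \<bar>v y\<bar>)" by (intro ennreal_leI) simp
      also have "\<dots> = ennreal \<bar>u y\<bar> + ennreal \<bar>v y\<bar>" by (rule ennreal_plus) auto
      also have "\<dots> \<le> (\<Sum>n. ennreal \<bar>f n y * g n y\<bar>) + (\<Sum>n. ennreal \<bar>f' n y * g' n y\<bar>)"
        by (intro add_mono elim)
      also have "\<dots> \<le> (\<Sum>n. if even n then ennreal \<bar>f (n div 2) y * g (n div 2) y\<bar> else ennreal \<bar>f' (n div 2) y * g' (n div 2) y\<bar>)"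
        by (rule suminf_interleave_ge)
      also have "\<dots> = (\<Sum>n. ennreal \<bar>F n y * G n y\<bar>)"
        by (intro arg_cong[of _ _ suminf]) (auto simp: F_def G_def)
      finally show ?case .
    qed
    moreover have "F n \<in> Y \<and> G n \<in> Z" for n
      using r unfolding pi_rep_def F_def G_def by (cases "even n") auto
    ultimately have "rep (\<lambda>y. u y + v y) F G"
      using sums_summable[OF s] unfolding pi_rep_def by blast
    from pi_norm_lower[OF this] sums_unique[OF s] show ?thesis by simp
  qed
  from u v obtain f g f' g' where r: "rep u f g" "rep v f' g'" by blast
  have "pn (\<lambda>y. u y + v y) - (\<Sum>n. nY (f' n) * nZ (g' n)) \<le> pn u" if "rep v f' g'" for f' g'
    by (rule pi_norm_greatest[OF r(1)]) (use *[OF _ that] in \<open>simp add: algebra_simps\<close>)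
  then have "pn (\<lambda>y. u y + v y) - pn u \<le> pn v"
    by (intro pi_norm_greatest[OF r(2)]) (simp add: algebra_simps)
  then show ?thesis by simp
qed

section \<open>The product ideal as a solid space with order continuous pi-norm\<close>

lemma product_ideal_measurable: "u \<in> product_ideal \<Longrightarrow> u \<in> borel_measurable N"
  by (simp add: product_ideal_def)

lemma product_in_ideal:
  assumes "f \<in> Y" "k \<in> Z"
  shows "(\<lambda>y. f y * k y) \<in> product_ideal"
  using assms Y.measurable Z.measurable unfolding product_ideal_def by auto

lemma product_ideal_solid:
  assumes u: "u \<in> borel_measurable N" and v: "v \<in> product_ideal" and le: "AE y in N. \<bar>u y\<bar> \<le> \<bar>v y\<bar>"
  shows "u \<in> product_ideal"
proof -
  obtain f k where fk: "f \<in> Y" "k \<in> Z" "AE y in N. \<bar>v y\<bar> \<le> \<bar>f y * k y\<bar>"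
    using v by (auto simp: product_ideal_def)
  have "AE y in N. \<bar>u y\<bar> \<le> \<bar>f y * k y\<bar>"
    using le fk(3) by eventually_elim (rule order_trans)
  with u fk show ?thesis by (auto simp: product_ideal_def)
qed

lemma product_ideal_subspace: "fun_subspace product_ideal"
  unfolding fun_subspace_def
proof (intro conjI ballI allI)
  show "(\<lambda>_. 0) \<in> product_ideal" using product_in_ideal[OF Y.zero Z.zero] by simp
next
  fix u v assume u: "u \<in> product_ideal" and v: "v \<in> product_ideal"
  obtain f k where fk: "f \<in> Y" "k \<in> Z" "AE y in N. \<bar>u y\<bar> \<le> \<bar>f y * k y\<bar>"
    using u by (auto simp: product_ideal_def)
  obtain f' k' where fk': "f' \<in> Y" "k' \<in> Z" "AE y in N. \<bar>v y\<bar> \<le> \<bar>f' y * k' y\<bar>"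
    using v by (auto simp: product_ideal_def)
  have "(\<lambda>y. (\<bar>f y\<bar> + \<bar>f' y\<bar>) * (\<bar>k y\<bar> + \<bar>k' y\<bar>)) \<in> product_ideal"
    by (intro product_in_ideal Y.add Z.add Y.abs Z.abs fk fk')
  moreover from fk(3) fk'(3) have "AE y in N. \<bar>u y + v y\<bar> \<le> \<bar>(\<bar>f y\<bar> + \<bar>f' y\<bar>) * (\<bar>k y\<bar> + \<bar>k' y\<bar>)\<bar>"
  proof eventually_elim
    case (elim y)
    have "\<bar>u y + v y\<bar> \<le> \<bar>f y\<bar> * \<bar>k y\<bar> + \<bar>f' y\<bar> * \<bar>k' y\<bar>"
      using elim abs_triangle_ineq[of "u y" "v y"] by (simp only: abs_mult)
    also have "\<dots> \<le> (\<bar>f y\<bar> + \<bar>f' y\<bar>) * (\<bar>k y\<bar> + \<bar>k' y\<bar>)" by (simp add: algebra_simps)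
    finally show ?case by simp
  qed
  ultimately show "(\<lambda>y. u y + v y) \<in> product_ideal"
    by (rule product_ideal_solid[OF borel_measurable_add[OF product_ideal_measurable[OF u] product_ideal_measurable[OF v]]])
next
  fix u c assume u: "u \<in> product_ideal"
  obtain f k where fk: "f \<in> Y" "k \<in> Z" "AE y in N. \<bar>u y\<bar> \<le> \<bar>f y * k y\<bar>"
    using u by (auto simp: product_ideal_def)
  have "AE y in N. \<bar>c * u y\<bar> \<le> \<bar>(c * f y) * k y\<bar>"
    using fk(3) by eventually_elim (simp add: abs_mult mult.assoc mult_left_mono)
  then show "(\<lambda>y. c * u y) \<in> product_ideal"
    unfolding product_ideal_def
    by (intro CollectI conjI bexI[of _ "\<lambda>y. c * f y"] bexI[of _ k] Y.scale fk(1,2)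
        borel_measurable_times borel_measurable_const product_ideal_measurable[OF u])
qed

lemma product_ideal_solid_subspace: "solid_subspace N product_ideal"
  unfolding solid_subspace_def
  using product_ideal_subspace product_ideal_measurable product_ideal_solid by blast

text \<open>If \<open>\<bar>u\<bar> \<le> \<bar>f * k\<bar>\<close>, the indicator can be attached
  to either factor. Attached to the modulus of the one with order continuous norm, it gives a
  decreasing sequence with limit 0, while the norm of the other factor stays fixed.\<close>

lemma pi_norm_order_continuous:
  assumes soc: "sigma_order_continuous N Y nY \<or> sigma_order_continuous N Z nZ"
    and u: "u \<in> product_ideal"
    and A: "range A \<subseteq> sets N" "decseq A" "(\<Inter>i. A i) = {}"
  shows "(\<lambda>i::nat. pn (\<lambda>y. indicator (A i) y * u y)) \<longlonglongrightarrow> 0"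
proof -
  have Am[measurable]: "A i \<in> sets N" for i using A by auto
  note [measurable] = product_ideal_measurable[OF u]
  obtain f k where fk: "f \<in> Y" "k \<in> Z" "AE y in N. \<bar>u y\<bar> \<le> \<bar>f y * k y\<bar>"
    using u by (auto simp: product_ideal_def)
  note [measurable] = Y.measurable[OF fk(1)] Z.measurable[OF fk(2)]
  have dec: "decseq (\<lambda>i. indicator (A i) y * \<bar>c\<bar> :: real)" for y c
    using A(2) by (auto simp: decseq_def indicator_def)
  have lim: "(\<lambda>i. indicator (A i) y * \<bar>c\<bar> :: real) \<longlonglongrightarrow> 0" for y c
  proof -
    have "(\<lambda>i. indicator (A i) y :: real) \<longlonglongrightarrow> indicator (\<Inter>i. A i) y"
      by (rule LIMSEQ_indicator_decseq[OF A(2)])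
    then have "(\<lambda>i. indicator (A i) y * \<bar>c\<bar> :: real) \<longlonglongrightarrow> indicator (\<Inter>i. A i) y * \<bar>c\<bar>"
      by (intro tendsto_intros)
    with A(3) show ?thesis by simp
  qed
  have "\<exists>b. b \<longlonglongrightarrow> 0 \<and> (\<forall>i. pn (\<lambda>y. indicator (A i) y * u y) \<le> b i)"
    using soc
  proof
    assume "sigma_order_continuous N Y nY"
    moreover have fY: "(\<lambda>y. indicator (A i) y * \<bar>f y\<bar>) \<in> Y" for i
      by (rule Y.solid[OF _ fk(1)]) (auto simp: indicator_def)
    ultimately have "(\<lambda>i. nY (\<lambda>y. indicator (A i) y * \<bar>f y\<bar>)) \<longlonglongrightarrow> 0"
      unfolding sigma_order_continuous_def using dec lim by simp
    then have "(\<lambda>i. nY (\<lambda>y. indicator (A i) y * \<bar>f y\<bar>) * nZ k) \<longlonglongrightarrow> 0"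
      using tendsto_mult_right[of _ 0 _ "nZ k"] by simp
    moreover have "pn (\<lambda>y. indicator (A i) y * u y) \<le> nY (\<lambda>y. indicator (A i) y * \<bar>f y\<bar>) * nZ k" for i
      by (rule pi_norm_product_le[OF fY fk(2)])
        (use fk(3) in \<open>eventually_elim, auto simp: indicator_def abs_mult\<close>)
    ultimately show ?thesis by blast
  next
    assume "sigma_order_continuous N Z nZ"
    moreover have kZ: "(\<lambda>y. indicator (A i) y * \<bar>k y\<bar>) \<in> Z" for i
      by (rule Z.solid[OF _ fk(2)]) (auto simp: indicator_def)
    ultimately have "(\<lambda>i. nZ (\<lambda>y. indicator (A i) y * \<bar>k y\<bar>)) \<longlonglongrightarrow> 0"
      unfolding sigma_order_continuous_def using dec lim by simp
    then have "(\<lambda>i. nY f * nZ (\<lambda>y. indicator (A i) y * \<bar>k y\<bar>)) \<longlonglongrightarrow> 0"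
      using tendsto_mult_left[of _ 0 _ "nY f"] by simp
    moreover have "pn (\<lambda>y. indicator (A i) y * u y) \<le> nY f * nZ (\<lambda>y. indicator (A i) y * \<bar>k y\<bar>)" for i
      by (rule pi_norm_product_le[OF fk(1) kZ])
        (use fk(3) in \<open>eventually_elim, auto simp: indicator_def abs_mult\<close>)
    ultimately show ?thesis by blast
  qed
  then obtain b where b: "b \<longlonglongrightarrow> 0" "\<And>i. pn (\<lambda>y. indicator (A i) y * u y) \<le> b i" by blast
  have Au: "(\<lambda>y. indicator (A i) y * u y) \<in> product_ideal" for i
    by (rule product_ideal_solid[OF _ u]) (auto simp: indicator_def)
  then have "0 \<le> pn (\<lambda>y. indicator (A i) y * u y)" for i
    using product_ideal_rep pi_norm_nonneg by blast
  with b show ?thesis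
    by (intro tendsto_sandwich[OF always_eventually always_eventually tendsto_const b(1)]) auto
qed

text \<open>The symmetric form of the multiplier condition: it exhibits the multipliers from
  \<open>Y\<close> into the dual of \<open>Z\<close> as the functions integrable against all
  products. In the application \<open>Z\<close> is Y1' and its dual is Y1''.\<close>

lemma multiplier_iff:
  "g \<in> mult_space N Y (kdual N Z) \<longleftrightarrow>
     g \<in> borel_measurable N \<and> (\<forall>f\<in>Y. \<forall>k\<in>Z. integrable N (\<lambda>y. g y * f y * k y))"
  using Y.measurable Z.measurable
  unfolding mult_space_def kdual_def L1_def by (auto intro!: borel_measurable_times)

text \<open>Boundedness in \<open>f\<close> comes from the gliding hump for the norm of
  \<open>g * f\<close> in \<open>kdual N Z\<close>, boundedness in \<open>k\<close> from Hoelder.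
  Integrating a representation of \<open>u\<close> term by term turns this bilinear bound into one
  by the pi-norm.\<close>

lemma multiplier_pi_bound:
  assumes satZ: "saturated N Z" and g: "g \<in> mult_space N Y (kdual N Z)"
  obtains K where "0 < K"
    and "\<And>u. u \<in> product_ideal \<Longrightarrow> integrable N (\<lambda>y. g y * u y) \<and> (\<integral>y. \<bar>g y * u y\<bar> \<partial>N) \<le> K * pn u"
proof -
  interpret Z': riesz_fischer_space N "kdual N Z" "kdual_norm N Z nZ"
    by (rule Z.kdual_riesz_fischer_space[OF satZ])
  have gm[measurable]: "g \<in> borel_measurable N" using g by (simp add: mult_space_def)
  have gf: "(\<lambda>y. g y * f y) \<in> kdual N Z" if "f \<in> Y" for f
    using g that by (simp add: mult_space_def)
  obtain K where K: "0 < K" "\<And>f. f \<in> Y \<Longrightarrow> kdual_norm N Z nZ (\<lambda>y. g y * f y) \<le> K * nY f"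
  proof (rule Y.positive_functional_bounded[where \<Psi> = "\<lambda>f. kdual_norm N Z nZ (\<lambda>y. g y * f y)"])
    show "0 \<le> kdual_norm N Z nZ (\<lambda>y. g y * f y)" if "f \<in> Y" for f
      by (rule Z'.norm_nonneg[OF gf[OF that]])
    show "kdual_norm N Z nZ (\<lambda>y. g y * (c * f y)) = \<bar>c\<bar> * kdual_norm N Z nZ (\<lambda>y. g y * f y)" if "f \<in> Y" for f c
      using Z'.norm_scale[OF gf[OF that], of c] by (simp add: mult.left_commute)
    show "kdual_norm N Z nZ (\<lambda>y. g y * f y) \<le> kdual_norm N Z nZ (\<lambda>y. g y * f' y)"
      if "f \<in> Y" "f' \<in> Y" "AE y in N. \<bar>f y\<bar> \<le> \<bar>f' y\<bar>" for f f'
    proof (rule Z'.norm_mono[OF Z'.measurable[OF gf[OF that(1)]] gf[OF that(2)]])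
      show "AE y in N. \<bar>g y * f y\<bar> \<le> \<bar>g y * f' y\<bar>"
        using that(3) by eventually_elim (simp add: abs_mult mult_left_mono)
    qed
  qed (use that in blast)
  have bil: "(\<integral>y. \<bar>g y * (f y * k y)\<bar> \<partial>N) \<le> K * (nY f * nZ k)" "integrable N (\<lambda>y. g y * (f y * k y))"
    if f: "f \<in> Y" and k: "k \<in> Z" for f k
  proof -
    show "integrable N (\<lambda>y. g y * (f y * k y))"
      using Z.kdual_integrable[OF gf[OF f] k] by (simp add: mult.assoc)
    have "(\<integral>y. \<bar>g y * (f y * k y)\<bar> \<partial>N) \<le> kdual_norm N Z nZ (\<lambda>y. g y * f y) * nZ k"
      using Z.kdual_hoelder[OF gf[OF f] k] by (simp add: mult.assoc)
    also have "\<dots> \<le> K * nY f * nZ k"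
      by (intro mult_right_mono K(2) f Z.norm_nonneg k)
    finally show "(\<integral>y. \<bar>g y * (f y * k y)\<bar> \<partial>N) \<le> K * (nY f * nZ k)" by (simp add: mult.assoc)
  qed
  show ?thesis
  proof (rule that[OF K(1)])
    fix u assume u: "u \<in> product_ideal"
    note [measurable] = product_ideal_measurable[OF u]
    have nn: "(\<integral>\<^sup>+y. ennreal \<bar>g y * u y\<bar> \<partial>N) \<le> ennreal (K * (\<Sum>n. nY (f n) * nZ (k n)))" if r: "rep u f k" for f k
    proof -
      have fk: "\<And>n. f n \<in> Y" "\<And>n. k n \<in> Z" and s: "summable (\<lambda>n. nY (f n) * nZ (k n))"
        and le: "AE y in N. ennreal \<bar>u y\<bar> \<le> (\<Sum>n. ennreal \<bar>f n y * k n y\<bar>)"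
        using r unfolding pi_rep_def by blast+
      note [measurable] = Y.measurable[OF fk(1)] Z.measurable[OF fk(2)]
      have "(\<integral>\<^sup>+y. ennreal \<bar>g y * u y\<bar> \<partial>N) \<le> (\<integral>\<^sup>+y. (\<Sum>n. ennreal \<bar>g y * (f n y * k n y)\<bar>) \<partial>N)"
      proof (rule nn_integral_mono_AE, use le in eventually_elim)
        fix y assume "ennreal \<bar>u y\<bar> \<le> (\<Sum>n. ennreal \<bar>f n y * k n y\<bar>)"
        then have "ennreal \<bar>g y\<bar> * ennreal \<bar>u y\<bar> \<le> ennreal \<bar>g y\<bar> * (\<Sum>n. ennreal \<bar>f n y * k n y\<bar>)"
          by (rule mult_left_mono) simp
        then show "ennreal \<bar>g y * u y\<bar> \<le> (\<Sum>n. ennreal \<bar>g y * (f n y * k n y)\<bar>)"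
          by (simp only: abs_mult[of "g y"] ennreal_mult'[OF abs_ge_zero] ennreal_suminf_cmult)
      qed
      also have "\<dots> = (\<Sum>n. \<integral>\<^sup>+y. ennreal \<bar>g y * (f n y * k n y)\<bar> \<partial>N)"
        by (rule nn_integral_suminf) measurable
      also have "\<dots> \<le> (\<Sum>n. ennreal (K * (nY (f n) * nZ (k n))))"
      proof (intro suminf_le summableI)
        fix n
        have "(\<integral>\<^sup>+y. ennreal \<bar>g y * (f n y * k n y)\<bar> \<partial>N) = ennreal (\<integral>y. \<bar>g y * (f n y * k n y)\<bar> \<partial>N)"
          by (rule nn_integral_eq_integral[OF integrable_abs[OF bil(2)[OF fk]]]) simp
        also have "\<dots> \<le> ennreal (K * (nY (f n) * nZ (k n)))"
          by (intro ennreal_leI bil(1) fk)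
        finally show "(\<integral>\<^sup>+y. ennreal \<bar>g y * (f n y * k n y)\<bar> \<partial>N) \<le> ennreal (K * (nY (f n) * nZ (k n)))" .
      qed
      also have "\<dots> = ennreal (\<Sum>n. K * (nY (f n) * nZ (k n)))"
        using K(1) by (intro suminf_ennreal2 summable_mult s mult_nonneg_nonneg Y.norm_nonneg Z.norm_nonneg fk) simp
      also have "(\<Sum>n. K * (nY (f n) * nZ (k n))) = K * (\<Sum>n. nY (f n) * nZ (k n))"
        by (rule suminf_mult[OF s])
      finally show ?thesis .
    qed
    obtain f k where r: "rep u f k" using product_ideal_rep[OF u] by blast
    have i: "integrable N (\<lambda>y. g y * u y)"
      using order_le_less_trans[OF nn[OF r] ennreal_less_top] by (simp add: integrable_iff_bounded)
    have "(\<integral>y. \<bar>g y * u y\<bar> \<partial>N) / K \<le> pn u"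
    proof (rule pi_norm_greatest[OF r])
      fix f k assume r: "rep u f k"
      have "ennreal (\<integral>y. \<bar>g y * u y\<bar> \<partial>N) \<le> ennreal (K * (\<Sum>n. nY (f n) * nZ (k n)))"
        using nn[OF r] nn_integral_eq_integral[OF integrable_abs[OF i]] by simp
      then have "(\<integral>y. \<bar>g y * u y\<bar> \<partial>N) \<le> K * (\<Sum>n. nY (f n) * nZ (k n))"
        using rep_sum_nonneg[OF r] K(1) by (simp add: ennreal_le_iff)
      with K(1) show "(\<integral>y. \<bar>g y * u y\<bar> \<partial>N) / K \<le> (\<Sum>n. nY (f n) * nZ (k n))"
        by (simp add: field_simps)
    qed
    with i K(1) show "integrable N (\<lambda>y. g y * u y) \<and> (\<integral>y. \<bar>g y * u y\<bar> \<partial>N) \<le> K * pn u"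
      by (simp add: field_simps)
  qed
qed

end

context product_pair
begin

lemma product_ideal_sum:
  "(\<And>p. p \<in> P \<Longrightarrow> w p \<in> product_ideal) \<Longrightarrow> (\<lambda>y. \<Sum>p\<in>P. r p * w p y) \<in> product_ideal"
proof (induction P rule: infinite_finite_induct)
  case (insert p P)
  then have "(\<lambda>y. r p * w p y + (\<Sum>p\<in>P. r p * w p y)) \<in> product_ideal"
    by (intro fun_subspace_add[OF product_ideal_subspace] fun_subspace_scale[OF product_ideal_subspace]) auto
  with insert show ?case by simp
qed (auto intro: fun_subspace_zero[OF product_ideal_subspace])

text \<open>Two copies of the product ideal, under the one-sided sublinear functional
  \<open>\<parallel>u\<^sup>+ + v\<^sup>+\<parallel>\<close>, let Hahn--Banach produce the positive and the negative part of the
  representing functional at once.\<close>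

theorem moment_representation:
  fixes w :: "'i \<Rightarrow> 'b \<Rightarrow> real" and t :: "'i \<Rightarrow> real"
  assumes sf: "sigma_finite_measure N" and satY: "saturated N Y" and satZ: "saturated N Z"
    and soc: "sigma_order_continuous N Y nY \<or> sigma_order_continuous N Z nZ"
    and w: "\<And>p. w p \<in> product_ideal" and C: "0 < C"
    and bound: "\<And>P r. finite P \<Longrightarrow> (\<Sum>p\<in>P. r p * t p) \<le> C * pn (\<lambda>y. \<Sum>p\<in>P. r p * w p y)"
  obtains g where "g \<in> mult_space N Y (kdual N Z)" "\<And>p. (\<integral>y. g y * w p y \<partial>N) = t p"
proof -
  \<comment> \<open>A pair of functions is coded as one function on \<open>bool \<times> 'b\<close>,
    so that Hahn-Banach for spaces of real functions applies to pairs.\<close>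
  define V where "V = {F :: bool \<times> 'b \<Rightarrow> real. \<forall>b. (\<lambda>y. F (b, y)) \<in> product_ideal}"
  define m where "m F y = max 0 (F (True, y)) + max 0 (F (False, y))" for F :: "bool \<times> 'b \<Rightarrow> real" and y
  define q where "q F = C * pn (m F)" for F
  have V_sub: "fun_subspace V"
    unfolding fun_subspace_def V_def
    by (auto intro: fun_subspace_zero[OF product_ideal_subspace]
        fun_subspace_add[OF product_ideal_subspace] fun_subspace_scale[OF product_ideal_subspace])
  have pos_part: "(\<lambda>y. max 0 (u y)) \<in> product_ideal" if u: "u \<in> product_ideal" for u
    by (rule product_ideal_solid[OF _ u]) (use product_ideal_measurable[OF u] in auto)
  have mV: "m F \<in> product_ideal" if "F \<in> V" for F
    unfolding m_def[abs_def]
    using that by (intro fun_subspace_add[OF product_ideal_subspace] pos_part) (auto simp: V_def)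
  have m0: "0 \<le> m F y" for F y by (simp add: m_def)
  have q_sub: "sublinear_on V q"
    unfolding sublinear_on_def
  proof (intro conjI ballI allI impI)
    fix F G assume F: "F \<in> V" and G: "G \<in> V"
    have "m (\<lambda>x. F x + G x) y \<le> m F y + m G y" for y by (simp add: m_def)
    then have "AE y in N. \<bar>m (\<lambda>x. F x + G x) y\<bar> \<le> \<bar>m F y + m G y\<bar>" using m0 by simp
    then have "pn (m (\<lambda>x. F x + G x)) \<le> pn (\<lambda>y. m F y + m G y)"
      by (intro pi_norm_mono product_ideal_rep fun_subspace_add[OF product_ideal_subspace] mV F G)
    also have "\<dots> \<le> pn (m F) + pn (m G)"
      by (intro pi_norm_add_le product_ideal_rep mV F G)
    finally show "q (\<lambda>x. F x + G x) \<le> q F + q G"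
      using C by (simp add: q_def distrib_left[symmetric])
  next
    fix F and c :: real assume F: "F \<in> V" and c: "0 < c"
    have "m (\<lambda>x. c * F x) = (\<lambda>y. c * m F y)"
      using c by (auto simp: m_def max_def fun_eq_iff algebra_simps zero_le_mult_iff)
    then have "pn (m (\<lambda>x. c * F x)) \<le> c * pn (m F)"
      using pi_norm_scale_le[OF product_ideal_rep[OF mV[OF F]], of c] c by simp
    then show "q (\<lambda>x. c * F x) \<le> c * q F"
      using C mult_left_mono[of "pn (m (\<lambda>x. c * F x))" "c * pn (m F)" C] by (simp add: q_def mult.left_commute)
  qed
  \<comment> \<open>Moments are prescribed on the pairs \<open>(u, - u)\<close>. There
    \<open>m\<close> equals \<open>\<bar>u\<bar>\<close>, so the one-sided functional
    \<open>q\<close> reduces to \<open>C * pn u\<close> and \<open>bound\<close> is exactly the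
    domination required.\<close>
  define s where "s b = (if b then 1 else - 1 :: real)" for b
  define comb where "comb P r y = (\<Sum>p\<in>P. r p * w p y)" for P and r :: "'i \<Rightarrow> real" and y
  define L where "L = {((\<lambda>(b, y). s b * comb P r y), \<Sum>p\<in>P. r p * t p) | P r. finite P}"
  have comb: "comb P r \<in> product_ideal" for P r
    unfolding comb_def[abs_def] by (rule product_ideal_sum) (rule w)
  have L_E: "\<exists>P r. finite P \<and> l = ((\<lambda>(b, y). s b * comb P r y), \<Sum>p\<in>P. r p * t p)" if "l \<in> L" for l
    using that by (auto simp: L_def)
  have L_I: "((\<lambda>(b, y). s b * comb P r y), \<Sum>p\<in>P. r p * t p) \<in> L" if "finite P" for P r
    using that by (auto simp: L_def)
  obtain F where F_add: "\<And>u v. u \<in> V \<Longrightarrow> v \<in> V \<Longrightarrow> F (\<lambda>x. u x + v x) = F u + F v"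
    and F_scale: "\<And>u c. u \<in> V \<Longrightarrow> F (\<lambda>x. c * u x) = c * F u"
    and F_le: "\<And>u. u \<in> V \<Longrightarrow> F u \<le> q u"
    and F_L: "\<And>w a. (w, a) \<in> L \<Longrightarrow> F w = a"
  proof (rule hahn_banach_relation[OF V_sub q_sub, of L])
    show "x \<in> V" if "(x, a) \<in> L" for x a
      using L_E[OF that] fun_subspace_scale[OF product_ideal_subspace comb] by (auto simp: V_def)
    show "L \<noteq> {}" using L_I[of "{}"] by auto
    show "((\<lambda>z. x z + x' z), a + a') \<in> L" if l: "(x, a) \<in> L" "(x', a') \<in> L" for x a x' a'
    proof -
      obtain P r where P: "finite P" "x = (\<lambda>(b, y). s b * comb P r y)" "a = (\<Sum>p\<in>P. r p * t p)"
        using L_E[OF l(1)] by auto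
      obtain P' r' where P': "finite P'" "x' = (\<lambda>(b, y). s b * comb P' r' y)" "a' = (\<Sum>p\<in>P'. r' p * t p)"
        using L_E[OF l(2)] by auto
      \<comment> \<open>The two combinations are merged over \<open>P \<union> P'\<close>, each
        coefficient counting as 0 off its own index set.\<close>
      define R where "R p = (if p \<in> P then r p else 0) + (if p \<in> P' then r' p else 0)" for p
      have sum_R: "(\<Sum>p\<in>P \<union> P'. R p * f p) = (\<Sum>p\<in>P. r p * f p) + (\<Sum>p\<in>P'. r' p * f p)" for f :: "'i \<Rightarrow> real"
      proof -
        have "(\<Sum>p\<in>P \<union> P'. R p * f p) = (\<Sum>p\<in>P \<union> P'. (if p \<in> P then r p * f p else 0)) + (\<Sum>p\<in>P \<union> P'. (if p \<in> P' then r' p * f p else 0))"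
          unfolding sum.distrib[symmetric] by (intro sum.cong) (auto simp: R_def distrib_right)
        also have "\<dots> = (\<Sum>p\<in>P. r p * f p) + (\<Sum>p\<in>P'. r' p * f p)"
          using P(1) P'(1) by (simp add: sum.inter_restrict[symmetric] Int_absorb1)
        finally show ?thesis .
      qed
      have "(\<lambda>z. x z + x' z) = (\<lambda>(b, y). s b * comb (P \<union> P') R y)"
        by (auto simp: P P' comb_def sum_R distrib_left fun_eq_iff)
      moreover have "a + a' = (\<Sum>p\<in>P \<union> P'. R p * t p)" by (simp add: P P' sum_R)
      ultimately show ?thesis using L_I[of "P \<union> P'" R] P(1) P'(1) by simp
    qed
    show "((\<lambda>z. c * x z), c * a) \<in> L" if l: "(x, a) \<in> L" for x a c
    proof -
      obtain P r where P: "finite P" "x = (\<lambda>(b, y). s b * comb P r y)" "a = (\<Sum>p\<in>P. r p * t p)"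
        using L_E[OF l] by auto
      have "(\<lambda>z. c * x z) = (\<lambda>(b, y). s b * comb P (\<lambda>p. c * r p) y)"
        by (auto simp: P comb_def sum_distrib_left fun_eq_iff ac_simps)
      moreover have "c * a = (\<Sum>p\<in>P. (c * r p) * t p)" by (simp add: P sum_distrib_left ac_simps)
      ultimately show ?thesis using L_I[OF P(1), of "\<lambda>p. c * r p"] by simp
    qed
    show "a \<le> q x" if l: "(x, a) \<in> L" for x a
    proof -
      obtain P r where P: "finite P" "x = (\<lambda>(b, y). s b * comb P r y)" "a = (\<Sum>p\<in>P. r p * t p)"
        using L_E[OF l] by auto
      have mx: "m x y = \<bar>comb P r y\<bar>" for y by (auto simp: m_def P s_def)
      have xV: "x \<in> V" using fun_subspace_scale[OF product_ideal_subspace comb] by (auto simp: V_def P)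
      have "pn (comb P r) \<le> pn (m x)"
        by (rule pi_norm_mono[OF product_ideal_rep[OF mV[OF xV]]]) (simp add: mx)
      with C bound[OF P(1), of r] show ?thesis
        unfolding q_def P(3) comb_def[abs_def] by (meson mult_left_mono less_imp_le order_trans)
    qed
  qed (rule that, assumption+)
  \<comment> \<open>The embedding of one copy. Because \<open>q\<close> sees only positive parts,
    \<open>F (lift b (- u)) \<le> 0\<close> for nonnegative \<open>u\<close>, so \<open>F\<close> is
    positive on each copy.\<close>
  define lift where "lift b u = (\<lambda>(c, y). if c = b then u y else 0)" for b :: bool and u :: "'b \<Rightarrow> real"
  have liftV: "lift b u \<in> V" if u: "u \<in> product_ideal" for b u
  proof -
    have "(\<lambda>y. lift b u (c, y)) \<in> product_ideal" for c
      using u fun_subspace_zero[OF product_ideal_subspace] by (cases "c = b") (auto simp: lift_def)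
    then show ?thesis by (simp add: V_def)
  qed
  have lift_add: "lift b (\<lambda>y. u y + v y) = (\<lambda>x. lift b u x + lift b v x)" for b u v
    by (auto simp: lift_def fun_eq_iff)
  have lift_scale: "lift b (\<lambda>y. c * u y) = (\<lambda>x. c * lift b u x)" for b u c
    by (auto simp: lift_def fun_eq_iff)
  have m_lift: "m (lift b u) y = max 0 (u y)" for b u y
    by (cases b) (auto simp: m_def lift_def)
  have F_lift_le: "F (lift b u) \<le> C * pn v" if u: "u \<in> product_ideal" and v: "v \<in> product_ideal"
    and le: "AE y in N. u y \<le> \<bar>v y\<bar>" for b u v
  proof -
    have "pn (m (lift b u)) \<le> pn v"
      by (rule pi_norm_mono[OF product_ideal_rep[OF v]])
        (use le in eventually_elim, simp add: m_lift)
    with C have "q (lift b u) \<le> C * pn v" by (simp add: q_def)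
    with F_le[OF liftV[OF u]] show ?thesis by (rule order_trans)
  qed
  have F_lift_minus: "F (lift b (\<lambda>y. - 1 * u y)) = - F (lift b u)" if u: "u \<in> product_ideal" for b u
    unfolding lift_scale using F_scale[OF liftV[OF u], of "- 1"] by simp
  have minus: "(\<lambda>y. - 1 * u y) \<in> product_ideal" if u: "u \<in> product_ideal" for u
    by (rule fun_subspace_scale[OF product_ideal_subspace u])
  have ocf: "order_continuous_functional N product_ideal (\<lambda>u. F (lift b u))" for b
  proof (intro order_continuous_functional.intro[OF sf] order_continuous_functional_axioms.intro)
    show "solid_subspace N product_ideal" by (rule product_ideal_solid_subspace)
    show "F (lift b (\<lambda>x. u x + v x)) = F (lift b u) + F (lift b v)"
      if "u \<in> product_ideal" "v \<in> product_ideal" for u v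
      unfolding lift_add by (rule F_add[OF liftV[OF that(1)] liftV[OF that(2)]])
    show "F (lift b (\<lambda>x. c * u x)) = c * F (lift b u)" if "u \<in> product_ideal" for u c
      unfolding lift_scale by (rule F_scale[OF liftV[OF that]])
    show "0 \<le> F (lift b u)" if u: "u \<in> product_ideal" and nn: "AE x in N. 0 \<le> u x" for u
    proof -
      have "F (lift b (\<lambda>y. - 1 * u y)) \<le> C * pn (\<lambda>_. 0)"
        by (rule F_lift_le[OF minus[OF u] fun_subspace_zero[OF product_ideal_subspace]])
          (use nn in eventually_elim, simp)
      moreover have "pn (\<lambda>_. 0) \<le> nY (\<lambda>_. 0) * nZ (\<lambda>_. 0)"
        by (rule pi_norm_product_le[OF Y.zero Z.zero]) simp
      then have "C * pn (\<lambda>_. 0) \<le> C * 0" using C by (intro mult_left_mono) (simp_all add: Y.norm_zero)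
      ultimately show ?thesis using F_lift_minus[OF u] by simp
    qed
    show "(\<lambda>i. F (lift b (\<lambda>x. indicator (A i) x * u x))) \<longlonglongrightarrow> 0"
      if u: "u \<in> product_ideal" and A: "range A \<subseteq> sets N" "decseq A" "(\<Inter>i. A i) = {}"
      for u and A :: "nat \<Rightarrow> 'b set"
    proof (rule Lim_null_comparison[OF always_eventually])
      have Au: "(\<lambda>y. indicator (A i) y * u y) \<in> product_ideal" for i
        using A(1) product_ideal_measurable[OF u]
        by (intro product_ideal_solid[OF _ u] borel_measurable_times borel_measurable_indicator)
          (auto simp: indicator_def)
      show "\<forall>i. norm (F (lift b (\<lambda>x. indicator (A i) x * u x))) \<le> C * pn (\<lambda>y. indicator (A i) y * u y)"
      proof
        fix i
        have "F (lift b (\<lambda>x. indicator (A i) x * u x)) \<le> C * pn (\<lambda>y. indicator (A i) y * u y)"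
          by (rule F_lift_le[OF Au Au]) simp
        moreover have "F (lift b (\<lambda>x. - 1 * (indicator (A i) x * u x))) \<le> C * pn (\<lambda>y. indicator (A i) y * u y)"
          by (rule F_lift_le[OF minus[OF Au] Au]) simp
        ultimately show "norm (F (lift b (\<lambda>x. indicator (A i) x * u x))) \<le> C * pn (\<lambda>y. indicator (A i) y * u y)"
          using F_lift_minus[OF Au, of b i] by (simp only: real_norm_def abs_le_iff)
      qed
      show "(\<lambda>i. C * pn (\<lambda>y. indicator (A i) y * u y)) \<longlonglongrightarrow> 0"
        using tendsto_mult_left[OF pi_norm_order_continuous[OF soc u A], of C] by simp
    qed
  qed
  \<comment> \<open>The product of weak units of the two factors is the strictly positive element of
    the ideal that the integral representation needs.\<close>
  obtain e where e: "e \<in> Y" "AE y in N. 0 < e y" by (rule Y.weak_unit[OF sf satY])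
  obtain e' where e': "e' \<in> Z" "AE y in N. 0 < e' y" by (rule Z.weak_unit[OF sf satZ])
  have ee: "AE y in N. 0 < e y * e' y" using e(2) e'(2) by eventually_elim simp
  have "\<exists>g. g \<in> borel_measurable N \<and> (\<forall>u\<in>product_ideal. integrable N (\<lambda>y. g y * u y) \<and> (\<integral>y. g y * u y \<partial>N) = F (lift b u))" for b
    using order_continuous_functional.integral_representation[OF ocf product_in_ideal[OF e(1) e'(1)] ee, of b]
    by metis
  then obtain G where Gm: "\<And>b. G b \<in> borel_measurable N"
    and Gi: "\<And>b u. u \<in> product_ideal \<Longrightarrow> integrable N (\<lambda>y. G b y * u y)"
    and G_eq: "\<And>b u. u \<in> product_ideal \<Longrightarrow> (\<integral>y. G b y * u y \<partial>N) = F (lift b u)"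
    by metis
  \<comment> \<open>The pair \<open>(u, - u)\<close> is \<open>u\<close> in the first copy minus
    \<open>u\<close> in the second, so the prescribed moments are those of the difference of the two
    densities.\<close>
  define g where "g y = G True y - G False y" for y
  have gi: "integrable N (\<lambda>y. g y * u y)" if "u \<in> product_ideal" for u
    using Gi[OF that] by (simp add: g_def left_diff_distrib)
  show ?thesis
  proof (rule that)
    show "g \<in> mult_space N Y (kdual N Z)"
      unfolding multiplier_iff
    proof (intro conjI ballI)
      show "g \<in> borel_measurable N" unfolding g_def[abs_def] by (intro borel_measurable_diff Gm)
      show "integrable N (\<lambda>y. g y * f y * k y)" if "f \<in> Y" "k \<in> Z" for f k
        using gi[OF product_in_ideal[OF that]] by (simp add: mult.assoc)
    qed
    show "(\<integral>y. g y * w p y \<partial>N) = t p" for p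
    proof -
      have "(\<integral>y. g y * w p y \<partial>N) = F (lift True (w p)) - F (lift False (w p))"
        using Gi[OF w] G_eq[OF w] by (simp add: g_def left_diff_distrib)
      also have "\<dots> = F (\<lambda>x. lift True (w p) x + lift False (\<lambda>y. - 1 * w p y) x)"
        using F_add[OF liftV[OF w] liftV[OF minus[OF w]]] F_lift_minus[OF w] by simp
      also have "(\<lambda>x. lift True (w p) x + lift False (\<lambda>y. - 1 * w p y) x) = (\<lambda>(b, y). s b * comb {p} (\<lambda>_. 1) y)"
        by (auto simp: lift_def s_def comb_def fun_eq_iff)
      also have "F \<dots> = (\<Sum>p\<in>{p}. 1 * t p)" by (rule F_L[OF L_I]) simp
      finally show ?thesis by simp
    qed
  qed
qed

end

section \<open>Bounded operators along Schauder expansions\<close>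

lemma bounded_op_diff_sum:
  assumes X: "riesz_fischer_space M X nX" and T: "bounded_op M N X nX Y nY T"
    and x: "x \<in> X" and b: "\<And>k::nat. b k \<in> X"
  shows "AE y in N. T (\<lambda>t. x t - (\<Sum>k<n. a k * b k t)) y = T x y - (\<Sum>k<n. a k * T (b k) y)"
proof -
  interpret riesz_fischer_space M X nX by (rule X)
  \<comment> \<open>\<open>T\<close> is linear only up to a null set depending on the arguments; the
    expansion is therefore built by induction, with one more null set for each term.\<close>
  have lin: "AE y in N. T (\<lambda>t. c * f t + d * g t) y = c * T f y + d * T g y" if "f \<in> X" "g \<in> X" for f g c d
    using T that unfolding bounded_op_def by blast
  show ?thesis
  proof (induction n)
    case 0
    then show ?case by simp
  next
    case (Suc n)
    have "(\<lambda>t. x t - (\<Sum>k<n. a k * b k t)) \<in> X" by (intro diff x sum b)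
    from lin[OF this b, of 1 "- a n" n] Suc show ?case
      by eventually_elim (simp add: algebra_simps)
  qed
qed

lemma bounded_op_subsequence:
  assumes X: "riesz_fischer_space M X nX" and Y: "riesz_fischer_space N Y nY"
    and T: "bounded_op M N X nX Y nY T"
    and v: "\<And>n::nat. v n \<in> X" and lim: "(\<lambda>n. nX (v n)) \<longlonglongrightarrow> 0"
  obtains r :: "nat \<Rightarrow> nat" where "strict_mono r" "AE y in N. (\<lambda>n. T (v (r n)) y) \<longlonglongrightarrow> 0"
proof -
  interpret X: riesz_fischer_space M X nX by (rule X)
  interpret Y: riesz_fischer_space N Y nY by (rule Y)
  have Tv: "T (v n) \<in> Y" for n using T v unfolding bounded_op_def by blast
  obtain K where K: "\<And>f. f \<in> X \<Longrightarrow> nY (T f) \<le> K * nX f" using T unfolding bounded_op_def by blast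
  have "(\<lambda>n. nY (T (v n))) \<longlonglongrightarrow> 0"
  proof (rule Lim_null_comparison[OF always_eventually])
    show "\<forall>n. norm (nY (T (v n))) \<le> K * nX (v n)" using K[OF v] Y.norm_nonneg[OF Tv] by simp
    show "(\<lambda>n. K * nX (v n)) \<longlonglongrightarrow> 0" using tendsto_mult_left[OF lim, of K] by simp
  qed
  from Y.subsequence_AE[OF Tv this] that show ?thesis by blast
qed

text \<open>The defect \<open>T - g * S (h * _)\<close> vanishes on every \<open>\<beta> k\<close>,
  so on the remainders \<open>v n\<close> of the expansion it is the same function as on
  \<open>x\<close>. Along a subsequence both images of the remainders tend to 0 almost everywhere,
  and multiplication by the number \<open>g y\<close> preserves this.\<close>

lemma factorization_from_basis:
  assumes X1: "riesz_fischer_space M X1 nX1" and X2: "riesz_fischer_space M X2 nX2"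
    and Y1: "riesz_fischer_space N Y1 nY1" and Y2: "riesz_fischer_space N Y2 nY2"
    and T: "bounded_op M N X1 nX1 Y1 nY1 T" and S: "bounded_op M N X2 nX2 Y2 nY2 S"
    and basis: "schauder_basis X1 nX1 \<beta>" and h: "h \<in> mult_space M X1 X2"
    and eq: "\<And>n. AE y in N. T (\<beta> n) y = g y * S (\<lambda>t. h t * \<beta> n t) y"
    and x: "x \<in> X1"
  shows "AE y in N. T x y = g y * S (\<lambda>t. h t * x t) y"
proof -
  interpret X1: riesz_fischer_space M X1 nX1 by (rule X1)
  interpret X2: riesz_fischer_space M X2 nX2 by (rule X2)
  have hX: "(\<lambda>t. h t * f t) \<in> X2" if "f \<in> X1" for f using h that by (simp add: mult_space_def)
  have \<beta>: "\<beta> k \<in> X1" for k using basis by (simp add: schauder_basis_def)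
  obtain a where a: "(\<lambda>n. nX1 (\<lambda>t. x t - (\<Sum>k<n. a k * \<beta> k t))) \<longlonglongrightarrow> 0"
    using basis x unfolding schauder_basis_def by blast
  \<comment> \<open>Multiplication by \<open>h\<close> is bounded from \<open>X1\<close> to
    \<open>X2\<close>, again by the gliding hump.\<close>
  obtain K where K: "\<And>f. f \<in> X1 \<Longrightarrow> nX2 (\<lambda>t. h t * f t) \<le> K * nX1 f"
  proof (rule X1.positive_functional_bounded[where \<Psi> = "\<lambda>f. nX2 (\<lambda>t. h t * f t)"])
    show "0 \<le> nX2 (\<lambda>t. h t * f t)" if "f \<in> X1" for f by (rule X2.norm_nonneg[OF hX[OF that]])
    show "nX2 (\<lambda>t. h t * (c * f t)) = \<bar>c\<bar> * nX2 (\<lambda>t. h t * f t)" if "f \<in> X1" for f c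
      using X2.norm_scale[OF hX[OF that], of c] by (simp add: mult.left_commute)
    show "nX2 (\<lambda>t. h t * f t) \<le> nX2 (\<lambda>t. h t * f' t)"
      if "f \<in> X1" "f' \<in> X1" "AE t in M. \<bar>f t\<bar> \<le> \<bar>f' t\<bar>" for f f'
      by (rule X2.norm_mono[OF X2.measurable[OF hX[OF that(1)]] hX[OF that(2)]])
        (use that(3) in eventually_elim, simp add: abs_mult mult_left_mono)
  qed (use that in blast)
  define v where "v n t = x t - (\<Sum>k<n. a k * \<beta> k t)" for n t
  have v: "v n \<in> X1" for n unfolding v_def[abs_def] by (intro X1.diff x X1.sum \<beta>)
  have v_lim: "(\<lambda>n. nX1 (v n)) \<longlonglongrightarrow> 0" using a by (simp add: v_def[abs_def])
  have hv_lim: "(\<lambda>n. nX2 (\<lambda>t. h t * v n t)) \<longlonglongrightarrow> 0"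
  proof (rule Lim_null_comparison[OF always_eventually])
    show "\<forall>n. norm (nX2 (\<lambda>t. h t * v n t)) \<le> K * nX1 (v n)" using K[OF v] X2.norm_nonneg[OF hX[OF v]] by simp
    show "(\<lambda>n. K * nX1 (v n)) \<longlonglongrightarrow> 0" using tendsto_mult_left[OF v_lim, of K] by simp
  qed
  obtain r :: "nat \<Rightarrow> nat" where r: "strict_mono r" "AE y in N. (\<lambda>n. T (v (r n)) y) \<longlonglongrightarrow> 0"
    by (rule bounded_op_subsequence[OF X1 Y1 T v v_lim])
  have "(\<lambda>n. nX2 (\<lambda>t. h t * v (r n) t)) \<longlonglongrightarrow> 0"
    using LIMSEQ_subseq_LIMSEQ[OF hv_lim r(1)] by (simp add: o_def)
  \<comment> \<open>The second subsequence is drawn from the first, so that both limits hold along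
    the indices \<open>r (s n)\<close>.\<close>
  then obtain s :: "nat \<Rightarrow> nat" where s: "strict_mono s" "AE y in N. (\<lambda>n. S (\<lambda>t. h t * v (r (s n)) t) y) \<longlonglongrightarrow> 0"
    by (rule bounded_op_subsequence[OF X2 Y2 S hX[OF v]])
  have Tv: "AE y in N. \<forall>n. T (v n) y = T x y - (\<Sum>k<n. a k * T (\<beta> k) y)"
    unfolding AE_all_countable v_def[abs_def] by (intro allI bounded_op_diff_sum[OF X1 T x \<beta>])
  have hv: "(\<lambda>t. h t * v n t) = (\<lambda>t. h t * x t - (\<Sum>k<n. a k * (h t * \<beta> k t)))" for n
    by (auto simp: v_def right_diff_distrib sum_distrib_left ac_simps)
  have Sv: "AE y in N. \<forall>n. S (\<lambda>t. h t * v n t) y = S (\<lambda>t. h t * x t) y - (\<Sum>k<n. a k * S (\<lambda>t. h t * \<beta> k t) y)"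
    unfolding AE_all_countable hv by (intro allI bounded_op_diff_sum[OF X2 S hX[OF x] hX[OF \<beta>]])
  have eq': "AE y in N. \<forall>n. T (\<beta> n) y = g y * S (\<lambda>t. h t * \<beta> n t) y"
    unfolding AE_all_countable using eq by blast
  from r(2) s(2) Tv Sv eq' show ?thesis
  proof eventually_elim
    case (elim y)
    have "(\<lambda>n. T (v (r (s n))) y - g y * S (\<lambda>t. h t * v (r (s n)) t) y) \<longlonglongrightarrow> 0 - g y * 0"
      using LIMSEQ_subseq_LIMSEQ[OF elim(1) s(1)] elim(2) by (intro tendsto_intros) (auto simp: o_def)
    moreover have "T (v n) y - g y * S (\<lambda>t. h t * v n t) y = T x y - g y * S (\<lambda>t. h t * x t) y" for n
    proof -
      have "(\<Sum>k<n. a k * T (\<beta> k) y) = g y * (\<Sum>k<n. a k * S (\<lambda>t. h t * \<beta> k t) y)"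
        using elim(5) by (simp add: sum_distrib_left mult.left_commute)
      then show ?thesis using elim(3,4) by (simp add: right_diff_distrib)
    qed
    ultimately have "(\<lambda>n::nat. T x y - g y * S (\<lambda>t. h t * x t) y) \<longlonglongrightarrow> 0" by simp
    then show ?case by (simp add: LIMSEQ_const_iff)
  qed
qed

section \<open>The factorization theorem\<close>

theorem theorem4p2:
  fixes M :: "'a measure" and N :: "'b measure"
    and X1 X2 :: "('a \<Rightarrow> real) set" and nX1 nX2 :: "('a \<Rightarrow> real) \<Rightarrow> real"
    and Y1 Y2 :: "('b \<Rightarrow> real) set" and nY1 nY2 :: "('b \<Rightarrow> real) \<Rightarrow> real"
    and T S :: "('a \<Rightarrow> real) \<Rightarrow> ('b \<Rightarrow> real)"
    and \<beta> :: "nat \<Rightarrow> 'a \<Rightarrow> real" and \<gamma> :: "nat \<Rightarrow> 'b \<Rightarrow> real"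
    and h :: "'a \<Rightarrow> real"
  assumes sfM: "sigma_finite_measure M" and sfN: "sigma_finite_measure N"
    and X1: "bfs M X1 nX1" "saturated M X1"
    and X2: "bfs M X2 nX2" "saturated M X2"
    and Y1: "bfs N Y1 nY1" "saturated N Y1"
    and Y2: "bfs N Y2 nY2" "saturated N Y2"
    and T: "bounded_op M N X1 nX1 Y1 nY1 T" "nontrivial_op N X1 T"
    and S: "bounded_op M N X2 nX2 Y2 nY2 S" "nontrivial_op N X2 S"
    and gamma_basis: "schauder_basis (kdual N Y1) (kdual_norm N Y1 nY1) \<gamma>"
    and beta_basis: "schauder_basis X1 nX1 \<beta>"
    and sat_mult: "saturated N (mult_space N Y2 (kdual N (kdual N Y1)))"
    and soc: "sigma_order_continuous N Y2 nY2 \<or>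
              sigma_order_continuous N (kdual N Y1) (kdual_norm N Y1 nY1)"
    and h: "h \<in> mult_space M X1 X2"
  shows
   "let Y1dd = kdual N (kdual N Y1);
        G = mult_space N Y2 Y1dd;
        A = (\<exists>g\<in>G. \<forall>x\<in>X1. AE y in N. T x y = g y * S (\<lambda>t. h t * x t) y);
        B = (\<exists>g\<in>G. \<forall>n. AE y in N. T (\<beta> n) y = g y * S (\<lambda>t. h t * \<beta> n t) y);
        C = (\<exists>C>0. \<forall>n m. \<forall>r::nat \<Rightarrow> nat \<Rightarrow> real. (\<forall>i j. \<bar>r i j\<bar> \<le> 1) \<longrightarrow>
               (\<Sum>i<n. \<Sum>j<m. r i j * (\<integral>y. T (\<beta> j) y * \<gamma> i y \<partial>N))
               \<le> C * pi_norm N Y2 nY2 (kdual N Y1) (kdual_norm N Y1 nY1)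
                      (\<lambda>y. \<Sum>i<n. \<Sum>j<m. r i j * S (\<lambda>t. h t * \<beta> j t) y * \<gamma> i y));
        D = (\<exists>C>0. \<forall>n m. \<forall>r::nat \<Rightarrow> real. (\<forall>j. \<bar>r j\<bar> \<le> 1) \<longrightarrow>
               (\<Sum>j<m. r j * (\<integral>y. T (\<beta> j) y * \<gamma> n y \<partial>N))
               \<le> C * (\<integral>y. \<bar>\<Sum>j<m. r j * S (\<lambda>t. h t * \<beta> j t) y * \<gamma> n y\<bar> \<partial>N));
        extra = (Y2 \<subseteq> Y1dd \<and>
                 (\<forall>i j. i \<noteq> j \<longrightarrow> (AE y in N. \<gamma> i y = 0 \<or> \<gamma> j y = 0)))
    in (A \<longleftrightarrow> B) \<and> (B \<longleftrightarrow> C) \<and>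
       (extra \<longrightarrow> (D \<longrightarrow> A)) \<and>
       (extra \<and> G = Linf N \<longrightarrow> (D \<longleftrightarrow> A))"
proof -
  interpret X1: riesz_fischer_space M X1 nX1 by (rule bfs_riesz_fischer_space[OF X1(1)])
  interpret X2: riesz_fischer_space M X2 nX2 by (rule bfs_riesz_fischer_space[OF X2(1)])
  interpret Y1: riesz_fischer_space N Y1 nY1 by (rule bfs_riesz_fischer_space[OF Y1(1)])
  interpret Y2: riesz_fischer_space N Y2 nY2 by (rule bfs_riesz_fischer_space[OF Y2(1)])
  let ?Z = "kdual N Y1" and ?nZ = "kdual_norm N Y1 nY1"
  interpret Z: riesz_fischer_space N ?Z ?nZ by (rule Y1.kdual_riesz_fischer_space[OF Y1(2)])
  interpret P: product_pair N Y2 nY2 ?Z ?nZ ..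
  \<comment> \<open>Saturation of Y1' is derived rather than assumed. It yields a weak unit in Y1',
    a norm on Y1'', and the uniqueness statement that ends the step from (c) to (b).\<close>
  have satZ: "saturated N ?Z" by (rule Y1.kdual_saturated[OF sfN])
  let ?G = "mult_space N Y2 (kdual N ?Z)"
  let ?s = "\<lambda>j. S (\<lambda>t. h t * \<beta> j t)"
  let ?pn = "pi_norm N Y2 nY2 ?Z ?nZ"
  have \<beta>: "\<beta> j \<in> X1" for j using beta_basis by (simp add: schauder_basis_def)
  have \<gamma>: "\<gamma> i \<in> ?Z" for i using gamma_basis by (simp add: schauder_basis_def)
  have s: "?s j \<in> Y2" for j
    using S(1) h \<beta>[of j] by (auto simp: bounded_op_def mult_space_def)
  have T\<beta>: "T (\<beta> j) \<in> Y1" for j using T(1) \<beta>[of j] by (simp add: bounded_op_def)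
  have T\<gamma>: "integrable N (\<lambda>y. T (\<beta> j) y * \<gamma> i y)" for i j
    using Y1.kdual_integrable[OF \<gamma> T\<beta>, of i j] by (simp add: mult.commute)
  have s\<gamma>: "(\<lambda>y. ?s j y * \<gamma> i y) \<in> P.product_ideal" for i j by (rule P.product_in_ideal[OF s \<gamma>])
  have lin: "(\<lambda>y. \<Sum>p\<in>Q. r p * (?s (snd p) y * \<gamma> (fst p) y)) \<in> P.product_ideal" for Q and r :: "nat \<times> nat \<Rightarrow> real"
    by (rule P.product_ideal_sum) (rule s\<gamma>)
  \<comment> \<open>Moments are indexed by pairs \<open>(i, j)\<close>, with \<open>i\<close> for
    \<open>\<gamma>\<close> and \<open>j\<close> for \<open>\<beta>\<close>; this connects the
    double sums of (c) with that indexing.\<close>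
  have dbl: "(\<Sum>i<n. \<Sum>j<m. f i j) = (\<Sum>p\<in>{..<n} \<times> {..<m}. f (fst p) (snd p))" for n m :: nat and f :: "nat \<Rightarrow> nat \<Rightarrow> real"
    by (simp add: sum.cartesian_product case_prod_beta)
  have lin2: "(\<lambda>y. \<Sum>i<n. \<Sum>j<m. r i j * ?s j y * \<gamma> i y) \<in> P.product_ideal" for n m and r :: "nat \<Rightarrow> nat \<Rightarrow> real"
    unfolding dbl using lin[where Q = "{..<n} \<times> {..<m}" and r = "\<lambda>p. r (fst p) (snd p)"] by (simp add: mult.assoc)
  have lin1: "(\<lambda>y. \<Sum>j<m. r j * ?s j y * \<gamma> n y) \<in> P.product_ideal" for n m and r :: "nat \<Rightarrow> real"
    using P.product_ideal_sum[of "{..<m}" "\<lambda>j y. ?s j y * \<gamma> n y" r] s\<gamma> by (simp add: mult.assoc)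
  let ?A = "\<exists>g\<in>?G. \<forall>x\<in>X1. AE y in N. T x y = g y * S (\<lambda>t. h t * x t) y"
  let ?B = "\<exists>g\<in>?G. \<forall>n. AE y in N. T (\<beta> n) y = g y * ?s n y"
  let ?C = "\<exists>C>0. \<forall>n m. \<forall>r::nat \<Rightarrow> nat \<Rightarrow> real. (\<forall>i j. \<bar>r i j\<bar> \<le> 1) \<longrightarrow>
      (\<Sum>i<n. \<Sum>j<m. r i j * (\<integral>y. T (\<beta> j) y * \<gamma> i y \<partial>N))
      \<le> C * ?pn (\<lambda>y. \<Sum>i<n. \<Sum>j<m. r i j * ?s j y * \<gamma> i y)"
  let ?D = "\<exists>C>0. \<forall>n m. \<forall>r::nat \<Rightarrow> real. (\<forall>j. \<bar>r j\<bar> \<le> 1) \<longrightarrow>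
      (\<Sum>j<m. r j * (\<integral>y. T (\<beta> j) y * \<gamma> n y \<partial>N))
      \<le> C * (\<integral>y. \<bar>\<Sum>j<m. r j * ?s j y * \<gamma> n y\<bar> \<partial>N)"
  let ?E = "Y2 \<subseteq> kdual N ?Z \<and> (\<forall>i j. i \<noteq> j \<longrightarrow> (AE y in N. \<gamma> i y = 0 \<or> \<gamma> j y = 0))"
  have moment: "(\<integral>y. T (\<beta> j) y * \<gamma> i y \<partial>N) = (\<integral>y. g y * (?s j y * \<gamma> i y) \<partial>N)"
    if g: "g \<in> ?G" and eq: "\<And>n. AE y in N. T (\<beta> n) y = g y * ?s n y" for g i j
  proof (rule integral_cong_AE)
    show "AE y in N. T (\<beta> j) y * \<gamma> i y = g y * (?s j y * \<gamma> i y)"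
      using eq[of j] by eventually_elim simp
    show "(\<lambda>y. T (\<beta> j) y * \<gamma> i y) \<in> borel_measurable N" using T\<gamma> by blast
    show "(\<lambda>y. g y * (?s j y * \<gamma> i y)) \<in> borel_measurable N"
      using g Y2.measurable[OF s] Z.measurable[OF \<gamma>]
      by (intro borel_measurable_times) (simp_all add: mult_space_def)
  qed
  have BA: "?A" if B: ?B
  proof -
    obtain g where g: "g \<in> ?G" "\<And>n. AE y in N. T (\<beta> n) y = g y * ?s n y" using B by blast
    have "AE y in N. T x y = g y * S (\<lambda>t. h t * x t) y" if "x \<in> X1" for x
      by (rule factorization_from_basis[OF X1.riesz_fischer_space_axioms X2.riesz_fischer_space_axioms
            Y1.riesz_fischer_space_axioms Y2.riesz_fischer_space_axioms T(1) S(1) beta_basis h g(2) that])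
    with g(1) show ?thesis by blast
  qed
  have AB: "?B" if ?A using that \<beta> by blast
  have BC: "?C" if B: ?B
  proof -
    obtain g where g: "g \<in> ?G" "\<And>n. AE y in N. T (\<beta> n) y = g y * ?s n y" using B by blast
    obtain K where K: "0 < K" "\<And>u. u \<in> P.product_ideal \<Longrightarrow>
        integrable N (\<lambda>y. g y * u y) \<and> (\<integral>y. \<bar>g y * u y\<bar> \<partial>N) \<le> K * ?pn u"
      by (rule P.multiplier_pi_bound[OF satZ g(1)]) blast
    have "(\<Sum>i<n. \<Sum>j<m. r i j * (\<integral>y. T (\<beta> j) y * \<gamma> i y \<partial>N))
      \<le> K * ?pn (\<lambda>y. \<Sum>i<n. \<Sum>j<m. r i j * ?s j y * \<gamma> i y)" for n m and r :: "nat \<Rightarrow> nat \<Rightarrow> real"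
    proof -
      have i: "integrable N (\<lambda>y. g y * (?s j y * \<gamma> i y))" for i j using K(2)[OF s\<gamma>] by blast
      have "(\<Sum>i<n. \<Sum>j<m. r i j * (\<integral>y. T (\<beta> j) y * \<gamma> i y \<partial>N))
        = (\<integral>y. (\<Sum>i<n. \<Sum>j<m. r i j * (g y * (?s j y * \<gamma> i y))) \<partial>N)"
        using i by (simp add: moment[OF g] Bochner_Integration.integral_sum)
      also have "\<dots> = (\<integral>y. g y * (\<Sum>i<n. \<Sum>j<m. r i j * ?s j y * \<gamma> i y) \<partial>N)"
        by (simp add: sum_distrib_left ac_simps)
      also have "\<dots> \<le> (\<integral>y. \<bar>g y * (\<Sum>i<n. \<Sum>j<m. r i j * ?s j y * \<gamma> i y)\<bar> \<partial>N)"
        using K(2)[OF lin2] by (intro integral_mono integrable_abs) auto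
      also have "\<dots> \<le> K * ?pn (\<lambda>y. \<Sum>i<n. \<Sum>j<m. r i j * ?s j y * \<gamma> i y)"
        using K(2)[OF lin2] by blast
      finally show ?thesis .
    qed
    with K(1) show ?thesis by blast
  qed
  have CB: "?B" if C: ?C
  proof -
    obtain C where C: "0 < C" "\<And>n m r. (\<And>i j. \<bar>r i j\<bar> \<le> (1::real)) \<Longrightarrow>
        (\<Sum>i<n. \<Sum>j<m. r i j * (\<integral>y. T (\<beta> j) y * \<gamma> i y \<partial>N))
        \<le> C * ?pn (\<lambda>y. \<Sum>i<n. \<Sum>j<m. r i j * ?s j y * \<gamma> i y)"
      using C by blast
    let ?w = "\<lambda>p y. ?s (snd p) y * \<gamma> (fst p) y"
    let ?t = "\<lambda>p. \<integral>y. T (\<beta> (snd p)) y * \<gamma> (fst p) y \<partial>N"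
    \<comment> \<open>Condition (c) speaks of rectangular index ranges and of coefficients of
      modulus at most 1. An arbitrary finite \<open>Q\<close> is filled up to a square with zero
      coefficients, and division by \<open>R\<close> makes all coefficients admissible; since both
      sides scale by the same factor, the division can be undone. The summand 1 in \<open>R\<close>
      keeps it positive.\<close>
    have bound: "(\<Sum>p\<in>Q. r p * ?t p) \<le> C * ?pn (\<lambda>y. \<Sum>p\<in>Q. r p * ?w p y)"
      if Q: "finite Q" for Q :: "(nat \<times> nat) set" and r
    proof -
      have "\<exists>n. fst ` Q \<union> snd ` Q \<subseteq> {..<n}" using Q by (intro finite_nat_bounded) auto
      then obtain n where "fst ` Q \<union> snd ` Q \<subseteq> {..<n}" by blast
      then have n: "Q \<subseteq> {..<n} \<times> {..<n}"
        by (intro subsetI) (simp add: mem_Times_iff image_subset_iff)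
      define R where "R = 1 + (\<Sum>p\<in>Q. \<bar>r p\<bar>)"
      have R: "1 \<le> R" by (simp add: R_def sum_nonneg)
      define r' where "r' i j = (if (i, j) \<in> Q then r (i, j) / R else 0)" for i j
      have "\<bar>r' i j\<bar> \<le> 1" for i j
      proof (cases "(i, j) \<in> Q")
        case True
        then have "\<bar>r (i, j)\<bar> \<le> R" using member_le_sum[OF True, of "\<lambda>p. \<bar>r p\<bar>"] Q by (simp add: R_def)
        moreover have "\<bar>r' i j\<bar> = \<bar>r (i, j)\<bar> / R" using R True by (simp add: r'_def)
        ultimately show ?thesis using R by simp
      qed (simp add: r'_def)
      moreover have sum_r': "(\<Sum>i<n. \<Sum>j<n. r' i j * f i j) = (\<Sum>p\<in>Q. r p * f (fst p) (snd p)) / R" for f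
      proof -
        have "(\<Sum>i<n. \<Sum>j<n. r' i j * f i j) = (\<Sum>p\<in>{..<n} \<times> {..<n}. r' (fst p) (snd p) * f (fst p) (snd p))"
          by (rule dbl)
        also have "\<dots> = (\<Sum>p\<in>Q. r' (fst p) (snd p) * f (fst p) (snd p))"
          using n by (intro sum.mono_neutral_right) (auto simp: r'_def)
        also have "\<dots> = (\<Sum>p\<in>Q. r p * f (fst p) (snd p) / R)"
          by (intro sum.cong) (auto simp: r'_def)
        finally show ?thesis by (simp add: sum_divide_distrib)
      qed
      ultimately have "(\<Sum>p\<in>Q. r p * ?t p) / R \<le> C * ?pn (\<lambda>y. \<Sum>i<n. \<Sum>j<n. r' i j * ?s j y * \<gamma> i y)"
        using C(2)[of r' n n] by (simp only: sum_r')
      also have "(\<lambda>y. \<Sum>i<n. \<Sum>j<n. r' i j * ?s j y * \<gamma> i y) = (\<lambda>y. inverse R * (\<Sum>p\<in>Q. r p * ?w p y))"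
        using sum_r' by (auto simp: mult.assoc divide_inverse_commute)
      also have "C * ?pn (\<lambda>y. inverse R * (\<Sum>p\<in>Q. r p * ?w p y)) \<le> C * (\<bar>inverse R\<bar> * ?pn (\<lambda>y. \<Sum>p\<in>Q. r p * ?w p y))"
        using C(1) by (intro mult_left_mono P.pi_norm_scale_le P.product_ideal_rep lin) simp
      finally show ?thesis using R by (simp add: field_simps)
    qed
    obtain g where g: "g \<in> ?G" and g_eq: "\<And>p. (\<integral>y. g y * ?w p y \<partial>N) = ?t p"
      by (rule P.moment_representation[OF sfN Y2(2) satZ soc s\<gamma> C(1) bound]) blast+
    have "AE y in N. T (\<beta> j) y = g y * ?s j y" for j
    proof -
      have gs: "(\<lambda>y. g y * ?s j y) \<in> kdual N ?Z" using g s by (simp add: mult_space_def)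
      have gi: "integrable N (\<lambda>y. g y * ?s j y * \<gamma> i y)" for i by (rule Z.kdual_integrable[OF gs \<gamma>])
      \<comment> \<open>Here \<open>T (\<beta> j)\<close> is regarded as an element of Y1'', which
        contains Y1; in Y1'' it can be compared with \<open>g * ?s j\<close>.\<close>
      have "(\<lambda>y. T (\<beta> j) y - g y * ?s j y) \<in> kdual N ?Z"
      proof (rule Z.kdualI)
        show "(\<lambda>y. T (\<beta> j) y - g y * ?s j y) \<in> borel_measurable N"
          by (intro borel_measurable_diff Y1.measurable[OF T\<beta>] Z.kdual_measurable[OF gs])
        show "integrable N (\<lambda>y. (T (\<beta> j) y - g y * ?s j y) * k y)" if k: "k \<in> ?Z" for k
          using Bochner_Integration.integrable_diff[OF Y1.kdual_integrable[OF k T\<beta>, of j] Z.kdual_integrable[OF gs k]]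
          by (simp add: left_diff_distrib mult.commute[of "k _"])
      qed
      moreover have "(\<integral>y. (T (\<beta> j) y - g y * ?s j y) * \<gamma> i y \<partial>N) = 0" for i
        using T\<gamma>[of j i] gi[of i] g_eq[of "(i, j)"] by (simp add: left_diff_distrib mult.assoc)
      ultimately have "AE y in N. T (\<beta> j) y - g y * ?s j y = 0"
        by (rule Z.kdual_annihilator_basis[OF sfN satZ gamma_basis])
      then show ?thesis by eventually_elim simp
    qed
    with g show ?thesis by blast
  qed
  have DC: "?C" if E: ?E and D: ?D
  proof -
    obtain C where C: "0 < C" "\<And>n m r. (\<And>j. \<bar>r j\<bar> \<le> (1::real)) \<Longrightarrow>
        (\<Sum>j<m. r j * (\<integral>y. T (\<beta> j) y * \<gamma> n y \<partial>N)) \<le> C * (\<integral>y. \<bar>\<Sum>j<m. r j * ?s j y * \<gamma> n y\<bar> \<partial>N)"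
      using D by blast
    \<comment> \<open>Stating the inclusion of Y2 in Y1'' as membership of the constant 1 makes the
      multiplier bound an estimate of the L1 norm by the pi-norm.\<close>
    have one: "(\<lambda>_. 1) \<in> ?G" using E by (auto simp: mult_space_def)
    obtain K where K: "0 < K" "\<And>u. u \<in> P.product_ideal \<Longrightarrow>
        integrable N (\<lambda>y. 1 * u y) \<and> (\<integral>y. \<bar>1 * u y\<bar> \<partial>N) \<le> K * ?pn u"
      by (rule P.multiplier_pi_bound[OF satZ one]) blast
    have "(\<Sum>i<n. \<Sum>j<m. r i j * (\<integral>y. T (\<beta> j) y * \<gamma> i y \<partial>N))
      \<le> (C * K) * ?pn (\<lambda>y. \<Sum>i<n. \<Sum>j<m. r i j * ?s j y * \<gamma> i y)"
      if r: "\<And>i j. \<bar>r i j\<bar> \<le> 1" for n m and r :: "nat \<Rightarrow> nat \<Rightarrow> real"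
    proof -
      define u where "u i y = (\<Sum>j<m. r i j * ?s j y * \<gamma> i y)" for i y
      have ui: "integrable N (u i)" for i using K(2)[OF lin1[where m = m and r = "r i" and n = i]] by (simp add: u_def[abs_def])
      have u_eq: "u i y = (\<Sum>j<m. r i j * ?s j y) * \<gamma> i y" for i y by (simp add: u_def sum_distrib_right)
      have "AE y in N. \<forall>i j. i \<noteq> j \<longrightarrow> \<gamma> i y = 0 \<or> \<gamma> j y = 0"
        using E by (simp add: AE_all_countable)
      \<comment> \<open>At almost every \<open>y\<close> at most one \<open>\<gamma> i y\<close> is
        nonzero, hence at most one summand. This merges the separate estimates of (d) for each
        \<open>n\<close> into one L1 norm of the whole double sum.\<close>
      then have disj: "AE y in N. (\<Sum>i<n. \<bar>u i y\<bar>) = \<bar>\<Sum>i<n. u i y\<bar>"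
      proof eventually_elim
        case (elim y)
        show ?case
        proof (cases "\<exists>i. \<gamma> i y \<noteq> 0")
          case True
          then obtain i where i: "\<gamma> i y \<noteq> 0" by blast
          have z: "u k y = 0" if "k \<noteq> i" for k using elim i that by (auto simp: u_eq)
          have "u k y = (if k = i then u i y else 0)" for k using z by simp
          then have "(\<Sum>k<n. u k y) = (if i < n then u i y else 0)" by (simp add: sum.delta)
          moreover have "\<bar>u k y\<bar> = (if k = i then \<bar>u i y\<bar> else 0)" for k using z by simp
          then have "(\<Sum>k<n. \<bar>u k y\<bar>) = (if i < n then \<bar>u i y\<bar> else 0)" by (simp add: sum.delta)
          ultimately show ?thesis by simp
        qed (simp add: u_eq)
      qed
      have "(\<Sum>i<n. \<Sum>j<m. r i j * (\<integral>y. T (\<beta> j) y * \<gamma> i y \<partial>N)) \<le> (\<Sum>i<n. C * (\<integral>y. \<bar>u i y\<bar> \<partial>N))"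
        unfolding u_def by (intro sum_mono C(2) r)
      also have "\<dots> = C * (\<integral>y. (\<Sum>i<n. \<bar>u i y\<bar>) \<partial>N)"
        using ui by (simp add: Bochner_Integration.integral_sum sum_distrib_left)
      also have "(\<integral>y. (\<Sum>i<n. \<bar>u i y\<bar>) \<partial>N) = (\<integral>y. \<bar>\<Sum>i<n. u i y\<bar> \<partial>N)"
        using ui disj by (intro integral_cong_AE) auto
      also have "C * \<dots> \<le> C * (K * ?pn (\<lambda>y. \<Sum>i<n. u i y))"
        using K(2)[OF lin2[where n = n and m = m and r = r]] C(1) by (intro mult_left_mono) (auto simp: u_def)
      finally show ?thesis by (simp add: u_def mult.assoc)
    qed
    moreover have "0 < C * K" using C(1) K(1) by simp
    ultimately show ?thesis by blast
  qed
  have AD: "?D" if E: ?E and G: "?G = Linf N" and A: ?A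
  proof -
    obtain g where g: "g \<in> ?G" "\<And>n. AE y in N. T (\<beta> n) y = g y * ?s n y" using AB[OF A] by blast
    obtain K where K: "AE y in N. \<bar>g y\<bar> \<le> K" using g(1) G by (auto simp: Linf_def)
    \<comment> \<open>An essential bound \<open>K\<close> may be 0, or negative on a null space,
      whereas (d) asks for a positive constant; hence \<open>\<bar>K\<bar> + 1\<close>.\<close>
    have "(\<Sum>j<m. r j * (\<integral>y. T (\<beta> j) y * \<gamma> n y \<partial>N)) \<le> (\<bar>K\<bar> + 1) * (\<integral>y. \<bar>\<Sum>j<m. r j * ?s j y * \<gamma> n y\<bar> \<partial>N)"
      for n m and r :: "nat \<Rightarrow> real"
    proof -
      define u where "u y = (\<Sum>j<m. r j * ?s j y * \<gamma> n y)" for y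
      have i: "integrable N (\<lambda>y. g y * (?s j y * \<gamma> n y))" for j
        using g(1) s \<gamma> by (auto simp: P.multiplier_iff mult.assoc)
      \<comment> \<open>The inclusion of Y2 in Y1'' makes the products integrable by themselves, so
        that the right-hand side of (d) is a genuine integral.\<close>
      have s\<gamma>i: "integrable N (\<lambda>y. ?s j y * \<gamma> n y)" for j
        using E s[of j] Z.kdual_integrable[OF _ \<gamma>[of n]] by blast
      then have ui: "integrable N u" by (auto simp: u_def[abs_def] mult.assoc)
      have eq: "(\<Sum>j<m. r j * (g y * (?s j y * \<gamma> n y))) = g y * u y" for y
        by (simp add: u_def sum_distrib_left ac_simps)
      have "(\<Sum>j<m. r j * (\<integral>y. T (\<beta> j) y * \<gamma> n y \<partial>N)) = (\<integral>y. (\<Sum>j<m. r j * (g y * (?s j y * \<gamma> n y))) \<partial>N)"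
        using i by (simp add: moment[OF g] Bochner_Integration.integral_sum)
      also have "\<dots> = (\<integral>y. g y * u y \<partial>N)" unfolding eq ..
      also have "\<dots> \<le> (\<integral>y. (\<bar>K\<bar> + 1) * \<bar>u y\<bar> \<partial>N)"
      proof (rule integral_mono_AE)
        have "integrable N (\<lambda>y. \<Sum>j<m. r j * (g y * (?s j y * \<gamma> n y)))" using i by auto
        then show "integrable N (\<lambda>y. g y * u y)" unfolding eq .
        show "integrable N (\<lambda>y. (\<bar>K\<bar> + 1) * \<bar>u y\<bar>)" using ui by auto
        show "AE y in N. g y * u y \<le> (\<bar>K\<bar> + 1) * \<bar>u y\<bar>"
          using K
        proof eventually_elim
          case (elim y)
          have "g y * u y \<le> \<bar>g y\<bar> * \<bar>u y\<bar>" by (simp add: abs_mult[symmetric])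
          also have "\<dots> \<le> (\<bar>K\<bar> + 1) * \<bar>u y\<bar>" using elim by (intro mult_right_mono) auto
          finally show ?case .
        qed
      qed
      finally show ?thesis by (simp add: u_def)
    qed
    moreover have "0 < \<bar>K\<bar> + 1" by simp
    ultimately show ?thesis by blast
  qed
  have DA: "?A" if ?E ?D by (rule BA[OF CB[OF DC[OF that]]])
  have "?A \<longleftrightarrow> ?B" by (rule iffI[OF AB BA])
  moreover have "?B \<longleftrightarrow> ?C" by (rule iffI[OF BC CB])
  moreover have "?E \<longrightarrow> ?D \<longrightarrow> ?A" by (intro impI DA)
  moreover have "?E \<and> ?G = Linf N \<longrightarrow> (?D \<longleftrightarrow> ?A)"
  proof
    assume *: "?E \<and> ?G = Linf N"
    show "?D \<longleftrightarrow> ?A" by (rule iffI[OF DA[OF conjunct1[OF *]] AD[OF conjunct1[OF *] conjunct2[OF *]]])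
  qed
  ultimately show ?thesis unfolding Let_def by (intro conjI)
qed

end
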